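(* Let $\Lambda$ be a dominant integral weight of the affine Lie algebra $A^{(1)}_\ell$. For any defect $d$ (a non-negative integer) there is a minimal degree $N(d)$ such that every weight $\lambda\in P(\Lambda)$ of defect $d$ and of degree $n\ge N(d)$ is, for some residue $i\in\{0,\dots,\ell\}$, at the end of an $i$-string of the reduced crystal $\hat P(\Lambda)$ whose other end is a vertex of lower degree.
   Context: Let $\mathfrak g$ be the affine Lie algebra $A^{(1)}_\ell$, $e=\ell+1\ge 2$, with simple roots $\alpha_0,\dots,\alpha_\ell$, simple coroots $\alpha_i^\vee$, fundamental weights $\Lambda_0,\dots,\Lambda_\ell$ and null root $\delta=\alpha_0+\dots+\alpha_\ell$. Let $(\cdot\mid\cdot)$ be the standard symmetric form on the weight space, so that $(\lambda\mid\alpha_i)=\langle\lambda,\alpha_i^\vee\rangle$ and $(\alpha_i\mid\alpha_j)$ is the $(i,j)$ entry of the Cartan matrix. Let $Q_+=\bigoplus_i\mathbb Z_{\ge0}\alpha_i$. Let $\Lambda=a_0\Lambda_0+\dots+a_\ell\Lambda_\ell$ be a dominant integral weight, $V(\Lambda)$ the irreducible highest weight module of highest weight $\Lambda$, $P(\Lambda)$ its set of weights, and $B(\Lambda)$ its Kashiwara crystal with crystal operators $\tilde e_i,\tilde f_i$. Every $\lambda\in P(\Lambda)$ has the form $\Lambda-\alpha$ with $\alpha=\sum_i c_i\alpha_i\in Q_+$. Its content is $(c_0,\dots,c_\ell)$, its degree is $c_0+\dots+c_\ell$, and its defect is $\operatorname{def}(\lambda)=\tfrac12\big((\Lambda\mid\Lambda)-(\lambda\mid\lambda)\big)=(\Lambda\mid\alpha)-\tfrac12(\alpha\mid\alpha)$.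 The reduced crystal $\hat P(\Lambda)$ is the graph with vertex set $P(\Lambda)$ in which two weights are joined by an edge of residue $i$ if there are two elements of $B(\Lambda)$ with those weights that are connected by $\tilde e_i$ or $\tilde f_i$ (so the two weights differ by $\alpha_i$). An $i$-string is a maximal finite set of vertices connected by edges of residue $i$; it has the form $\mu,\mu-\alpha_i,\dots,\mu-w\alpha_i$, and its two ends are $\mu$ (low-degree end) and $\mu-w\alpha_i$ (high-degree end). *)

theory Defs
  imports
    Complex_Main
    "HOL-Library.Function_Algebras"
    "HOL-Library.Product_Plus"
    "HOL-Computational_Algebra.Computational_Algebra"
begin

section \<open>Weights of the affine Lie algebra of type $A^{(1)}_\ell$\<close>

text \<open>
  Everything is parametrised by \<open>l\<close>, with \<open>l \<ge> 1\<close> assumed in theorems; residues are \<open>0, \<dots>, l\<close>.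
  For \<open>l = 1\<close> the two off-diagonal terms coincide and give \<open>-2\<close>.
\<close>

definition cartan :: "nat \<Rightarrow> nat \<Rightarrow> nat \<Rightarrow> int" where
  "cartan l i j =
     2 * of_bool (i = j) - of_bool (j = Suc i mod Suc l) - of_bool (i = Suc j mod Suc l)"

text \<open>
  A weight \<open>(f, m)\<close> stands for the element \<open>\<Sum>i\<le>l. f i \<Lambda>\<^sub>i + m \<delta>\<close> of the weight lattice, so that
  \<open>f i\<close> is its value at the simple coroot \<open>\<alpha>\<^sub>i\<close>-check and \<open>m\<close> its value at the scaling element \<open>d\<close>.
  Dually, a coweight \<open>(h, n)\<close> stands for \<open>\<Sum>i\<le>l. h i \<alpha>\<^sub>i\<close>-check \<open>+ n d\<close>.  The lattice predicate
  forces the coordinates beyond \<open>l\<close> to vanish.  Highest weights are integral, hence so are all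
  weights of the modules considered below, and no non-integral weights are needed.
\<close>

type_synonym weight = "(nat \<Rightarrow> int) \<times> int"
type_synonym coweight = "(nat \<Rightarrow> int) \<times> int"

definition weight_lattice :: "nat \<Rightarrow> weight set" where
  "weight_lattice l = {x. \<forall>i>l. fst x i = 0}"

definition coweight_lattice :: "nat \<Rightarrow> coweight set" where
  "coweight_lattice l = {h. \<forall>i>l. fst h i = 0}"

definition pairing :: "nat \<Rightarrow> coweight \<Rightarrow> weight \<Rightarrow> int" where
  "pairing l h x = (\<Sum>i\<le>l. fst h i * fst x i) + snd h * snd x"

definition int_mult :: "int \<Rightarrow> weight \<Rightarrow> weight" where
  "int_mult c x = ((\<lambda>i. c * fst x i), c * snd x)"

definition fundamental_weight :: "nat \<Rightarrow> weight" where
  "fundamental_weight i = ((\<lambda>j. of_bool (j = i)), 0)"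

definition simple_coroot :: "nat \<Rightarrow> coweight" where
  "simple_coroot i = ((\<lambda>j. of_bool (j = i)), 0)"

definition simple_root :: "nat \<Rightarrow> nat \<Rightarrow> weight" where
  "simple_root l i = ((\<lambda>j. if j \<le> l then cartan l j i else 0), of_bool (i = 0))"

text \<open>
  The standard form, normalised by \<open>(\<Lambda>\<^sub>0|\<Lambda>\<^sub>0) = 0\<close>.  In coordinates it is determined by
  \<open>(\<Lambda>\<^sub>i|\<Lambda>\<^sub>j) = min i j - i j / (l + 1)\<close>, \<open>(\<Lambda>\<^sub>i|\<delta>) = 1\<close> and \<open>(\<delta>|\<delta>) = 0\<close>; the lemmas
  \<open>wt_form_simple_root\<close> and \<open>wt_form_simple_roots\<close> below are its defining properties.
\<close>

definition wt_form :: "nat \<Rightarrow> weight \<Rightarrow> weight \<Rightarrow> rat" where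
  "wt_form l x y =
     (\<Sum>i\<le>l. \<Sum>j\<le>l. of_int (fst x i * fst y j) *
        (of_nat (min i j) - of_nat i * of_nat j / of_nat (Suc l)))
     + of_int ((\<Sum>i\<le>l. fst x i) * snd y + snd x * (\<Sum>i\<le>l. fst y i))"

definition defect :: "nat \<Rightarrow> weight \<Rightarrow> weight \<Rightarrow> rat" where
  "defect l \<Lambda> x = (wt_form l \<Lambda> \<Lambda> - wt_form l x x) / 2"

text \<open>The content is well defined on \<open>\<Lambda> - Q\<^sub>+\<close> since the simple roots are linearly independent.\<close>

definition content :: "nat \<Rightarrow> weight \<Rightarrow> weight \<Rightarrow> nat \<Rightarrow> nat" where
  "content l \<Lambda> x = (THE c. (\<forall>i>l. c i = 0) \<and>
     x = \<Lambda> - (\<Sum>i\<le>l. int_mult (int (c i)) (simple_root l i)))"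

definition degree_of_weight :: "nat \<Rightarrow> weight \<Rightarrow> weight \<Rightarrow> nat" where
  "degree_of_weight l \<Lambda> x = (\<Sum>i\<le>l. content l \<Lambda> x i)"


section \<open>Irreducible highest weight modules of the Lie algebra\<close>

text \<open>
  A module over the Kac--Moody algebra with Chevalley generators \<open>e\<^sub>i, f\<^sub>i\<close> and Cartan subalgebra
  spanned by the coweight lattice is a complex vector space with operators satisfying the
  defining relations (including the Serre relations) of the algebra.
\<close>

record 'v lie_rep =
  lscale :: "complex \<Rightarrow> 'v \<Rightarrow> 'v"
  lE :: "nat \<Rightarrow> 'v \<Rightarrow> 'v"
  lF :: "nat \<Rightarrow> 'v \<Rightarrow> 'v"
  lH :: "coweight \<Rightarrow> 'v \<Rightarrow> 'v"

definition commutator :: "('v \<Rightarrow> 'v::ab_group_add) \<Rightarrow> ('v \<Rightarrow> 'v) \<Rightarrow> 'v \<Rightarrow> 'v" where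
  "commutator X Y = (\<lambda>v. X (Y v) - Y (X v))"

definition affine_module :: "nat \<Rightarrow> 'v::ab_group_add lie_rep \<Rightarrow> bool" where
  "affine_module l V \<longleftrightarrow>
     vector_space (lscale V) \<and>
     (\<forall>i\<le>l. Vector_Spaces.linear (lscale V) (lscale V) (lE V i)) \<and>
     (\<forall>i\<le>l. Vector_Spaces.linear (lscale V) (lscale V) (lF V i)) \<and>
     (\<forall>h\<in>coweight_lattice l. Vector_Spaces.linear (lscale V) (lscale V) (lH V h)) \<and>
     (\<forall>h\<in>coweight_lattice l. \<forall>h'\<in>coweight_lattice l. \<forall>v.
        lH V (h + h') v = lH V h v + lH V h' v \<and> commutator (lH V h) (lH V h') v = 0) \<and>
     (\<forall>h\<in>coweight_lattice l. \<forall>i\<le>l. \<forall>v.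
        commutator (lH V h) (lE V i) v
          = lscale V (of_int (pairing l h (simple_root l i))) (lE V i v) \<and>
        commutator (lH V h) (lF V i) v
          = lscale V (- of_int (pairing l h (simple_root l i))) (lF V i v)) \<and>
     (\<forall>i\<le>l. \<forall>j\<le>l. \<forall>v.
        commutator (lE V i) (lF V j) v = (if i = j then lH V (simple_coroot i) v else 0)) \<and>
     (\<forall>i\<le>l. \<forall>j\<le>l. i \<noteq> j \<longrightarrow> (\<forall>v.
        (commutator (lE V i) ^^ nat (1 - cartan l i j)) (lE V j) v = 0 \<and>
        (commutator (lF V i) ^^ nat (1 - cartan l i j)) (lF V j) v = 0))"

definition lie_submodule :: "nat \<Rightarrow> 'v::ab_group_add lie_rep \<Rightarrow> 'v set \<Rightarrow> bool" where
  "lie_submodule l V W \<longleftrightarrow> module.subspace (lscale V) W \<and>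
     (\<forall>w\<in>W. (\<forall>i\<le>l. lE V i w \<in> W \<and> lF V i w \<in> W) \<and> (\<forall>h\<in>coweight_lattice l. lH V h w \<in> W))"

definition lie_weight_space :: "nat \<Rightarrow> 'v::ab_group_add lie_rep \<Rightarrow> weight \<Rightarrow> 'v set" where
  "lie_weight_space l V x =
     {v. \<forall>h\<in>coweight_lattice l. lH V h v = lscale V (of_int (pairing l h x)) v}"

definition lie_irreducible_hw :: "nat \<Rightarrow> weight \<Rightarrow> 'v::ab_group_add lie_rep \<Rightarrow> bool" where
  "lie_irreducible_hw l \<Lambda> V \<longleftrightarrow>
     affine_module l V \<and>
     (\<forall>W. lie_submodule l V W \<longrightarrow> W = {0} \<or> W = UNIV) \<and>
     (\<exists>v. v \<noteq> 0 \<and> v \<in> lie_weight_space l V \<Lambda> \<and> (\<forall>i\<le>l. lE V i v = 0) \<and>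
          (\<forall>W. lie_submodule l V W \<and> v \<in> W \<longrightarrow> W = UNIV))"

definition lie_weights :: "nat \<Rightarrow> 'v::ab_group_add lie_rep \<Rightarrow> weight set" where
  "lie_weights l V = {x \<in> weight_lattice l. lie_weight_space l V x \<noteq> {0}}"


section \<open>Irreducible highest weight modules of the quantum group\<close>

text \<open>The base field is \<open>\<rat>(q)\<close>; the Cartan matrix is symmetric, so \<open>q\<^sub>i = q\<close> for every residue.\<close>

type_synonym ratq = "rat poly fract"

definition qvar :: ratq where
  "qvar = Fract [:0, 1:] 1"

definition qint :: "nat \<Rightarrow> ratq" where
  "qint n = (qvar powi int n - qvar powi (- int n)) / (qvar - qvar powi (-1))"

definition qfact :: "nat \<Rightarrow> ratq" where
  "qfact n = (\<Prod>k=1..n. qint k)"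

record 'w q_rep =
  qscale :: "ratq \<Rightarrow> 'w \<Rightarrow> 'w"
  qE :: "nat \<Rightarrow> 'w \<Rightarrow> 'w"
  qF :: "nat \<Rightarrow> 'w \<Rightarrow> 'w"
  qK :: "coweight \<Rightarrow> 'w \<Rightarrow> 'w"  \<comment> \<open>the action of \<open>q\<^sup>h\<close>\<close>

definition dividedE :: "'w q_rep \<Rightarrow> nat \<Rightarrow> nat \<Rightarrow> 'w \<Rightarrow> 'w" where
  "dividedE M i n v = qscale M (inverse (qfact n)) ((qE M i ^^ n) v)"

definition dividedF :: "'w q_rep \<Rightarrow> nat \<Rightarrow> nat \<Rightarrow> 'w \<Rightarrow> 'w" where
  "dividedF M i n v = qscale M (inverse (qfact n)) ((qF M i ^^ n) v)"

definition quantum_module :: "nat \<Rightarrow> 'w::ab_group_add q_rep \<Rightarrow> bool" where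
  "quantum_module l M \<longleftrightarrow>
     vector_space (qscale M) \<and>
     (\<forall>i\<le>l. Vector_Spaces.linear (qscale M) (qscale M) (qE M i)) \<and>
     (\<forall>i\<le>l. Vector_Spaces.linear (qscale M) (qscale M) (qF M i)) \<and>
     (\<forall>h\<in>coweight_lattice l. Vector_Spaces.linear (qscale M) (qscale M) (qK M h)) \<and>
     (\<forall>v. qK M 0 v = v) \<and>
     (\<forall>h\<in>coweight_lattice l. \<forall>h'\<in>coweight_lattice l. \<forall>v.
        qK M (h + h') v = qK M h (qK M h' v)) \<and>
     (\<forall>h\<in>coweight_lattice l. \<forall>i\<le>l. \<forall>v.
        qK M h (qE M i (qK M (- h) v))
          = qscale M (qvar powi pairing l h (simple_root l i)) (qE M i v) \<and>
        qK M h (qF M i (qK M (- h) v))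
          = qscale M (qvar powi (- pairing l h (simple_root l i))) (qF M i v)) \<and>
     (\<forall>i\<le>l. \<forall>j\<le>l. \<forall>v.
        commutator (qE M i) (qF M j) v =
          (if i = j
           then qscale M (inverse (qvar - qvar powi (-1)))
                  (qK M (simple_coroot i) v - qK M (- simple_coroot i) v)
           else 0)) \<and>
     (\<forall>i\<le>l. \<forall>j\<le>l. i \<noteq> j \<longrightarrow> (\<forall>v. let m = nat (1 - cartan l i j) in
        (\<Sum>k\<le>m. qscale M ((-1) ^ k) (dividedE M i (m - k) (qE M j (dividedE M i k v)))) = 0 \<and>
        (\<Sum>k\<le>m. qscale M ((-1) ^ k) (dividedF M i (m - k) (qF M j (dividedF M i k v)))) = 0))"

definition q_submodule :: "nat \<Rightarrow> 'w::ab_group_add q_rep \<Rightarrow> 'w set \<Rightarrow> bool" where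
  "q_submodule l M W \<longleftrightarrow> module.subspace (qscale M) W \<and>
     (\<forall>w\<in>W. (\<forall>i\<le>l. qE M i w \<in> W \<and> qF M i w \<in> W) \<and> (\<forall>h\<in>coweight_lattice l. qK M h w \<in> W))"

definition q_weight_space :: "nat \<Rightarrow> 'w::ab_group_add q_rep \<Rightarrow> weight \<Rightarrow> 'w set" where
  "q_weight_space l M x =
     {v. \<forall>h\<in>coweight_lattice l. qK M h v = qscale M (qvar powi pairing l h x) v}"

definition q_irreducible_hw :: "nat \<Rightarrow> weight \<Rightarrow> 'w::ab_group_add q_rep \<Rightarrow> bool" where
  "q_irreducible_hw l \<Lambda> M \<longleftrightarrow>
     quantum_module l M \<and>
     (\<forall>W. q_submodule l M W \<longrightarrow> W = {0} \<or> W = UNIV) \<and>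
     (\<exists>v. v \<noteq> 0 \<and> v \<in> q_weight_space l M \<Lambda> \<and> (\<forall>i\<le>l. qE M i v = 0) \<and>
          (\<forall>W. q_submodule l M W \<and> v \<in> W \<longrightarrow> W = UNIV))"


section \<open>Kashiwara's crystal bases\<close>

text \<open>
  Every \<open>u\<close> in an integrable module with weight decomposition is a finite sum of terms
  \<open>f\<^sub>i\<^sup>(\<^sup>k\<^sup>) u\<^sub>k\<^sub>,\<^sub>x\<close> where \<open>u\<^sub>k\<^sub>,\<^sub>x\<close> has weight \<open>x\<close>, is killed by \<open>e\<^sub>i\<close>, and \<open>k\<close> is at most the value of \<open>x\<close> at the
  \<open>i\<close>-th coroot; the nonzero components are unique.  The Kashiwara operators shift the
  divided powers in this decomposition down or up by one.
\<close>

definition kashiwara_decomp ::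
    "nat \<Rightarrow> 'w::ab_group_add q_rep \<Rightarrow> nat \<Rightarrow> 'w \<Rightarrow> (nat \<times> weight) set \<Rightarrow> (nat \<times> weight \<Rightarrow> 'w) \<Rightarrow> bool"
  where
  "kashiwara_decomp l M i u S c \<longleftrightarrow>
     finite S \<and>
     (\<forall>(k, x)\<in>S. x \<in> weight_lattice l \<and> int k \<le> pairing l (simple_coroot i) x \<and>
        c (k, x) \<in> q_weight_space l M x \<and> qE M i (c (k, x)) = 0) \<and>
     u = (\<Sum>p\<in>S. dividedF M i (fst p) (c p))"

definition kashiwara_e :: "nat \<Rightarrow> 'w::ab_group_add q_rep \<Rightarrow> nat \<Rightarrow> 'w \<Rightarrow> 'w" where
  "kashiwara_e l M i u = (THE w. \<exists>S c. kashiwara_decomp l M i u S c \<and>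
     w = (\<Sum>p\<in>S. if fst p = 0 then 0 else dividedF M i (fst p - 1) (c p)))"

definition kashiwara_f :: "nat \<Rightarrow> 'w::ab_group_add q_rep \<Rightarrow> nat \<Rightarrow> 'w \<Rightarrow> 'w" where
  "kashiwara_f l M i u = (THE w. \<exists>S c. kashiwara_decomp l M i u S c \<and>
     w = (\<Sum>p\<in>S. dividedF M i (Suc (fst p)) (c p)))"

text \<open>The subring of \<open>\<rat>(q)\<close> of functions regular at \<open>q = 0\<close>.\<close>

definition regular_at_0 :: "ratq set" where
  "regular_at_0 = {Fract a b | a b. poly b 0 \<noteq> 0}"

text \<open>
  A crystal lattice is a free \<open>regular_at_0\<close>-submodule generating the module over \<open>\<rat>(q)\<close> (equivalently,
  the \<open>regular_at_0\<close>-span of a \<open>\<rat>(q)\<close>-basis), compatible with weights and stable under the Kashiwara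
  operators.
\<close>

definition crystal_lattice :: "nat \<Rightarrow> 'w::ab_group_add q_rep \<Rightarrow> 'w set \<Rightarrow> bool" where
  "crystal_lattice l M L \<longleftrightarrow>
     (\<exists>X. \<not> module.dependent (qscale M) X \<and> module.span (qscale M) X = UNIV \<and>
        L = {\<Sum>x\<in>S. qscale M (c x) x | S c. finite S \<and> S \<subseteq> X \<and> (\<forall>x\<in>S. c x \<in> regular_at_0)}) \<and>
     (\<forall>u\<in>L. \<exists>S c. finite S \<and> S \<subseteq> weight_lattice l \<and>
        (\<forall>x\<in>S. c x \<in> L \<inter> q_weight_space l M x) \<and> u = (\<Sum>x\<in>S. c x)) \<and>
     (\<forall>i\<le>l. \<forall>u\<in>L. kashiwara_e l M i u \<in> L \<and> kashiwara_f l M i u \<in> L)"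

text \<open>
  Elements of \<open>L / qL\<close> are cosets; \<open>bar_e\<close> and \<open>bar_f\<close> are the maps induced on \<open>L / qL\<close>.  For a crystal lattice
  the cosets united in their definitions all coincide.
\<close>

definition q_coset :: "'w::ab_group_add q_rep \<Rightarrow> 'w set \<Rightarrow> 'w \<Rightarrow> 'w set" where
  "q_coset M L u = {u + qscale M qvar y | y. y \<in> L}"

definition bar_e :: "nat \<Rightarrow> 'w::ab_group_add q_rep \<Rightarrow> 'w set \<Rightarrow> nat \<Rightarrow> 'w set \<Rightarrow> 'w set" where
  "bar_e l M L i b = (\<Union>u\<in>b. q_coset M L (kashiwara_e l M i u))"

definition bar_f :: "nat \<Rightarrow> 'w::ab_group_add q_rep \<Rightarrow> 'w set \<Rightarrow> nat \<Rightarrow> 'w set \<Rightarrow> 'w set" where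
  "bar_f l M L i b = (\<Union>u\<in>b. q_coset M L (kashiwara_f l M i u))"

definition crystal_weight ::
    "nat \<Rightarrow> 'w::ab_group_add q_rep \<Rightarrow> 'w set \<Rightarrow> 'w set \<Rightarrow> weight \<Rightarrow> bool" where
  "crystal_weight l M L b x \<longleftrightarrow>
     x \<in> weight_lattice l \<and> (\<exists>u \<in> L \<inter> q_weight_space l M x. b = q_coset M L u)"

text \<open>
  \<open>B\<close> is a basis of the \<open>\<rat>\<close>-vector space \<open>L / qL\<close>.  Linear combinations of elements of \<open>B\<close> are expressed
  through finite sets \<open>S\<close> of representatives in \<open>L\<close>; rationals act as constants of \<open>\<rat>(q)\<close>.
\<close>

definition basis_mod_q :: "'w::ab_group_add q_rep \<Rightarrow> 'w set \<Rightarrow> 'w set set \<Rightarrow> bool" where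
  "basis_mod_q M L B \<longleftrightarrow>
     B \<subseteq> q_coset M L ` L \<and>
     (\<forall>S (c :: 'w \<Rightarrow> rat). finite S \<and> S \<subseteq> L \<and> inj_on (q_coset M L) S \<and> q_coset M L ` S \<subseteq> B \<and>
        (\<Sum>u\<in>S. qscale M (Fract [:c u:] 1) u) \<in> q_coset M L 0 \<longrightarrow> (\<forall>u\<in>S. c u = 0)) \<and>
     (\<forall>x\<in>L. \<exists>S (c :: 'w \<Rightarrow> rat). finite S \<and> S \<subseteq> L \<and> q_coset M L ` S \<subseteq> B \<and>
        x \<in> q_coset M L (\<Sum>u\<in>S. qscale M (Fract [:c u:] 1) u))"

definition crystal_base ::
    "nat \<Rightarrow> 'w::ab_group_add q_rep \<Rightarrow> 'w set \<Rightarrow> 'w set set \<Rightarrow> bool" where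
  "crystal_base l M L B \<longleftrightarrow>
     crystal_lattice l M L \<and>
     basis_mod_q M L B \<and>
     (\<forall>b\<in>B. \<exists>x. crystal_weight l M L b x) \<and>
     (\<forall>i\<le>l. \<forall>b\<in>B. bar_e l M L i b \<in> B \<union> {q_coset M L 0} \<and>
                    bar_f l M L i b \<in> B \<union> {q_coset M L 0}) \<and>
     (\<forall>i\<le>l. \<forall>b\<in>B. \<forall>b'\<in>B. bar_f l M L i b = b' \<longleftrightarrow> b = bar_e l M L i b')"


section \<open>The reduced crystal and its strings\<close>

text \<open>
  The vertex set \<open>P\<close> consists of the weights of the module of the Lie algebra, while the edges come
  from the crystal base \<open>(L, B)\<close> of the module \<open>M\<close> of the quantum group.
\<close>

definition reduced_edge ::
    "nat \<Rightarrow> weight set \<Rightarrow> 'w::ab_group_add q_rep \<Rightarrow> 'w set \<Rightarrow> 'w set set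
      \<Rightarrow> nat \<Rightarrow> weight \<Rightarrow> weight \<Rightarrow> bool" where
  "reduced_edge l P M L B i x y \<longleftrightarrow>
     x \<in> P \<and> y \<in> P \<and>
     (\<exists>b\<in>B. \<exists>b'\<in>B. crystal_weight l M L b x \<and> crystal_weight l M L b' y \<and>
        (bar_e l M L i b = b' \<or> bar_f l M L i b = b'))"

definition edge_connected ::
    "nat \<Rightarrow> weight set \<Rightarrow> 'w::ab_group_add q_rep \<Rightarrow> 'w set \<Rightarrow> 'w set set
      \<Rightarrow> nat \<Rightarrow> weight set \<Rightarrow> bool" where
  "edge_connected l P M L B i S \<longleftrightarrow>
     S \<noteq> {} \<and> S \<subseteq> P \<and>
     (\<forall>x\<in>S. \<forall>y\<in>S. (x, y) \<in> {(s, t). s \<in> S \<and> t \<in> S \<and> reduced_edge l P M L B i s t}\<^sup>*)"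

definition is_residue_string ::
    "nat \<Rightarrow> weight set \<Rightarrow> 'w::ab_group_add q_rep \<Rightarrow> 'w set \<Rightarrow> 'w set set
      \<Rightarrow> nat \<Rightarrow> weight set \<Rightarrow> bool" where
  "is_residue_string l P M L B i S \<longleftrightarrow>
     finite S \<and> edge_connected l P M L B i S \<and>
     (\<forall>T. finite T \<and> edge_connected l P M L B i T \<and> S \<subseteq> T \<longrightarrow> T = S)"

definition string_ends :: "nat \<Rightarrow> nat \<Rightarrow> weight set \<Rightarrow> weight \<Rightarrow> weight \<Rightarrow> bool" where
  "string_ends l i S low high \<longleftrightarrow>
     (\<exists>w::nat. S = {low - int_mult (int k) (simple_root l i) | k. k \<le> w} \<and>
               high = low - int_mult (int w) (simple_root l i))"


section \<open>The defining properties of the form\<close>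

lemma cartan_row_sum:
  fixes g :: "nat \<Rightarrow> rat"
  assumes "l \<ge> 1" "i \<le> l"
  shows "(\<Sum>k\<le>l. of_int (cartan l k i) * g k) =
     2 * g i - g (if i = l then 0 else Suc i) - g (if i = 0 then l else i - 1)"
proof -
  have 1: "(i = Suc k mod Suc l) \<longleftrightarrow> k = (if i = 0 then l else i - 1)" if "k \<le> l" for k
    using that assms by (cases "k = l") auto
  have 2: "(k = Suc i mod Suc l) \<longleftrightarrow> k = (if i = l then 0 else Suc i)" for k
    using assms by (cases "i = l") auto
  have "(\<Sum>k\<le>l. of_int (cartan l k i) * g k) =
     (\<Sum>k\<le>l. 2 * (if k = i then g k else 0)
        - (if k = (if i = l then 0 else Suc i) then g k else 0)
        - (if k = (if i = 0 then l else i - 1) then g k else 0))"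
    by (rule sum.cong) (auto simp: cartan_def 1 2 algebra_simps)
  also have "\<dots> = 2 * g i - g (if i = l then 0 else Suc i) - g (if i = 0 then l else i - 1)"
    using assms by (auto simp: sum_subtractf simp flip: sum_distrib_left)
  finally show ?thesis .
qed

lemma wt_form_simple_root:
  assumes "l \<ge> 1" "i \<le> l"
  shows "wt_form l x (simple_root l i) = of_int (fst x i)"
proof -
  let ?G = "\<lambda>j k. of_nat (min j k) - of_nat j * of_nat k / of_nat (Suc l) :: rat"
  have inner: "(\<Sum>k\<le>l. of_int (cartan l k i) * ?G j k) = of_bool (j = i) - of_bool (i = 0)"
    if "j \<le> l" for j
  proof -
    define c :: rat where "c = of_nat j / of_nat (Suc l)"
    have c: "c * of_nat l = of_nat j - c" by (simp add: c_def field_simps)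
    have G: "?G j k = of_nat (min j k) - c * of_nat k" for k by (simp add: c_def)
    consider "i = 0" | "i = l" "i \<noteq> 0" | m where "i = Suc m" "i \<noteq> l"
      by (cases i) auto
    then show ?thesis
    proof cases
      case 1
      then show ?thesis using that assms unfolding cartan_row_sum[OF assms] G
        by (auto simp: c min_def algebra_simps)
    next
      case 2
      then obtain m where m: "l = Suc m" by (cases l) auto
      have "c * of_nat m = of_nat j - 2 * c" using c by (simp add: m algebra_simps)
      then show ?thesis using that assms 2 unfolding cartan_row_sum[OF assms] G
        by (auto simp: m min_def algebra_simps le_Suc_eq)
    next
      case 3
      then show ?thesis using that assms unfolding cartan_row_sum[OF assms] G
        by (auto simp: min_def algebra_simps le_Suc_eq)
    qed
  qed
  have level: "(\<Sum>k\<le>l. cartan l k i) = 0"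
    using cartan_row_sum[OF assms, of "\<lambda>_. 1"] by (simp flip: of_int_sum)
  have "(\<Sum>j\<le>l. \<Sum>k\<le>l. of_int (fst x j * fst (simple_root l i) k) * ?G j k)
      = (\<Sum>j\<le>l. of_int (fst x j) * (\<Sum>k\<le>l. of_int (cartan l k i) * ?G j k))"
    by (simp add: sum_distrib_left simple_root_def mult.assoc)
  also have "\<dots> = (\<Sum>j\<le>l. (if j = i then of_int (fst x j) else 0) - of_bool (i = 0) * of_int (fst x j))"
    by (rule sum.cong) (simp_all only: inner atMost_iff, auto simp: algebra_simps)
  also have "\<dots> = of_int (fst x i) - of_bool (i = 0) * of_int (\<Sum>j\<le>l. fst x j)"
    using assms by (simp add: sum_subtractf flip: sum_distrib_left)
  finally show ?thesis
    using level by (auto simp: wt_form_def simple_root_def)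
qed

corollary wt_form_simple_roots:
  assumes "l \<ge> 1" "i \<le> l" "j \<le> l"
  shows "wt_form l (simple_root l i) (simple_root l j) = of_int (cartan l i j)"
  using assms by (simp add: wt_form_simple_root)  (simp add: simple_root_def cartan_def)

end

(*
  A weight x of defect d with value -w at the i-th coroot has
  def(x + j alpha_i) = d + j w - j^2.  If w > d, this is negative for j = -1 and for j = w + 1, so
  neither x - alpha_i nor x + (w + 1) alpha_i is a weight, and x is the high end of the i-string
  x + w alpha_i, ..., x.  If instead all coordinates of x are at least -d, then, their sum being the
  level, there are finitely many possibilities for them; for positive level the form then
  determines the coefficient of delta, so only finitely many weights of defect d are excluded.

  That the string is connected in the crystal rests on two facts.  First, the modules of the Lie
  algebra and of the quantum group have the same weights: both weight sets are stable under the
  simple reflections, and both contain every dominant weight below Lambda, as a maximum principle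
  on the cyclic Dynkin diagram shows.  Second, a representative u of a crystal element of weight x
  is a lowest weight vector, so u is the w-th divided power of f_i applied to some t, and the
  Kashiwara operators just move along the divided powers of f_i applied to t.
*)
theory Submission
  imports Defs
begin

section \<open>The root lattice and the form\<close>

text \<open>The vertices come from the Lie algebra and the edges from the quantum group, over
  different fields. The representation theory is therefore developed once, for abstract operators
  \<open>E\<close>, \<open>F\<close> whose commutator acts on each weight space by a scalar
  \<open>c\<close>, an integer or a quantum integer. Integrability is not part of the definition of
  the modules: local nilpotency of \<open>F\<close> is derived from the Serre relations before
  strings and reflections become available, and non-negativity of the defect follows by reflecting a
  weight until it is dominant. Level zero is treated apart, since there the form says nothing about
  the coefficient of delta; the only weight is then Lambda. Two facts on crystal bases need an
  argument modulo q. Every weight carries a crystal element, because the lattice is graded by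
  weights. And raising a crystal element inside its string never gives zero modulo q: otherwise q
  could be divided out of the raised vector, and lowering the quotient would show that the original
  class was zero already.\<close>

definition cyc_succ :: "nat \<Rightarrow> nat \<Rightarrow> nat" where
  "cyc_succ l i = (if i = l then 0 else Suc i)"

definition cyc_pred :: "nat \<Rightarrow> nat \<Rightarrow> nat" where
  "cyc_pred l i = (if i = 0 then l else i - 1)"

lemma cyc_succ_le: "i \<le> l \<Longrightarrow> cyc_succ l i \<le> l"
  by (auto simp: cyc_succ_def)

lemma cyc_pred_le: "i \<le> l \<Longrightarrow> cyc_pred l i \<le> l"
  by (auto simp: cyc_pred_def)

text \<open>Stepping forwards is enough: from \<open>i\<close> up to \<open>l\<close>, across the
  wrap to 0, then up to \<open>k\<close>.\<close>

lemma cyc_succ_invariant_imp_all: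
  assumes "P i" "i \<le> l" "\<And>j. j \<le> l \<Longrightarrow> P j \<Longrightarrow> P (cyc_succ l j)" "k \<le> l"
  shows "P k"
proof -
  have up: "P j \<Longrightarrow> j + n \<le> l \<Longrightarrow> P (j + n)" for j n
  proof (induction n)
    case (Suc n)
    then show ?case using assms(3)[of "j + n"] by (simp add: cyc_succ_def)
  qed simp
  have "P l" using up[of i "l - i"] assms by simp
  then have "P 0" using assms(3)[of l] by (simp add: cyc_succ_def)
  then show ?thesis using up[of 0 k] assms by simp
qed

text \<open>Two neighbours bounded by \<open>m\<close> whose sum is at least \<open>2 * m\<close>
  both equal \<open>m\<close>, so the maximum spreads round the cycle. Asking for the inequality
  only where the maximum is attained matters in \<open>dominant_in_weights\<close>, which has it
  only at positive values.\<close>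

lemma cyclic_maximum_principle:
  fixes u :: "nat \<Rightarrow> int"
  assumes le: "\<And>i. i \<le> l \<Longrightarrow> u i \<le> m" and "i \<le> l" "u i = m"
    and sub: "\<And>i. i \<le> l \<Longrightarrow> u i = m \<Longrightarrow> 2 * u i \<le> u (cyc_succ l i) + u (cyc_pred l i)"
    and "k \<le> l"
  shows "u k = m"
  using assms(3,2) _ \<open>k \<le> l\<close>
proof (rule cyc_succ_invariant_imp_all[where P = "\<lambda>i. u i = m"])
  fix j assume "j \<le> l" "u j = m"
  then show "u (cyc_succ l j) = m"
    using sub[of j] le[OF cyc_succ_le, of j] le[OF cyc_pred_le, of j] by auto
qed

lemma cartan_sym: "cartan l i j = cartan l j i"
  by (auto simp: cartan_def)

lemma cartan_diag: "l \<ge> 1 \<Longrightarrow> i \<le> l \<Longrightarrow> cartan l i i = 2"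
  by (auto simp: cartan_def mod_Suc)

definition root_sum :: "nat \<Rightarrow> (nat \<Rightarrow> int) \<Rightarrow> weight" where
  "root_sum l c = (\<Sum>i\<le>l. int_mult (c i) (simple_root l i))"

lemma sum_fun_apply: "(\<Sum>i\<in>A. f i) j = (\<Sum>i\<in>A. f i j)"
  by (induction A rule: infinite_finite_induct) auto

lemma root_sum_eq:
  assumes "l \<ge> 1"
  shows "root_sum l c =
    (\<lambda>j. if j \<le> l then 2 * c j - c (cyc_succ l j) - c (cyc_pred l j) else 0, c 0)"
proof -
  have "(\<Sum>i\<le>l. c i * cartan l j i) = 2 * c j - c (cyc_succ l j) - c (cyc_pred l j)"
    if "j \<le> l" for j
  proof -
    \<comment> \<open>\<open>cartan_row_sum\<close> is rational and sums over the first index, hence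
      the cast and the transposition.\<close>
    have "rat_of_int (\<Sum>i\<le>l. c i * cartan l j i) = (\<Sum>i\<le>l. of_int (cartan l i j) * of_int (c i))"
      by (simp add: cartan_sym[of l j] mult.commute)
    also have "\<dots> = of_int (2 * c j - c (cyc_succ l j) - c (cyc_pred l j))"
      unfolding cartan_row_sum[OF assms that] by (simp add: cyc_succ_def cyc_pred_def)
    finally show ?thesis by (simp only: of_int_eq_iff)
  qed
  then have "fst (root_sum l c) = (\<lambda>j. if j \<le> l then 2 * c j - c (cyc_succ l j) - c (cyc_pred l j) else 0)"
    by (auto simp: root_sum_def fst_sum sum_fun_apply int_mult_def simple_root_def fun_eq_iff)
  moreover have "snd (root_sum l c) = c 0"
    by (simp add: root_sum_def snd_sum int_mult_def simple_root_def of_bool_def if_distrib[of "\<lambda>x. _ * x"] cong: if_cong)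
  ultimately show ?thesis by (simp add: prod_eq_iff)
qed

lemma root_sum_add: "root_sum l (\<lambda>i. c i + d i) = root_sum l c + root_sum l d"
  unfolding root_sum_def sum.distrib[symmetric]
  by (rule sum.cong) (auto simp: int_mult_def plus_prod_def fun_eq_iff algebra_simps)

lemma root_sum_single:
  assumes "i \<le> l"
  shows "root_sum l (\<lambda>j. if j = i then n else 0) = int_mult n (simple_root l i)"
proof -
  have "root_sum l (\<lambda>j. if j = i then n else 0) =
      (\<Sum>j\<le>l. if j = i then int_mult n (simple_root l j) else 0)"
    unfolding root_sum_def by (rule sum.cong) (auto simp: int_mult_def zero_prod_def)
  then show ?thesis using assms by simp
qed

text \<open>The difference \<open>u\<close> lies in the kernel of the affine Cartan matrix, so it is
  harmonic on the cycle and hence constant. The delta coordinate, carried by alpha_0 alone, forces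
  the constant to be 0.\<close>

lemma root_sum_inject:
  assumes "l \<ge> 1" "root_sum l c = root_sum l d" "i \<le> l"
  shows "c i = d i"
proof -
  define u where "u j = c j - d j" for j
  have u: "2 * u j = u (cyc_succ l j) + u (cyc_pred l j)" if "j \<le> l" for j
    using arg_cong[OF assms(2), of "\<lambda>x. fst x j"] that assms(1)
    by (simp add: root_sum_eq u_def)
  have "Max (u ` {..l}) \<in> u ` {..l}" by (rule Max_in) auto
  then obtain j where j: "j \<le> l" "u j = Max (u ` {..l})" by (metis atMost_iff imageE)
  have "u k = Max (u ` {..l})" if "k \<le> l" for k
    by (rule cyclic_maximum_principle[where u = u, OF _ j _ that]) (simp, rule eq_refl, rule u)
  moreover have "u 0 = 0"
    using assms(1) arg_cong[OF assms(2), of snd] by (simp add: root_sum_eq u_def)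
  ultimately have "u i = 0" using assms(3) by (metis le0)
  then show ?thesis by (simp add: u_def)
qed

section \<open>The cone Q_+ of non-negative combinations of simple roots\<close>

definition pos_root_lattice :: "nat \<Rightarrow> weight set" where
  "pos_root_lattice l = {root_sum l (\<lambda>i. int (c i)) | c. \<forall>i>l. c i = 0}"

lemma pos_root_lattice_add:
  assumes "x \<in> pos_root_lattice l" "y \<in> pos_root_lattice l"
  shows "x + y \<in> pos_root_lattice l"
proof -
  from assms obtain c d where "\<forall>i>l. c i = 0" "x = root_sum l (\<lambda>i. int (c i))"
    "\<forall>i>l. d i = 0" "y = root_sum l (\<lambda>i. int (d i))"
    by (auto simp: pos_root_lattice_def)
  then show ?thesis
    unfolding pos_root_lattice_def
    by (auto intro!: exI[of _ "\<lambda>i. c i + d i"] simp: root_sum_add)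
qed

lemma simple_root_in_pos_root_lattice:
  assumes "i \<le> l"
  shows "int_mult (int n) (simple_root l i) \<in> pos_root_lattice l"
  unfolding pos_root_lattice_def root_sum_single[OF assms, symmetric]
  by (rule CollectI, rule exI[of _ "\<lambda>j. if j = i then n else 0"]) (use assms in \<open>auto intro!: arg_cong[of _ _ "root_sum l"]\<close>)

lemma zero_in_pos_root_lattice: "0 \<in> pos_root_lattice l"
  using simple_root_in_pos_root_lattice[of 0 l 0] by (simp add: int_mult_def zero_prod_def zero_fun_def)

lemma int_mult_one [simp]: "int_mult 1 x = x"
  by (simp add: int_mult_def)

lemma int_mult_add: "int_mult (m + n) x = int_mult m x + int_mult n x"
  by (simp add: int_mult_def plus_prod_def fun_eq_iff algebra_simps)

lemma int_mult_zero [simp]: "int_mult 0 x = 0"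
  by (simp add: int_mult_def zero_prod_def zero_fun_def)

lemma int_mult_minus: "int_mult (- n) x = - int_mult n x"
  by (simp add: int_mult_def uminus_prod_def fun_eq_iff)

lemma int_mult_diff: "int_mult (m - n) x = int_mult m x - int_mult n x"
  using int_mult_add[of m "-n" x] by (simp add: int_mult_minus)

lemma fst_int_mult [simp]: "fst (int_mult n x) i = n * fst x i"
  by (simp add: int_mult_def)

text \<open>One subtraction more than the coefficient of alpha_i makes that coefficient negative.
  This will bound the powers of \<open>E i\<close> on a weight vector.\<close>

lemma pos_root_lattice_Diff_unbounded:
  assumes "l \<ge> 1" "i \<le> l" "x \<in> pos_root_lattice l"
  shows "\<exists>n. x - int_mult (int n) (simple_root l i) \<notin> pos_root_lattice l"
proof -
  from assms obtain c where c: "x = root_sum l (\<lambda>i. int (c i))"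
    by (auto simp: pos_root_lattice_def)
  show ?thesis
  proof (rule exI, rule notI)
    assume "x - int_mult (int (Suc (c i))) (simple_root l i) \<in> pos_root_lattice l"
    then obtain d where "x - int_mult (int (Suc (c i))) (simple_root l i) = root_sum l (\<lambda>i. int (d i))"
      by (auto simp: pos_root_lattice_def)
    then have "root_sum l (\<lambda>i. int (c i)) =
        root_sum l (\<lambda>j. int (d j) + (if j = i then int (Suc (c i)) else 0))"
      unfolding c root_sum_add root_sum_single[OF assms(2)] by (metis diff_add_cancel)
    from root_sum_inject[OF assms(1) this assms(2)] show False by simp
  qed
qed

text \<open>The cone is pointed, so it defines an antisymmetric order on weights;
  \<open>singular_weight_unique\<close> rests on this.\<close>

lemma pos_root_lattice_add_eq_0:
  assumes "l \<ge> 1" "x \<in> pos_root_lattice l" "y \<in> pos_root_lattice l" "x + y = 0"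
  shows "x = 0"
proof -
  from assms obtain c d where c: "\<forall>i>l. c i = 0" "x = root_sum l (\<lambda>i. int (c i))"
    and d: "y = root_sum l (\<lambda>i. int (d i))"
    by (auto simp: pos_root_lattice_def)
  have "root_sum l (\<lambda>i. int (c i) + int (d i)) = root_sum l (\<lambda>i. 0)"
    unfolding root_sum_add using c d assms(4) by (simp add: root_sum_def)
  from root_sum_inject[OF assms(1) this] have "c i = 0" if "i \<le> l" for i
    using that by force
  then show ?thesis using c by (simp add: root_sum_def)
qed

lemma simple_root_neq_0:
  assumes "l \<ge> 1" "i \<le> l" "n \<noteq> 0" shows "int_mult n (simple_root l i) \<noteq> 0"
proof
  assume "int_mult n (simple_root l i) = 0"
  then have "fst (int_mult n (simple_root l i)) i = 0" by simp
  then have "n * cartan l i i = 0"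
    using assms(2) by (simp add: simple_root_def)
  then show False using assms cartan_diag by simp
qed

lemma simple_root_in_weight_lattice: "simple_root l i \<in> weight_lattice l"
  by (auto simp: weight_lattice_def simple_root_def)

lemma weight_lattice_add: "x \<in> weight_lattice l \<Longrightarrow> y \<in> weight_lattice l \<Longrightarrow> x + y \<in> weight_lattice l"
  by (simp add: weight_lattice_def)

lemma weight_lattice_diff: "x \<in> weight_lattice l \<Longrightarrow> y \<in> weight_lattice l \<Longrightarrow> x - y \<in> weight_lattice l"
  by (simp add: weight_lattice_def)

lemma weight_lattice_int_mult: "x \<in> weight_lattice l \<Longrightarrow> int_mult n x \<in> weight_lattice l"
  by (simp add: weight_lattice_def)

lemma fst_simple_root_self: "l \<ge> 1 \<Longrightarrow> i \<le> l \<Longrightarrow> fst (simple_root l i) i = 2"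
  by (simp add: simple_root_def cartan_diag)

section \<open>The form, the defect and the level\<close>

lemma wt_form_commute: "wt_form l x y = wt_form l y x"
  unfolding wt_form_def
  by (subst (1) sum.swap) (simp add: mult.commute min.commute add.commute mult.assoc)

lemma wt_form_add_left: "wt_form l (x + y) z = wt_form l x z + wt_form l y z"
  by (simp add: wt_form_def sum.distrib distrib_right distrib_left del: of_nat_Suc)

lemma wt_form_int_mult_left: "wt_form l (int_mult n x) z = of_int n * wt_form l x z"
  by (simp add: wt_form_def int_mult_def sum_distrib_left distrib_left mult.assoc del: of_nat_Suc)

lemma wt_form_diff_left: "wt_form l (x - y) z = wt_form l x z - wt_form l y z"
  using wt_form_add_left[of l "x - y" y z] by simp

lemma wt_form_sum_left: "wt_form l (\<Sum>i\<in>A. f i) z = (\<Sum>i\<in>A. wt_form l (f i) z)"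
  by (induction A rule: infinite_finite_induct)
     (use wt_form_diff_left[of l 0 0 z] in \<open>auto simp: wt_form_add_left\<close>)

lemma wt_form_root_sum:
  assumes "l \<ge> 1"
  shows "wt_form l x (root_sum l c) = of_int (\<Sum>i\<le>l. c i * fst x i)"
  by (subst wt_form_commute)
     (auto simp: root_sum_def wt_form_sum_left wt_form_int_mult_left wt_form_commute[of l "simple_root l _" x]
      wt_form_simple_root[OF assms] intro!: sum.cong)

text \<open>The quadratic term comes from (alpha_i|alpha_i) = 2. The increment vanishes at
  \<open>n = - fst x i\<close>, which is the invariance of the form under a simple
  reflection.\<close>

lemma wt_form_add_simple_root:
  assumes "l \<ge> 1" "i \<le> l"
  shows "wt_form l (x + int_mult n (simple_root l i)) (x + int_mult n (simple_root l i)) =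
    wt_form l x x + of_int (2 * n * fst x i + 2 * n * n)"
proof -
  let ?a = "simple_root l i"
  have aa: "wt_form l ?a ?a = 2"
    unfolding wt_form_simple_root[OF assms] fst_simple_root_self[OF assms] by simp
  have expand: "wt_form l (x + int_mult n ?a) (x + int_mult n ?a) =
     wt_form l x x + 2 * of_int n * wt_form l x ?a + of_int n * of_int n * wt_form l ?a ?a"
    by (simp add: wt_form_add_left wt_form_int_mult_left wt_form_commute[of l _ "_ + _"]
       wt_form_commute[of l ?a x] wt_form_commute[of l _ "int_mult _ _"] algebra_simps)
  show ?thesis unfolding expand aa unfolding wt_form_simple_root[OF assms]
    by (simp add: algebra_simps)
qed

lemma defect_add_simple_root:
  assumes "l \<ge> 1" "i \<le> l"
  shows "defect l \<Lambda> (x + int_mult n (simple_root l i)) = defect l \<Lambda> x - of_int (n * fst x i + n * n)"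
  unfolding defect_def wt_form_add_simple_root[OF assms] by (simp add: field_simps)

definition level :: "nat \<Rightarrow> weight \<Rightarrow> int" where
  "level l x = (\<Sum>i\<le>l. fst x i)"

text \<open>The columns of the affine Cartan matrix sum to zero, that is, (delta|alpha_i) =
  0.\<close>

lemma level_root_sum: 
  assumes "l \<ge> 1"
  shows "level l (root_sum l c) = 0"
proof -
  have "level l (simple_root l i) = 0" if "i \<le> l" for i
    using cartan_row_sum[OF assms that, of "\<lambda>_. 1"]
    by (simp add: level_def simple_root_def flip: of_int_sum)
  then show ?thesis
    unfolding level_def root_sum_def
    by (simp add: fst_sum sum_fun_apply sum.swap[of _ "{..l}" "{..l}"] flip: sum_distrib_left)
qed

section \<open>Content and degree\<close>

text \<open>Linear independence of the simple roots settles the definite description in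
  \<open>content\<close>.\<close>

lemma content_eq:
  assumes "l \<ge> 1" "\<forall>i>l. c i = 0"
  shows "content l \<Lambda> (\<Lambda> - root_sum l (\<lambda>i. int (c i))) = c"
  unfolding content_def root_sum_def[symmetric]
proof (rule the_equality)
  fix d assume d: "(\<forall>i>l. d i = 0) \<and> \<Lambda> - root_sum l (\<lambda>i. int (c i)) = \<Lambda> - root_sum l (\<lambda>i. int (d i))"
  then have "int (d i) = int (c i)" if "i \<le> l" for i
    using root_sum_inject[OF assms(1) _ that, of "\<lambda>i. int (d i)" "\<lambda>i. int (c i)"] by simp
  then show "d = c" using d assms(2) by (metis ext not_le of_nat_eq_iff)
qed (use assms in auto)

lemma degree_of_weight_eq:
  assumes "l \<ge> 1" "\<forall>i>l. c i = 0"
  shows "degree_of_weight l \<Lambda> (\<Lambda> - root_sum l (\<lambda>i. int (c i))) = (\<Sum>i\<le>l. c i)"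
  by (simp add: degree_of_weight_def content_eq[OF assms])

lemma degree_of_weight_add_simple_root:
  assumes "l \<ge> 1" "i \<le> l" "\<Lambda> - x \<in> pos_root_lattice l"
    "\<Lambda> - (x + int_mult (int n) (simple_root l i)) \<in> pos_root_lattice l"
  shows "degree_of_weight l \<Lambda> x = degree_of_weight l \<Lambda> (x + int_mult (int n) (simple_root l i)) + n"
proof -
  from assms(4) obtain c where c: "\<forall>i>l. c i = 0"
    "\<Lambda> - (x + int_mult (int n) (simple_root l i)) = root_sum l (\<lambda>i. int (c i))"
    by (auto simp: pos_root_lattice_def)
  define d where "d j = c j + (if j = i then n else 0)" for j
  have d: "\<forall>i>l. d i = 0" using c(1) assms(2) by (auto simp: d_def)
  have "root_sum l (\<lambda>j. int (d j)) =
      root_sum l (\<lambda>j. int (c j) + (if j = i then int n else 0))"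
    by (rule arg_cong[of _ _ "root_sum l"]) (auto simp: d_def)
  also have "\<dots> = root_sum l (\<lambda>i. int (c i)) + int_mult (int n) (simple_root l i)"
    by (simp add: root_sum_add root_sum_single assms(2))
  also have "\<dots> = \<Lambda> - x" unfolding c(2)[symmetric] by (simp add: algebra_simps)
  finally have x: "x = \<Lambda> - root_sum l (\<lambda>j. int (d j))" by (simp add: algebra_simps)
  have y: "x + int_mult (int n) (simple_root l i) = \<Lambda> - root_sum l (\<lambda>i. int (c i))"
    using c(2) by (simp add: algebra_simps)
  have "degree_of_weight l \<Lambda> x = (\<Sum>i\<le>l. d i)"
    unfolding x by (rule degree_of_weight_eq[OF assms(1) d])
  also have "\<dots> = (\<Sum>i\<le>l. c i) + n" using assms(2) by (simp add: d_def sum.distrib)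
  also have "(\<Sum>i\<le>l. c i) = degree_of_weight l \<Lambda> (x + int_mult (int n) (simple_root l i))"
    unfolding y by (rule degree_of_weight_eq[OF assms(1) c(1), symmetric])
  finally show ?thesis .
qed

section \<open>Highest weight modules\<close>

text \<open>The scalings are record fields, so linearity arrives as a hypothesis on each operator;
  the bundle turns it into rewrite rules.\<close>

lemma (in vector_space) linear_ops:
  assumes "Vector_Spaces.linear scale scale f"
  shows linear_op_add: "f (x + y) = f x + f y"
    and linear_op_scale: "f (scale r x) = scale r (f x)"
    and linear_op_diff: "f (x - y) = f x - f y"
    and linear_op_zero: "f 0 = 0"
    and linear_op_sum: "f (\<Sum>i\<in>A. g i) = (\<Sum>i\<in>A. f (g i))"
proof -
  interpret f: Vector_Spaces.linear scale scale f by fact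
  show "f (x + y) = f x + f y" by (rule f.add)
  show "f (scale r x) = scale r (f x)" by (rule f.scale)
  show "f (x - y) = f x - f y" by (rule f.diff)
  show "f 0 = 0" by (rule f.zero)
  show "f (\<Sum>i\<in>A. g i) = (\<Sum>i\<in>A. f (g i))" by (rule f.sum)
qed

lemma (in vector_space) linear_funpow:
  assumes "Vector_Spaces.linear scale scale f"
  shows "Vector_Spaces.linear scale scale (f ^^ n)"
proof (induction n)
  case 0
  show ?case using linear_id by (simp add: id_def)
next
  case (Suc n)
  show ?case using Vector_Spaces.linear_compose[OF Suc assms] by (simp add: comp_def)
qed

lemma (in vector_space) span_closed_under_linear:
  assumes "Vector_Spaces.linear scale scale f" "\<And>x. x \<in> S \<Longrightarrow> f x \<in> span S" "x \<in> span S"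
  shows "f x \<in> span S"
  using assms(3)
  by (rule span_induct)
     (auto simp: subspace_def linear_ops[OF assms(1)] assms(2) intro: span_add span_scale span_zero)

section \<open>Strings for sl_2 and its quantum analogue\<close>

text \<open>Covers sl_2 with \<open>c f = f\<close> and its quantum version with \<open>c f\<close>
  the quantum integer [f]; the grade is the coroot eigenvalue. \<open>c_sum\<close> is the identity
  [f] + [f-2] + ... + [f-2k+2] = [k][f-k+1], which gives the scalars met along a string in closed
  form.\<close>

locale sl2_graded = vector_space scale
  for scale :: "'k::field \<Rightarrow> 'v::ab_group_add \<Rightarrow> 'v" +
  fixes X Y :: "'v \<Rightarrow> 'v" and G :: "int \<Rightarrow> 'v set" and c :: "int \<Rightarrow> 'k"
  assumes X_linear: "Vector_Spaces.linear scale scale X"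
    and Y_linear: "Vector_Spaces.linear scale scale Y"
    and X_G: "v \<in> G f \<Longrightarrow> X v \<in> G (f + 2)"
    and Y_G: "v \<in> G f \<Longrightarrow> Y v \<in> G (f - 2)"
    and X_Y: "v \<in> G f \<Longrightarrow> X (Y v) = Y (X v) + scale (c f) v"
    and c_neg: "c (- n) = - c n"
    and c_zero: "c 0 = 0"
    and c_nonzero: "n > 0 \<Longrightarrow> c n \<noteq> 0"
    and c_sum: "(\<Sum>j<k. c (f - 2 * int j)) = c (int k) * c (f - int k + 1)"
begin

text \<open>The Chevalley involution: exchanging raising and lowering reverses the grade, and the
  sign of the commutator is absorbed because \<open>c\<close> is odd. Facts on lowest weight vectors
  thus come for free.\<close>

lemma dual: "sl2_graded scale Y X (\<lambda>f. G (- f)) c"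
proof (intro sl2_graded.intro vector_space_axioms sl2_graded_axioms.intro)
  show "Y v \<in> G (- (f + 2))" if "v \<in> G (- f)" for v f using Y_G[OF that] by simp
  show "X v \<in> G (- (f - 2))" if "v \<in> G (- f)" for v f using X_G[OF that] by simp
  show "Y (X v) = X (Y v) + scale (c f) v" if "v \<in> G (- f)" for v f
    using X_Y[OF that] by (simp add: c_neg)
qed (use X_linear Y_linear c_neg c_zero c_nonzero c_sum in auto)

text \<open>The scalar with which \<open>X\<close> takes the \<open>n\<close>-th vector below a
  highest weight vector of grade \<open>f\<close> back to its predecessor; by \<open>c_sum\<close>
  it is [n][f-n+1].\<close>

definition s :: "int \<Rightarrow> nat \<Rightarrow> 'k" where
  "s f n = (\<Sum>j<n. c (f - 2 * int j))"

lemma Y_pow_G: "v \<in> G f \<Longrightarrow> (Y ^^ n) v \<in> G (f - 2 * int n)"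
proof (induction n)
  case (Suc n)
  then show ?case using Y_G[of "(Y ^^ n) v" "f - 2 * int n"] by (simp add: algebra_simps)
qed simp

text \<open>Each passage of \<open>X\<close> past a \<open>Y\<close> adds the scalar of the grade
  reached. For \<open>n = 0\<close> the truncated exponent is harmless, since
  \<open>s f 0 = 0\<close>.\<close>

lemma X_Y_pow:
  assumes "v \<in> G f"
  shows "X ((Y ^^ n) v) = (Y ^^ n) (X v) + scale (s f n) ((Y ^^ (n - 1)) v)"
proof (induction n)
  case 0
  show ?case by (simp add: s_def)
next
  case (Suc n)
  have "X ((Y ^^ Suc n) v) = Y (X ((Y ^^ n) v)) + scale (c (f - 2 * int n)) ((Y ^^ n) v)"
    using X_Y[OF Y_pow_G[OF assms, of n]] by simp
  also have "\<dots> = (Y ^^ Suc n) (X v) + scale (s f n) (Y ((Y ^^ (n - 1)) v))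
      + scale (c (f - 2 * int n)) ((Y ^^ n) v)"
    by (simp add: Suc linear_ops[OF Y_linear])
  also have "scale (s f n) (Y ((Y ^^ (n - 1)) v)) = scale (s f n) ((Y ^^ n) v)"
    by (cases n) (simp_all add: s_def)
  finally show ?case by (simp add: s_def scale_left_distrib add.assoc)
qed

lemma s_nonzero: "1 \<le> n \<Longrightarrow> int n \<le> f \<Longrightarrow> s f n \<noteq> 0"
  by (simp add: s_def c_sum c_nonzero)

lemma s_vanishes: "f \<ge> 0 \<Longrightarrow> s f (Suc (nat f)) = 0"
  by (simp add: s_def c_sum c_zero del: sum.lessThan_Suc)

text \<open>Induction on the nilpotency order of \<open>X\<close> at \<open>v\<close>: a highest
  weight vector is recovered step by step with nonzero scalars, and any other \<open>v\<close> is
  compared with \<open>X v\<close>, whose order is smaller.\<close>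

lemma Y_pow_nonzero:
  assumes "v \<in> G f" "v \<noteq> 0" "(X ^^ n) v = 0" "int m \<le> f"
  shows "(Y ^^ m) v \<noteq> 0"
  using assms
proof (induction n arbitrary: v f m)
  case (Suc n)
  show ?case
  proof (cases "X v = 0")
    case True
    show ?thesis using Suc.prems(4)
    proof (induction m)
      case (Suc m)
      then have "scale (s f (Suc m)) ((Y ^^ m) v) \<noteq> 0" by (simp add: s_nonzero)
      then show ?case
        using X_Y_pow[OF \<open>v \<in> G f\<close>, of "Suc m"] True
        by (auto simp: linear_ops[OF linear_funpow[OF Y_linear]] linear_ops[OF X_linear] linear_ops[OF Y_linear])
    qed (use Suc in simp)
  next
    case False
    \<comment> \<open>\<open>X v\<close> has grade \<open>f + 2\<close>, which allows the exponent
      \<open>Suc m\<close>. If \<open>(Y ^^ m) v\<close> vanished, so would the next power, and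
      \<open>X_Y_pow\<close> would leave this vector equal to 0.\<close>
    have "(Y ^^ Suc m) (X v) \<noteq> 0"
      by (rule Suc.IH[OF X_G[OF Suc.prems(1)] False])
         (use Suc.prems in \<open>simp_all add: funpow_swap1\<close>)
    then show ?thesis
      using X_Y_pow[OF Suc.prems(1), of "Suc m"]
      by (auto simp: linear_ops[OF X_linear] linear_ops[OF Y_linear])
  qed
qed simp

lemma X_pow_nonzero:
  assumes "v \<in> G f" "v \<noteq> 0" "(Y ^^ n) v = 0" "int m \<le> - f"
  shows "(X ^^ m) v \<noteq> 0"
proof -
  interpret dual: sl2_graded scale Y X "\<lambda>f. G (- f)" c by (rule dual)
  show ?thesis using dual.Y_pow_nonzero[of v "- f"] assms by simp
qed

lemma X_pow_Y_pow_singular: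
  assumes "v \<in> G f" "X v = 0"
  shows "(X ^^ k) ((Y ^^ (n + k)) v) = scale (\<Prod>j\<in>{n<..n + k}. s f j) ((Y ^^ n) v)"
proof (induction k)
  case (Suc k)
  have "(X ^^ Suc k) ((Y ^^ (n + Suc k)) v) = (X ^^ k) (X ((Y ^^ Suc (n + k)) v))"
    by (simp add: funpow_swap1)
  also have "X ((Y ^^ Suc (n + k)) v) = scale (s f (Suc (n + k))) ((Y ^^ (n + k)) v)"
    using X_Y_pow[OF assms(1), of "Suc (n + k)"] assms(2)
    by (simp add: linear_ops[OF linear_funpow[OF Y_linear]] linear_ops[OF Y_linear])
  also have "(X ^^ k) \<dots> = scale (s f (Suc (n + k)) * (\<Prod>j\<in>{n<..n + k}. s f j)) ((Y ^^ n) v)"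
    by (simp add: linear_ops[OF linear_funpow[OF X_linear]] Suc)
  also have "{n<..n + Suc k} = insert (Suc (n + k)) {n<..n + k}" by auto
  then have "s f (Suc (n + k)) * (\<Prod>j\<in>{n<..n + k}. s f j) = (\<Prod>j\<in>{n<..n + Suc k}. s f j)"
    by simp
  finally show ?case .
qed simp

lemma X_pow_Y_pow_singular_eq_0:
  assumes "v \<in> G f" "X v = 0" "k < n"
  shows "(X ^^ n) ((Y ^^ k) v) = 0"
proof -
  obtain m where n: "n = Suc m + k" using assms(3) less_imp_Suc_add by (metis add.commute add_Suc_right)
  have "(X ^^ n) ((Y ^^ k) v) = (X ^^ m) (X ((X ^^ k) ((Y ^^ (0 + k)) v)))"
    by (simp add: n funpow_add funpow_swap1)
  also have "\<dots> = 0"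
    unfolding X_pow_Y_pow_singular[OF assms(1,2)]
    by (simp add: linear_ops[OF linear_funpow[OF X_linear]] linear_ops[OF X_linear] assms(2))
  finally show ?thesis .
qed

end


section \<open>Irreducible highest weight modules by abstract operators\<close>

text \<open>\<open>T h\<close> acts on weight \<open>x\<close> by \<open>\<chi> h x\<close>: the
  pairing for the Lie algebra, a power of q for the quantum group. The Serre relations, which differ
  in shape between the two cases, enter through their common consequence
  \<open>serre_nilpotent\<close>.\<close>

locale highest_weight_rep = vector_space scale
  for scale :: "'k::field \<Rightarrow> 'v::ab_group_add \<Rightarrow> 'v" +
  fixes l :: nat and E F :: "nat \<Rightarrow> 'v \<Rightarrow> 'v" and T :: "coweight \<Rightarrow> 'v \<Rightarrow> 'v"
    and \<chi> :: "coweight \<Rightarrow> weight \<Rightarrow> 'k" and c :: "int \<Rightarrow> 'k"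
    and W :: "weight \<Rightarrow> 'v set" and \<Lambda> :: weight
  assumes rank_pos: "l \<ge> 1"
    and E_linear: "i \<le> l \<Longrightarrow> Vector_Spaces.linear scale scale (E i)"
    and F_linear: "i \<le> l \<Longrightarrow> Vector_Spaces.linear scale scale (F i)"
    and T_linear: "h \<in> coweight_lattice l \<Longrightarrow> Vector_Spaces.linear scale scale (T h)"
    and W_eq: "W x = {v. \<forall>h\<in>coweight_lattice l. T h v = scale (\<chi> h x) v}"
    and separating: "x \<in> weight_lattice l \<Longrightarrow> y \<in> weight_lattice l \<Longrightarrow> x \<noteq> y \<Longrightarrow>
          \<exists>h\<in>coweight_lattice l. \<chi> h x \<noteq> \<chi> h y"
    and E_W: "i \<le> l \<Longrightarrow> v \<in> W x \<Longrightarrow> E i v \<in> W (x + simple_root l i)"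
    and F_W: "i \<le> l \<Longrightarrow> v \<in> W x \<Longrightarrow> F i v \<in> W (x - simple_root l i)"
    and E_F_commute: "i \<le> l \<Longrightarrow> j \<le> l \<Longrightarrow> i \<noteq> j \<Longrightarrow> E i (F j v) = F j (E i v)"
    and E_F: "i \<le> l \<Longrightarrow> v \<in> W x \<Longrightarrow> E i (F i v) = F i (E i v) + scale (c (fst x i)) v"
    and c_neg: "c (- z) = - c z"
    and c_zero: "c 0 = 0"
    and c_nonzero: "z > 0 \<Longrightarrow> c z \<noteq> 0"
    and c_sum: "(\<Sum>j<k. c (f - 2 * int j)) = c (int k) * c (f - int k + 1)"
    and serre_nilpotent: "i \<le> l \<Longrightarrow> j \<le> l \<Longrightarrow> i \<noteq> j \<Longrightarrow> (F i ^^ n) v = 0 \<Longrightarrow>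
          \<exists>m. (F i ^^ m) (F j v) = 0"
    and irreducible: "subspace U \<Longrightarrow> (\<And>w i. w \<in> U \<Longrightarrow> i \<le> l \<Longrightarrow> E i w \<in> U) \<Longrightarrow>
          (\<And>w i. w \<in> U \<Longrightarrow> i \<le> l \<Longrightarrow> F i w \<in> U) \<Longrightarrow>
          (\<And>w h. w \<in> U \<Longrightarrow> h \<in> coweight_lattice l \<Longrightarrow> T h w \<in> U) \<Longrightarrow> U = {0} \<or> U = UNIV"
    and highest_weight_vector: "\<exists>v. v \<noteq> 0 \<and> v \<in> W \<Lambda> \<and> (\<forall>i\<le>l. E i v = 0)"
    and \<Lambda>_lattice: "\<Lambda> \<in> weight_lattice l"
    and \<Lambda>_dominant: "i \<le> l \<Longrightarrow> fst \<Lambda> i \<ge> 0"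
begin

lemma W_subspace: "subspace (W x)"
  by (auto simp: W_eq subspace_def linear_ops[OF T_linear] scale_right_distrib mult.commute)

lemma W_sum: "(\<And>i. i \<in> A \<Longrightarrow> f i \<in> W x) \<Longrightarrow> (\<Sum>i\<in>A. f i) \<in> W x"
  by (rule subspace_sum[OF W_subspace])

lemma W_scale: "v \<in> W x \<Longrightarrow> scale r v \<in> W x"
  by (rule subspace_scale[OF W_subspace])

lemma W_diff: "v \<in> W x \<Longrightarrow> w \<in> W x \<Longrightarrow> v - w \<in> W x"
  by (rule subspace_diff[OF W_subspace])

lemma W_zero: "0 \<in> W x"
  by (rule subspace_0[OF W_subspace])

lemma weight_spaces_independent:
  assumes "finite S" "S \<subseteq> weight_lattice l" "\<And>x. x \<in> S \<Longrightarrow> u x \<in> W x" "(\<Sum>x\<in>S. u x) = 0" "x \<in> S"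
  shows "u x = 0"
  using assms
proof (induction S arbitrary: u x rule: finite_induct)
  case (insert y S)
  have zero: "u x = 0" if x: "x \<in> S" for x
  proof -
    from x insert have "x \<noteq> y" by auto
    then obtain h where h: "h \<in> coweight_lattice l" "\<chi> h x \<noteq> \<chi> h y"
      using separating insert.prems(1) x by blast
    have Tu: "T h (u z) = scale (\<chi> h z) (u z)" if "z \<in> insert y S" for z
      using insert.prems(2)[OF that] h by (simp add: W_eq)
    \<comment> \<open>\<open>T h\<close> minus its eigenvalue on \<open>y\<close> removes the
      summand at \<open>y\<close> and multiplies the one at \<open>x\<close> by a nonzero
      scalar.\<close>
    have "0 = T h (\<Sum>z\<in>insert y S. u z) - scale (\<chi> h y) (\<Sum>z\<in>insert y S. u z)"
      unfolding insert.prems(3) by (simp add: linear_ops[OF T_linear[OF h(1)]])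
    also have "\<dots> = (\<Sum>z\<in>insert y S. scale (\<chi> h z - \<chi> h y) (u z))"
      unfolding linear_ops[OF T_linear[OF h(1)]] scale_sum_right sum_subtractf[symmetric]
      by (rule sum.cong) (auto simp: Tu scale_left_diff_distrib)
    also have "\<dots> = (\<Sum>z\<in>S. scale (\<chi> h z - \<chi> h y) (u z))"
      using insert.hyps by simp
    finally have "scale (\<chi> h x - \<chi> h y) (u x) = 0"
      using insert.IH[of "\<lambda>z. scale (\<chi> h z - \<chi> h y) (u z)" x] insert.prems(1,2) x
      by (auto intro: W_scale)
    then show ?thesis using h(2) by simp
  qed
  then have "u y = 0" using insert.prems(3) insert.hyps by simp
  with zero show ?case using insert.prems(4) by (metis insertE)
qed simp

text \<open>Independence for an indexed family in which several terms may share a weight; this is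
  how the part of weight \<open>x\<close> is read off from a relation.\<close>

lemma weight_components_vanish:
  assumes "finite J" "\<And>j. j \<in> J \<Longrightarrow> wt j \<in> weight_lattice l" "\<And>j. j \<in> J \<Longrightarrow> u j \<in> W (wt j)"
    "(\<Sum>j\<in>J. u j) = 0"
  shows "(\<Sum>j\<in>{j\<in>J. wt j = x}. u j) = 0"
proof (cases "x \<in> wt ` J")
  case True
  show ?thesis
  proof (rule weight_spaces_independent[of "wt ` J" "\<lambda>x. \<Sum>j\<in>{j\<in>J. wt j = x}. u j"])
    show "(\<Sum>x\<in>wt ` J. \<Sum>j\<in>{j\<in>J. wt j = x}. u j) = 0"
      using sum.group[OF assms(1) finite_imageI[OF assms(1)] subset_refl, where h = u] assms(4) by simp
    show "(\<Sum>j\<in>{j\<in>J. wt j = y}. u j) \<in> W y" for y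
      by (rule W_sum) (use assms(3) in auto)
  qed (use True assms in auto)
next
  case False
  then have none: "{j\<in>J. wt j = x} = {}" by blast
  show ?thesis unfolding none by simp
qed

section \<open>Words in the lowering operators and singular vectors\<close>

definition root_word :: "nat list \<Rightarrow> weight" where
  "root_word w = (\<Sum>i\<leftarrow>w. simple_root l i)"

lemma root_word_in_pos_root_lattice: "set w \<subseteq> {..l} \<Longrightarrow> root_word w \<in> pos_root_lattice l"
proof (induction w)
  case (Cons i w)
  then show ?case
    using pos_root_lattice_add[OF simple_root_in_pos_root_lattice[of i l 1]]
    by (simp add: root_word_def)
qed (simp add: root_word_def zero_in_pos_root_lattice)

lemma root_word_in_weight_lattice: "root_word w \<in> weight_lattice l"
proof (induction w)
  case Nil
  show ?case by (simp add: root_word_def weight_lattice_def)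
next
  case (Cons i w)
  then show ?case by (simp add: root_word_def weight_lattice_add simple_root_in_weight_lattice)
qed

lemma F_word_W: "set w \<subseteq> {..l} \<Longrightarrow> u \<in> W \<mu> \<Longrightarrow> foldr F w u \<in> W (\<mu> - root_word w)"
proof (induction w)
  case (Cons i w)
  then show ?case using F_W[of i "foldr F w u" "\<mu> - root_word w"]
    by (simp add: root_word_def algebra_simps)
qed (simp add: root_word_def)

text \<open>The span of the words is stable under \<open>E\<close> by commuting it towards
  \<open>u\<close>, and under \<open>T\<close> because words are weight vectors; irreducibility does
  the rest. It is stated for any singular vector, so that two of them can be compared.\<close>

lemma singular_vector_generates:
  assumes u: "u \<in> W \<mu>" "\<And>i. i \<le> l \<Longrightarrow> E i u = 0" "u \<noteq> 0"
  shows "span {foldr F w u | w. set w \<subseteq> {..l}} = UNIV"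
proof -
  define S where "S = {foldr F w u | w. set w \<subseteq> {..l}}"
  have F: "F i w \<in> span S" if "i \<le> l" "w \<in> span S" for i w
  proof (rule span_closed_under_linear[OF F_linear[OF that(1)] _ that(2)])
    fix x assume "x \<in> S"
    then obtain w where "set w \<subseteq> {..l}" "x = foldr F w u" by (auto simp: S_def)
    then show "F i x \<in> span S" using that(1)
      by (intro span_base) (auto simp: S_def intro!: exI[of _ "i # w"])
  qed
  have E_word: "E i (foldr F w u) \<in> span S" if "i \<le> l" "set w \<subseteq> {..l}" for i w
    using that(2)
  proof (induction w)
    case (Cons j w)
    then have IH: "F j (E i (foldr F w u)) \<in> span S" using F by simp
    have w: "foldr F w u \<in> span S" using Cons.prems by (intro span_base) (auto simp: S_def)
    show ?case
    proof (cases "i = j")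
      case True
      then show ?thesis using E_F[OF that(1) F_word_W[OF _ u(1)], of w] IH w Cons.prems
        by (auto intro: span_add span_scale)
    next
      case False
      then show ?thesis using E_F_commute[OF that(1)] IH Cons.prems by simp
    qed
  qed (simp add: u that span_zero)
  have E: "E i w \<in> span S" if "i \<le> l" "w \<in> span S" for i w
    by (rule span_closed_under_linear[OF E_linear[OF that(1)] _ that(2)])
       (auto simp: S_def intro: E_word[OF that(1), unfolded S_def])
  have T: "T h w \<in> span S" if "h \<in> coweight_lattice l" "w \<in> span S" for h w
  proof (rule span_closed_under_linear[OF T_linear[OF that(1)] _ that(2)])
    fix x assume "x \<in> S"
    then obtain w where w: "set w \<subseteq> {..l}" "x = foldr F w u" by (auto simp: S_def)
    then have "T h x = scale (\<chi> h (\<mu> - root_word w)) x"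
      using F_word_W[OF w(1) u(1)] that(1) by (simp add: W_eq)
    then show "T h x \<in> span S" using \<open>x \<in> S\<close> by (simp add: span_base span_scale)
  qed
  have "u \<in> span S" by (rule span_base) (auto simp: S_def intro!: exI[of _ "[]"])
  then have "span S \<noteq> {0}" using u(3) by auto
  then show ?thesis using irreducible[OF subspace_span E F T] unfolding S_def by auto
qed

text \<open>Expand \<open>z\<close> in words and keep the part of weight \<open>x\<close>: if every
  word of that weight vanished, so would \<open>z\<close>.\<close>

lemma weight_is_word_weight:
  assumes u: "u \<in> W \<mu>" "\<And>i. i \<le> l \<Longrightarrow> E i u = 0" "u \<noteq> 0"
    and "\<mu> \<in> weight_lattice l" "x \<in> weight_lattice l" "z \<in> W x" "z \<noteq> 0"
  shows "\<exists>w. set w \<subseteq> {..l} \<and> foldr F w u \<noteq> 0 \<and> x = \<mu> - root_word w"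
proof (rule ccontr)
  assume contra: "\<not> ?thesis"
  define S where "S = {foldr F w u | w. set w \<subseteq> {..l}}"
  have "z \<in> span S" using singular_vector_generates[OF u] by (simp add: S_def)
  then obtain t r where t: "finite t" "t \<subseteq> S" "z = (\<Sum>a\<in>t. scale (r a) a)"
    by (auto simp: span_explicit)
  have "\<forall>a\<in>t. \<exists>w. set w \<subseteq> {..l} \<and> a = foldr F w u" using t(2) by (auto simp: S_def)
  then obtain w where w: "\<And>a. a \<in> t \<Longrightarrow> set (w a) \<subseteq> {..l} \<and> a = foldr F (w a) u" by metis
  \<comment> \<open>The index \<open>None\<close> carries \<open>- z\<close> and
    \<open>Some a\<close> a term of its expansion, so the expansion becomes a single vanishing
    sum.\<close>
  define wt where "wt j = (case j of None \<Rightarrow> x | Some a \<Rightarrow> \<mu> - root_word (w a))" for j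
  define y where "y j = (case j of None \<Rightarrow> - z | Some a \<Rightarrow> scale (r a) a)" for j
  have "(\<Sum>j\<in>{j\<in>insert None (Some ` t). wt j = x}. y j) = 0"
  proof (rule weight_components_vanish)
    show "(\<Sum>j\<in>insert None (Some ` t). y j) = 0"
      using t(1) by (simp add: y_def sum.reindex t(3)[symmetric])
    show "y j \<in> W (wt j)" if "j \<in> insert None (Some ` t)" for j
    proof (cases j)
      case None
      then show ?thesis using subspace_neg[OF W_subspace assms(6)] by (simp add: y_def wt_def)
    next
      case (Some a)
      then have "a \<in> t" using that by auto
      with w have "set (w a) \<subseteq> {..l}" "foldr F (w a) u = a" by auto
      then show ?thesis using W_scale[OF F_word_W[OF _ u(1), of "w a"], of "r a"] Some
        by (simp add: y_def wt_def)
    qed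
    show "wt j \<in> weight_lattice l" for j
      using assms(4,5) by (auto simp: wt_def split: option.splits
        intro: weight_lattice_diff root_word_in_weight_lattice)
  qed (use t in auto)
  moreover have "y j = (if j = None then - z else 0)" if "j \<in> {j\<in>insert None (Some ` t). wt j = x}" for j
  proof (cases j)
    case (Some a)
    then have "a \<in> t" "\<mu> - root_word (w a) = x" using that by (auto simp: wt_def)
    then have "a = 0" using w contra by metis
    then show ?thesis using Some by (simp add: y_def)
  qed (simp add: y_def)
  then have "(\<Sum>j\<in>{j\<in>insert None (Some ` t). wt j = x}. y j) =
      (\<Sum>j\<in>{j\<in>insert None (Some ` t). wt j = x}. if j = None then - z else 0)"
    by (rule sum.cong[OF refl])
  moreover have "\<dots> = - z" using t(1) by (simp add: wt_def)
  ultimately show False using assms(7) by simp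
qed

definition weights :: "weight set" where
  "weights = {x \<in> weight_lattice l. W x \<noteq> {0}}"

lemma weights_iff: "x \<in> weights \<longleftrightarrow> x \<in> weight_lattice l \<and> (\<exists>v\<in>W x. v \<noteq> 0)"
  using W_zero[of x] by (auto simp: weights_def simp del: split_paired_All split_paired_Ex)

lemma weights_le: "x \<in> weights \<Longrightarrow> \<Lambda> - x \<in> pos_root_lattice l"
proof -
  assume "x \<in> weights"
  then obtain z where z: "x \<in> weight_lattice l" "z \<in> W x" "z \<noteq> 0" by (auto simp: weights_iff)
  obtain v where "v \<noteq> 0" "v \<in> W \<Lambda>" "\<forall>i\<le>l. E i v = 0" using highest_weight_vector by auto
  then obtain w where "set w \<subseteq> {..l}" "x = \<Lambda> - root_word w"
    using weight_is_word_weight[OF _ _ _ \<Lambda>_lattice z] by blast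
  then show ?thesis by (simp add: root_word_in_pos_root_lattice)
qed

text \<open>Both the singular vector and the highest weight vector generate the module, so each of
  the two weights lies below the other.\<close>

lemma singular_weight_unique:
  assumes "u \<in> W \<mu>" "\<And>i. i \<le> l \<Longrightarrow> E i u = 0" "u \<noteq> 0" "\<mu> \<in> weight_lattice l"
  shows "\<mu> = \<Lambda>"
proof -
  obtain v where "v \<noteq> 0" "v \<in> W \<Lambda>" using highest_weight_vector by auto
  then obtain w where w: "set w \<subseteq> {..l}" "\<Lambda> = \<mu> - root_word w"
    using weight_is_word_weight[OF assms \<Lambda>_lattice] by blast
  have "\<Lambda> - \<mu> \<in> pos_root_lattice l"
    using assms weights_le[of \<mu>] by (auto simp: weights_iff simp del: split_paired_All)
  then have "\<Lambda> - \<mu> = 0"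
    by (rule pos_root_lattice_add_eq_0[OF rank_pos _ root_word_in_pos_root_lattice[OF w(1)]])
       (simp add: w(2))
  then show ?thesis by simp
qed

text \<open>Homogeneous vectors are taken to be weight vectors, so a grade is a union of weight
  spaces and not their sum.\<close>

lemma sl2_graded:
  assumes "i \<le> l"
  shows "sl2_graded scale (E i) (F i) (\<lambda>f. \<Union>x\<in>{x\<in>weight_lattice l. fst x i = f}. W x) c"
proof (intro sl2_graded.intro vector_space_axioms sl2_graded_axioms.intro)
  fix v f assume "v \<in> (\<Union>x\<in>{x\<in>weight_lattice l. fst x i = f}. W x)"
  then obtain x where x: "x \<in> weight_lattice l" "fst x i = f" "v \<in> W x" by auto
  show "E i v \<in> (\<Union>x\<in>{x\<in>weight_lattice l. fst x i = f + 2}. W x)"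
    using E_W[OF assms x(3)] x(1,2) weight_lattice_add[OF x(1) simple_root_in_weight_lattice[of l i]]
      fst_simple_root_self[OF rank_pos assms] by (intro UN_I[of "x + simple_root l i"]) auto
  show "F i v \<in> (\<Union>x\<in>{x\<in>weight_lattice l. fst x i = f - 2}. W x)"
    using F_W[OF assms x(3)] x(1,2) weight_lattice_diff[OF x(1) simple_root_in_weight_lattice[of l i]]
      fst_simple_root_self[OF rank_pos assms] by (intro UN_I[of "x - simple_root l i"]) auto
  show "E i (F i v) = F i (E i v) + scale (c f) v"
    using E_F[OF assms x(3)] x(2) by simp
qed (use assms E_linear F_linear c_neg c_zero c_nonzero c_sum in auto)

end

context highest_weight_rep begin

lemma W_G:
  "x \<in> weight_lattice l \<Longrightarrow> v \<in> W x \<Longrightarrow> v \<in> (\<Union>y\<in>{y\<in>weight_lattice l. fst y i = fst x i}. W y)"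
  by blast

lemma F_pow_W: "i \<le> l \<Longrightarrow> v \<in> W x \<Longrightarrow> (F i ^^ n) v \<in> W (x - int_mult (int n) (simple_root l i))"
proof (induction n)
  case (Suc n)
  then show ?case
    using F_W[of i "(F i ^^ n) v" "x - int_mult (int n) (simple_root l i)"]
      int_mult_add[of 1 "int n" "simple_root l i"] by (simp add: algebra_simps)
qed simp

lemma E_pow_W: "i \<le> l \<Longrightarrow> v \<in> W x \<Longrightarrow> (E i ^^ n) v \<in> W (x + int_mult (int n) (simple_root l i))"
proof (induction n)
  case (Suc n)
  then show ?case
    using E_W[of i "(E i ^^ n) v" "x + int_mult (int n) (simple_root l i)"]
      int_mult_add[of 1 "int n" "simple_root l i"] by (simp add: algebra_simps)
qed simp

lemma string_in_weight_lattice: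
  "x \<in> weight_lattice l \<Longrightarrow> x + int_mult n (simple_root l i) \<in> weight_lattice l"
  "x \<in> weight_lattice l \<Longrightarrow> x - int_mult n (simple_root l i) \<in> weight_lattice l"
  by (auto intro: weight_lattice_add weight_lattice_diff weight_lattice_int_mult simple_root_in_weight_lattice)

section \<open>Integrability\<close>

lemma E_locally_nilpotent:
  assumes "i \<le> l" "x \<in> weight_lattice l" "v \<in> W x"
  shows "\<exists>n. (E i ^^ n) v = 0"
proof (cases "v = 0")
  case True
  then show ?thesis by (intro exI[of _ 0]) simp
next
  case False
  then have "x \<in> weights" using assms by (auto simp: weights_iff)
  then obtain n where n: "\<Lambda> - x - int_mult (int n) (simple_root l i) \<notin> pos_root_lattice l"
    using pos_root_lattice_Diff_unbounded[OF rank_pos assms(1) weights_le] by blast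
  have "x + int_mult (int n) (simple_root l i) \<notin> weights"
    using weights_le n by (metis diff_diff_eq)
  then show ?thesis
    using E_pow_W[OF assms(1,3), of n] string_in_weight_lattice[OF assms(2)]
    by (auto simp: weights_iff simp del: split_paired_All)
qed

text \<open>The vector is singular: \<open>E i\<close> meets the vanishing scalar of
  \<open>s_vanishes\<close>, and the other \<open>E j\<close> commute with \<open>F i\<close>. Its
  weight differs from Lambda, so it is zero.\<close>

lemma F_pow_highest_weight_vector:
  assumes "i \<le> l" "v \<in> W \<Lambda>" "\<forall>j\<le>l. E j v = 0"
  shows "(F i ^^ Suc (nat (fst \<Lambda> i))) v = 0"
proof (rule ccontr)
  let ?n = "Suc (nat (fst \<Lambda> i))"
  assume nz: "(F i ^^ ?n) v \<noteq> 0"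
  interpret sl2: sl2_graded scale "E i" "F i" "\<lambda>f. \<Union>x\<in>{x\<in>weight_lattice l. fst x i = f}. W x" c
    by (rule sl2_graded) fact
  have "E j ((F i ^^ ?n) v) = 0" if "j \<le> l" for j
  proof (cases "j = i")
    case True
    have "E i ((F i ^^ ?n) v) = (F i ^^ ?n) (E i v) + scale (sl2.s (fst \<Lambda> i) ?n) ((F i ^^ (?n - 1)) v)"
      by (rule sl2.X_Y_pow[OF W_G[OF \<Lambda>_lattice assms(2)]])
    also have "E i v = 0" using assms by simp
    finally show ?thesis
      using sl2.s_vanishes[OF \<Lambda>_dominant[OF assms(1)]] True
      by (simp add: linear_ops[OF linear_funpow[OF F_linear[OF assms(1)]]] linear_ops[OF F_linear[OF assms(1)]])
  next
    case False
    have "E j ((F i ^^ n) v) = 0" for n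
    proof (induction n)
      case 0
      show ?case using assms that by simp
    next
      case (Suc n)
      then show ?case
        using E_F_commute[OF that assms(1) False] by (simp add: linear_ops[OF F_linear[OF assms(1)]])
    qed
    then show ?thesis .
  qed
  then have "\<Lambda> - int_mult (int ?n) (simple_root l i) = \<Lambda>"
    using singular_weight_unique[OF F_pow_W[OF assms(1,2)]] nz string_in_weight_lattice[OF \<Lambda>_lattice]
    by blast
  then have "int_mult (int ?n) (simple_root l i) = 0" by (simp add: diff_eq_eq)
  then show False using simple_root_neq_0[OF rank_pos assms(1)] by (metis of_nat_eq_0_iff old.nat.distinct(2))
qed

text \<open>The vectors killed by a power of \<open>F i\<close> form a subspace containing the
  highest weight vector and stable under all \<open>F j\<close>, under \<open>F i\<close> trivially
  and under the others by \<open>serre_nilpotent\<close>.\<close>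

lemma F_locally_nilpotent:
  assumes "i \<le> l"
  shows "\<exists>n. (F i ^^ n) u = 0"
proof -
  obtain v where v: "v \<noteq> 0" "v \<in> W \<Lambda>" "\<forall>i\<le>l. E i v = 0" using highest_weight_vector by auto
  have word: "\<exists>n. (F i ^^ n) (foldr F w v) = 0" if "set w \<subseteq> {..l}" for w
    using that
  proof (induction w)
    case Nil
    show ?case using F_pow_highest_weight_vector[OF assms v(2,3)]
      by (intro exI[of _ "Suc (nat (fst \<Lambda> i))"]) simp
  next
    case (Cons j w)
    then obtain n where n: "(F i ^^ n) (foldr F w v) = 0" by auto
    show ?case
    proof (cases "i = j")
      case True
      then have "(F i ^^ n) (foldr F (j # w) v) = F i ((F i ^^ n) (foldr F w v))"
        by (simp add: funpow_swap1)
      then show ?thesis using n by (auto simp: linear_ops[OF F_linear[OF assms]] intro!: exI[of _ n])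
    next
      case False
      then show ?thesis using serre_nilpotent[OF assms _ False n] Cons.prems by auto
    qed
  qed
  have mono: "(F i ^^ (n + m)) u = 0" if "(F i ^^ n) u = 0" for n m u
    using that by (simp add: add.commute[of n] funpow_add linear_ops[OF linear_funpow[OF F_linear[OF assms]]])
  have "subspace {u. \<exists>n. (F i ^^ n) u = 0}"
  proof (rule subspaceI, safe)
    show "\<exists>n. (F i ^^ n) 0 = 0" by (auto intro!: exI[of _ 0])
    fix x y n m assume "(F i ^^ n) x = 0" "(F i ^^ m) y = 0"
    then have "(F i ^^ (n + m)) (x + y) = 0"
      using mono[of n x m] mono[of m y n]
      by (simp add: linear_ops[OF linear_funpow[OF F_linear[OF assms]]] add.commute)
    then show "\<exists>n. (F i ^^ n) (x + y) = 0" ..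
  qed (auto simp: linear_ops[OF linear_funpow[OF F_linear[OF assms]]] intro!: exI)
  moreover have "u \<in> span {foldr F w v | w. set w \<subseteq> {..l}}"
    using singular_vector_generates[OF v(2) _ v(1)] v(3) by auto
  ultimately have "u \<in> {u. \<exists>n. (F i ^^ n) u = 0}"
    by (elim span_induct) (auto intro: word)
  then show ?thesis by simp
qed

lemma F_pow_nonzero:
  assumes "i \<le> l" "x \<in> weight_lattice l" "v \<in> W x" "v \<noteq> 0" "int m \<le> fst x i"
  shows "(F i ^^ m) v \<noteq> 0"
  using sl2_graded.Y_pow_nonzero[OF sl2_graded[OF assms(1)] W_G[OF assms(2,3)] assms(4) _ assms(5)]
    E_locally_nilpotent[OF assms(1-3)] by auto

lemma E_pow_nonzero:
  assumes "i \<le> l" "x \<in> weight_lattice l" "v \<in> W x" "v \<noteq> 0" "int m \<le> - fst x i"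
  shows "(E i ^^ m) v \<noteq> 0"
  using sl2_graded.X_pow_nonzero[OF sl2_graded[OF assms(1)] W_G[OF assms(2,3)] assms(4) _ assms(5)]
    F_locally_nilpotent[OF assms(1)] by auto

section \<open>The set of weights\<close>

text \<open>With \<open>m\<close> equal to the coroot value this is stability under a simple
  reflection; \<open>weights_add_string\<close> covers negative values.\<close>

lemma weights_sub_string:
  assumes "i \<le> l" "x \<in> weights" "int m \<le> fst x i"
  shows "x - int_mult (int m) (simple_root l i) \<in> weights"
  using F_pow_nonzero[OF assms(1) _ _ _ assms(3)] F_pow_W[OF assms(1), of _ x m]
    string_in_weight_lattice(2) assms(2) unfolding weights_iff by blast

lemma weights_add_string:
  assumes "i \<le> l" "x \<in> weights" "int m \<le> - fst x i"
  shows "x + int_mult (int m) (simple_root l i) \<in> weights"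
  using E_pow_nonzero[OF assms(1) _ _ _ assms(3)] E_pow_W[OF assms(1), of _ x m]
    string_in_weight_lattice(1) assms(2) unfolding weights_iff by blast

lemma \<Lambda>_weight: "\<Lambda> \<in> weights"
  using highest_weight_vector \<Lambda>_lattice by (auto simp: weights_iff)

lemma weights_level: "x \<in> weights \<Longrightarrow> level l x = level l \<Lambda>"
proof -
  assume "x \<in> weights"
  then obtain c where "\<Lambda> - x = root_sum l (\<lambda>i. int (c i))"
    using weights_le[of x] by (auto simp: pos_root_lattice_def)
  then have "level l (\<Lambda> - x) = 0" by (simp add: level_root_sum[OF rank_pos])
  then show ?thesis by (simp add: level_def sum_subtractf)
qed

text \<open>A dominant weight of level zero has only zero coordinates, so each \<open>F i\<close>
  already kills the highest weight vector and no nonempty word survives.\<close>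

lemma weights_level_zero:
  assumes "level l \<Lambda> = 0"
  shows "weights = {\<Lambda>}"
proof -
  obtain v where v: "v \<noteq> 0" "v \<in> W \<Lambda>" "\<forall>i\<le>l. E i v = 0" using highest_weight_vector by auto
  have "\<forall>i\<in>{..l}. fst \<Lambda> i = 0"
    using assms \<Lambda>_dominant unfolding level_def by (subst (asm) sum_nonneg_eq_0_iff) auto
  then have Fv: "F i v = 0" if "i \<le> l" for i
    using F_pow_highest_weight_vector[OF that v(2,3)] that by simp
  have "foldr F w v = 0" if "w \<noteq> []" "set w \<subseteq> {..l}" for w
    using that
  proof (induction w)
    case (Cons i w)
    then show ?case
      by (cases "w = []") (use F_linear in \<open>auto simp: Fv linear_ops\<close>)
  qed simp
  then have "x = \<Lambda>" if "x \<in> weights" for x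
  proof -
    from that obtain z where z: "x \<in> weight_lattice l" "z \<in> W x" "z \<noteq> 0" by (auto simp: weights_iff)
    obtain w where "set w \<subseteq> {..l}" "foldr F w v \<noteq> 0" "x = \<Lambda> - root_word w"
      using weight_is_word_weight[OF v(2) _ v(1) \<Lambda>_lattice z] v(3) by blast
    then show ?thesis using \<open>\<And>w. w \<noteq> [] \<Longrightarrow> set w \<subseteq> {..l} \<Longrightarrow> foldr F w v = 0\<close>[of w]
      by (cases "w = []") (auto simp: root_word_def)
  qed
  then show ?thesis using \<Lambda>_weight by blast
qed

text \<open>Reflecting at a negative coordinate adds a positive multiple of a simple root and lowers
  the degree, so the process ends at a dominant weight. It takes the place of the Weyl
  group.\<close>

lemma weights_induct [consumes 1, case_names dominant reflect]:
  assumes "x \<in> weights"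
    and dom: "\<And>x. x \<in> weights \<Longrightarrow> (\<And>i. i \<le> l \<Longrightarrow> fst x i \<ge> 0) \<Longrightarrow> P x"
    and refl: "\<And>x i. x \<in> weights \<Longrightarrow> i \<le> l \<Longrightarrow> fst x i < 0 \<Longrightarrow>
        x - int_mult (fst x i) (simple_root l i) \<in> weights \<Longrightarrow>
        P (x - int_mult (fst x i) (simple_root l i)) \<Longrightarrow> P x"
  shows "P x"
  using assms(1)
proof (induction "degree_of_weight l \<Lambda> x" arbitrary: x rule: less_induct)
  case less
  show ?case
  proof (cases "\<forall>i\<le>l. fst x i \<ge> 0")
    case True
    then show ?thesis using dom less.prems by blast
  next
    case False
    then obtain i where i: "i \<le> l" "fst x i < 0" by force
    define n where "n = nat (- fst x i)"
    have n: "fst x i = - int n" "n > 0" using i by (auto simp: n_def)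
    have y: "x - int_mult (fst x i) (simple_root l i) = x + int_mult (int n) (simple_root l i)"
      by (simp add: n int_mult_minus)
    have w: "x + int_mult (int n) (simple_root l i) \<in> weights"
      by (rule weights_add_string) (use i n less.prems in auto)
    have "degree_of_weight l \<Lambda> (x + int_mult (int n) (simple_root l i)) < degree_of_weight l \<Lambda> x"
      using degree_of_weight_add_simple_root[OF rank_pos i(1) weights_le[OF less.prems] weights_le[OF w]] n(2)
      by simp
    from less.hyps[OF this w] show ?thesis
      using refl[OF less.prems i] w unfolding y by blast
  qed
qed

text \<open>For dominant \<open>x\<close> the difference is (Lambda + x | Lambda - x), a pairing of
  a dominant weight with an element of Q_+; reflections do not change the form.\<close>

lemma weights_wt_form_le: "x \<in> weights \<Longrightarrow> wt_form l x x \<le> wt_form l \<Lambda> \<Lambda>"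
proof (induction x rule: weights_induct)
  case (dominant x)
  then obtain d where d: "\<Lambda> - x = root_sum l (\<lambda>i. int (d i))"
    using weights_le[of x] by (auto simp: pos_root_lattice_def)
  have "wt_form l \<Lambda> \<Lambda> - wt_form l x x = wt_form l (\<Lambda> + x) (\<Lambda> - x)"
    by (simp add: wt_form_add_left wt_form_diff_left wt_form_commute[of l _ "_ - _"] wt_form_commute[of l x \<Lambda>])
  also have "\<dots> = of_int (\<Sum>i\<le>l. int (d i) * fst (\<Lambda> + x) i)"
    unfolding d by (rule wt_form_root_sum[OF rank_pos])
  also have "\<dots> \<ge> 0"
    unfolding of_int_0_le_iff using dominant \<Lambda>_dominant by (auto intro!: sum_nonneg)
  finally show ?case by simp
next
  case (reflect x i)
  then show ?case
    using wt_form_add_simple_root[OF rank_pos \<open>i \<le> l\<close>, of x "- fst x i"]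
    by (simp add: int_mult_minus)
qed

lemma defect_nonneg: "x \<in> weights \<Longrightarrow> defect l \<Lambda> x \<ge> 0"
  using weights_wt_form_le by (simp add: defect_def)

text \<open>
  The proof takes a weight above \<open>x\<close> of largest possible degree: where the difference to \<open>x\<close> is
  maximal, no further simple root can be subtracted, so the maximum principle applies to it.
\<close>

lemma dominant_in_weights:
  assumes "\<Lambda> - x \<in> pos_root_lattice l" "\<And>i. i \<le> l \<Longrightarrow> fst x i \<ge> 0" "level l x \<noteq> 0"
  shows "x \<in> weights"
proof -
  obtain k where k: "\<forall>i>l. k i = 0" "\<Lambda> - x = root_sum l (\<lambda>i. int (k i))"
    using assms(1) by (auto simp: pos_root_lattice_def)
  define Q where "Q m \<longleftrightarrow> (\<forall>i. m i \<le> k i) \<and> \<Lambda> - root_sum l (\<lambda>i. int (m i)) \<in> weights" for m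
  have "Q (\<lambda>_. 0)" using \<Lambda>_weight by (simp add: Q_def root_sum_def)
  moreover have "\<forall>m. Q m \<longrightarrow> (\<Sum>i\<le>l. m i) < Suc (\<Sum>i\<le>l. k i)"
    unfolding less_Suc_eq_le by (auto intro!: sum_mono simp: Q_def)
  ultimately have "\<exists>m. Q m \<and> (\<forall>m'. Q m' \<longrightarrow> (\<Sum>i\<le>l. m' i) \<le> (\<Sum>i\<le>l. m i))"
    by (rule ex_has_greatest_nat)
  then obtain m where m: "Q m" "\<And>m'. Q m' \<Longrightarrow> (\<Sum>i\<le>l. m' i) \<le> (\<Sum>i\<le>l. m i)"
    by blast
  \<comment> \<open>\<open>u\<close> is what still has to be subtracted from \<open>y\<close> to
    reach \<open>x\<close>; the aim is \<open>u = 0\<close>.\<close>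
  define u where "u i = int (k i) - int (m i)" for i
  define y where "y = \<Lambda> - root_sum l (\<lambda>i. int (m i))"
  have y: "y \<in> weights" using m(1) by (simp add: Q_def y_def)
  have "root_sum l (\<lambda>i. int (k i)) = root_sum l (\<lambda>i. int (m i)) + root_sum l u"
    unfolding root_sum_add[symmetric] by (simp add: u_def)
  then have xy: "y = x + root_sum l u" using k(2) by (simp add: y_def algebra_simps)
  have fst_y: "fst y i = fst x i + 2 * u i - u (cyc_succ l i) - u (cyc_pred l i)" if "i \<le> l" for i
    using that by (simp add: xy root_sum_eq[OF rank_pos])
  have sub: "fst y i \<le> 0" if "i \<le> l" "u i > 0" for i
  proof (rule ccontr)
    assume "\<not> fst y i \<le> 0"
    then have "y - simple_root l i \<in> weights" using weights_sub_string[OF that(1) y, of 1] by simp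
    moreover define m' where "m' j = m j + (if j = i then 1 else 0)" for j
    have "root_sum l (\<lambda>j. int (m' j)) = root_sum l (\<lambda>j. int (m j) + (if j = i then 1 else 0))"
      by (rule arg_cong[of _ _ "root_sum l"]) (auto simp: m'_def)
    then have "root_sum l (\<lambda>j. int (m' j)) = root_sum l (\<lambda>j. int (m j)) + simple_root l i"
      unfolding root_sum_add root_sum_single[OF that(1)] by simp
    ultimately have "\<Lambda> - root_sum l (\<lambda>j. int (m' j)) \<in> weights"
      by (simp add: y_def diff_diff_eq)
    moreover have "m' j \<le> k j" for j
      using m(1) that(2) unfolding Q_def m'_def u_def by (auto simp: Suc_le_eq)
    ultimately have "Q m'" by (simp add: Q_def)
    then have "(\<Sum>j\<le>l. m' j) \<le> (\<Sum>j\<le>l. m j)" by (rule m(2))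
    then show False using that(1) by (simp add: m'_def sum.distrib)
  qed
  have "u i = 0" if "i \<le> l" for i
  proof (rule ccontr)
    assume "u i \<noteq> 0"
    then have "u i > 0" using m(1) unfolding Q_def u_def by (metis le_diff_eq add.left_neutral of_nat_le_iff order_le_less)
    define t where "t = Max (u ` {..l})"
    have le: "u j \<le> t" if "j \<le> l" for j unfolding t_def by (rule Max_ge) (use that in auto)
    have "t \<in> u ` {..l}" unfolding t_def by (rule Max_in) auto
    then obtain j where j: "j \<le> l" "u j = t" by auto
    have t: "t > 0" using le[OF that] \<open>u i > 0\<close> by simp
    have u: "u j = t" if "j \<le> l" for j
      using le j _ that
    proof (rule cyclic_maximum_principle)
      fix i assume "i \<le> l" "u i = t"
      then show "2 * u i \<le> u (cyc_succ l i) + u (cyc_pred l i)"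
        using sub[of i] fst_y[of i] assms(2)[of i] t by simp
    qed
    \<comment> \<open>For constant \<open>u\<close> the second difference in \<open>fst_y\<close>
      disappears, so \<open>fst x j = fst y j \<le> 0\<close>. This contradicts the nonzero
      level.\<close>
    have "fst x j = 0" if "j \<le> l" for j
      using sub[of j] fst_y[of j] assms(2)[of j] t u[of j] u[of "cyc_succ l j"] u[of "cyc_pred l j"]
        cyc_succ_le[OF that] cyc_pred_le[OF that] that by simp
    then show False using assms(3) by (simp add: level_def)
  qed
  then have "root_sum l u = 0" by (simp add: root_sum_def)
  then show ?thesis using xy y by simp
qed

end

lemma weights_subset_of_same_highest_weight:
  assumes 1: "highest_weight_rep scale1 l E1 F1 T1 \<chi>1 c1 W1 \<Lambda>"
    and 2: "highest_weight_rep scale2 l E2 F2 T2 \<chi>2 c2 W2 \<Lambda>"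
  shows "highest_weight_rep.weights l W1 \<subseteq> highest_weight_rep.weights l W2"
proof -
  interpret r1: highest_weight_rep scale1 l E1 F1 T1 \<chi>1 c1 W1 \<Lambda> by (rule 1)
  interpret r2: highest_weight_rep scale2 l E2 F2 T2 \<chi>2 c2 W2 \<Lambda> by (rule 2)
  show ?thesis
  proof (cases "level l \<Lambda> = 0")
    case True
    then show ?thesis using r1.weights_level_zero r2.weights_level_zero by simp
  next
    case False
    have "x \<in> r2.weights" if "x \<in> r1.weights" for x
      using that
    proof (induction x rule: r1.weights_induct)
      case (dominant x)
      then show ?case
        using r2.dominant_in_weights r1.weights_le r1.weights_level False by simp
    next
      case (reflect x i)
      let ?y = "x - int_mult (fst x i) (simple_root l i)"
      \<comment> \<open>The upward reflection made in the first module is undone inside the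
        second.\<close>
      have "fst ?y i = - fst x i" by (simp add: fst_simple_root_self[OF r1.rank_pos \<open>i \<le> l\<close>])
      then have "?y - int_mult (int (nat (- fst x i))) (simple_root l i) \<in> r2.weights"
        using reflect by (intro r2.weights_sub_string) auto
      then show ?case using \<open>fst x i < 0\<close> by (simp add: int_mult_minus)
    qed
    then show ?thesis by blast
  qed
qed

section \<open>The modules of the Lie algebra and of the quantum group\<close>

lemma pairing_minus_left: "pairing l (- h) x = - pairing l h x"
  by (simp add: pairing_def sum_negf)

lemma pairing_add_right: "pairing l h (x + y) = pairing l h x + pairing l h y"
  by (simp add: pairing_def sum.distrib algebra_simps)

lemma pairing_diff_right: "pairing l h (x - y) = pairing l h x - pairing l h y"
  using pairing_add_right[of l h "x - y" y] by simp

lemma pairing_simple_coroot: "i \<le> l \<Longrightarrow> pairing l (simple_coroot i) x = fst x i"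
  by (simp add: pairing_def simple_coroot_def of_bool_def if_distrib[of "\<lambda>x. x * _"] cong: if_cong)

lemma simple_coroot_in_coweight_lattice: "i \<le> l \<Longrightarrow> simple_coroot i \<in> coweight_lattice l"
  by (auto simp: coweight_lattice_def simple_coroot_def)

lemma coweight_lattice_minus: "h \<in> coweight_lattice l \<Longrightarrow> - h \<in> coweight_lattice l"
  by (auto simp: coweight_lattice_def)

lemma pairing_separates:
  assumes "x \<in> weight_lattice l" "y \<in> weight_lattice l" "x \<noteq> y"
  shows "\<exists>h\<in>coweight_lattice l. pairing l h x \<noteq> pairing l h y"
proof (cases "snd x = snd y")
  case True
  then have "fst x \<noteq> fst y" using assms(3) by (simp add: prod_eq_iff)
  then obtain i where i: "fst x i \<noteq> fst y i" by auto
  then have "i \<le> l" using assms(1,2) by (metis (mono_tags) mem_Collect_eq not_le weight_lattice_def)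
  then show ?thesis using i pairing_simple_coroot simple_coroot_in_coweight_lattice by metis
next
  case False
  have "pairing l (\<lambda>_. 0, 1) z = snd z" for z by (simp add: pairing_def)
  then show ?thesis using False by (intro bexI[of _ "(\<lambda>_. 0, 1)"]) (auto simp: coweight_lattice_def)
qed

section \<open>Local nilpotency from the Serre relations\<close>

text \<open>Every \<open>X\<close> applied to \<open>Z k v\<close> either raises \<open>k\<close>,
  and \<open>Z m\<close> is zero, or reaches \<open>v\<close>, which \<open>n\<close> of them kill;
  \<open>n + m\<close> factors exhaust both. The induction is on the number of factors still
  available.\<close>

lemma (in vector_space) commutator_nilpotent:
  assumes X: "Vector_Spaces.linear scale scale X" and Y: "Vector_Spaces.linear scale scale Y"
    and zero: "\<And>v. (commutator X ^^ m) Y v = 0"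
    and v: "(X ^^ n) v = 0"
  shows "(X ^^ (n + m)) (Y v) = 0"
proof -
  define Z where "Z k = (commutator X ^^ k) Y" for k
  have XZ: "X (Z k v) = Z (Suc k) v + Z k (X v)" for k v
    by (simp add: Z_def commutator_def)
  have Z0: "Z k 0 = 0" for k
  proof (induction k)
    case (Suc k)
    then show ?case using XZ[of k 0] by (simp add: linear_ops[OF X])
  qed (simp add: Z_def linear_ops[OF Y])
  have "(X ^^ (n + (m - k))) (Z k v) = 0" if "k \<le> m" "(X ^^ n) v = 0" for n k v
    using that
  proof (induction "n + (m - k)" arbitrary: n k v)
    case 0
    then have "n = 0" by (metis add_is_0)
    then have "v = 0" using 0(3) by simp
    then show ?case by (simp add: Z0 linear_ops[OF linear_funpow[OF X]])
  next
    case (Suc r)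
    show ?case
    proof (cases "n = 0 \<or> k = m")
      case True
      then show ?thesis
        using Suc.prems zero by (auto simp: Z0 linear_ops[OF linear_funpow[OF X]]) (simp add: Z_def linear_ops[OF linear_funpow[OF X]])
    next
      case False
      then obtain n' where n': "n = Suc n'" by (cases n) auto
      have k: "Suc k \<le> m" using False Suc.prems by simp
      then have r: "r = n + (m - Suc k)" using Suc.hyps(2) by simp
      have "(X ^^ r) (Z (Suc k) v) = 0"
        using Suc.hyps(1)[of n "Suc k" v] r Suc.prems k by simp
      moreover have "(X ^^ r) (Z k (X v)) = 0"
        using Suc.hyps(1)[of n' k "X v"] Suc.hyps(2) Suc.prems n' by (auto simp: funpow_swap1)
      ultimately have "(X ^^ Suc r) (Z k v) = 0"
        by (simp add: funpow_swap1 XZ linear_ops[OF linear_funpow[OF X]])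
      then show ?thesis using Suc.hyps(2) by simp
    qed
  qed
  from this[of 0 n v] v show ?thesis by (simp add: Z_def)
qed

text \<open>Isolating the term \<open>k = 0\<close> expresses \<open>(X ^^ m) (Y v)\<close> by terms
  in which at least one \<open>X\<close> acts on \<open>v\<close> directly. Thus \<open>m\<close>
  powers of \<open>X\<close> outside buy one power inside, whence the exponent
  \<open>n * m\<close>.\<close>

lemma (in vector_space) serre_sum_nilpotent:
  assumes X: "Vector_Spaces.linear scale scale X" and Y: "Vector_Spaces.linear scale scale Y"
    and sum: "\<And>v. (\<Sum>k\<le>m. scale (r k) ((X ^^ (m - k)) (Y ((X ^^ k) v)))) = 0" and "r 0 \<noteq> 0"
    and v: "(X ^^ n) v = 0"
  shows "(X ^^ (n * m)) (Y v) = 0"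
  using v
proof (induction n arbitrary: v)
  case 0
  then show ?case by (simp add: linear_ops[OF Y])
next
  case (Suc n)
  have "(X ^^ (n * m)) ((X ^^ (m - k)) (Y ((X ^^ k) v))) = 0" if "k \<in> {..m} - {0}" for k
  proof -
    from that have "k \<noteq> 0" by simp
    then obtain j where j: "k = Suc j" by (cases k) auto
    have "(X ^^ n) ((X ^^ k) v) = (X ^^ j) ((X ^^ Suc n) v)"
      by (metis j add.commute add_Suc_shift comp_apply funpow_add)
    then have "(X ^^ n) ((X ^^ k) v) = 0" using Suc.prems by (simp add: linear_ops[OF linear_funpow[OF X]] del: funpow.simps)
    then have "(X ^^ (n * m)) (Y ((X ^^ k) v)) = 0" by (rule Suc.IH)
    moreover have "(X ^^ (n * m)) ((X ^^ (m - k)) z) = (X ^^ (m - k)) ((X ^^ (n * m)) z)" for z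
      by (metis add.commute comp_apply funpow_add)
    ultimately show ?thesis by (simp add: linear_ops[OF linear_funpow[OF X]])
  qed
  then have "(\<Sum>k\<in>{..m} - {0}. scale (r k) ((X ^^ (n * m)) ((X ^^ (m - k)) (Y ((X ^^ k) v))))) = 0"
    by (intro sum.neutral) auto
  moreover have "(X ^^ (n * m)) (\<Sum>k\<le>m. scale (r k) ((X ^^ (m - k)) (Y ((X ^^ k) v)))) = 0"
    by (simp add: sum linear_ops[OF linear_funpow[OF X]])
  then have "(\<Sum>k\<le>m. scale (r k) ((X ^^ (n * m)) ((X ^^ (m - k)) (Y ((X ^^ k) v))))) = 0"
    by (simp add: linear_ops[OF linear_funpow[OF X]])
  ultimately have "scale (r 0) ((X ^^ (n * m)) ((X ^^ m) (Y v))) = 0"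
    by (simp add: sum.remove[of "{..m}" 0])
  then show ?case using \<open>r 0 \<noteq> 0\<close> by (simp add: add.commute[of m] funpow_add)
qed

lemma lie_highest_weight_rep:
  fixes V :: "'v::ab_group_add lie_rep"
  assumes "l \<ge> 1" "\<Lambda> \<in> weight_lattice l" "\<And>i. i \<le> l \<Longrightarrow> fst \<Lambda> i \<ge> 0" "lie_irreducible_hw l \<Lambda> V"
  shows "highest_weight_rep (lscale V) l (lE V) (lF V) (lH V) (\<lambda>h x. of_int (pairing l h x))
    of_int (lie_weight_space l V) \<Lambda>"
proof -
  have V: "affine_module l V" using assms(4) by (simp add: lie_irreducible_hw_def)
  interpret vector_space "lscale V" using V by (simp add: affine_module_def)
  have lin: "Vector_Spaces.linear (lscale V) (lscale V) (lE V i)"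
    "Vector_Spaces.linear (lscale V) (lscale V) (lF V i)" if "i \<le> l" for i
    using V that by (auto simp: affine_module_def)
  have "\<forall>h\<in>coweight_lattice l. Vector_Spaces.linear (lscale V) (lscale V) (lH V h)"
    using V unfolding affine_module_def by (elim conjE)
  then have linH: "Vector_Spaces.linear (lscale V) (lscale V) (lH V h)" if "h \<in> coweight_lattice l" for h
    using that by (rule bspec)
  have HE: "lH V h (lE V i v) = lE V i (lH V h v) + lscale V (of_int (pairing l h (simple_root l i))) (lE V i v)"
    and HF: "lH V h (lF V i v) = lF V i (lH V h v) + lscale V (- of_int (pairing l h (simple_root l i))) (lF V i v)"
    if "h \<in> coweight_lattice l" "i \<le> l" for h i v
  proof -
    have "commutator (lH V h) (lE V i) v = lscale V (of_int (pairing l h (simple_root l i))) (lE V i v)"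
      "commutator (lH V h) (lF V i) v = lscale V (- of_int (pairing l h (simple_root l i))) (lF V i v)"
      using V that unfolding affine_module_def by blast+
    then show "lH V h (lE V i v) = lE V i (lH V h v) + lscale V (of_int (pairing l h (simple_root l i))) (lE V i v)"
      "lH V h (lF V i v) = lF V i (lH V h v) + lscale V (- of_int (pairing l h (simple_root l i))) (lF V i v)"
      unfolding commutator_def by (simp_all only: diff_eq_eq add.commute)
  qed
  have EF: "lE V i (lF V j v) - lF V j (lE V i v) = (if i = j then lH V (simple_coroot i) v else 0)"
    if "i \<le> l" "j \<le> l" for i j v
    using V that unfolding affine_module_def commutator_def by blast
  show ?thesis
  proof (intro highest_weight_rep.intro vector_space_axioms highest_weight_rep_axioms.intro)
    show "\<exists>h\<in>coweight_lattice l. complex_of_int (pairing l h x) \<noteq> of_int (pairing l h y)"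
      if "x \<in> weight_lattice l" "y \<in> weight_lattice l" "x \<noteq> y" for x y
      using pairing_separates[OF that] by simp
    show "lE V i v \<in> lie_weight_space l V (x + simple_root l i)"
      if "i \<le> l" "v \<in> lie_weight_space l V x" for i v x
      using that by (auto simp: lie_weight_space_def HE linear_ops[OF lin(1)] pairing_add_right scale_left_distrib)
    show "lF V i v \<in> lie_weight_space l V (x - simple_root l i)"
      if "i \<le> l" "v \<in> lie_weight_space l V x" for i v x
      using that by (auto simp: lie_weight_space_def HF linear_ops[OF lin(2)] pairing_diff_right scale_left_diff_distrib)
    show "lE V i (lF V j v) = lF V j (lE V i v)" if "i \<le> l" "j \<le> l" "i \<noteq> j" for i j v
      using EF[OF that(1,2), of v] that(3) by simp
    show "lE V i (lF V i v) = lF V i (lE V i v) + lscale V (of_int (fst x i)) v"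
      if "i \<le> l" "v \<in> lie_weight_space l V x" for i v x
      using EF[OF that(1,1), of v] that simple_coroot_in_coweight_lattice[OF that(1)]
      by (simp add: lie_weight_space_def pairing_simple_coroot diff_eq_eq add.commute)
    show "(\<Sum>j<k. complex_of_int (f - 2 * int j)) = of_int (int k) * of_int (f - int k + 1)" for f k
      by (induction k) (auto simp: algebra_simps)
    show "\<exists>m. (lF V i ^^ m) (lF V j v) = 0"
      if "i \<le> l" "j \<le> l" "i \<noteq> j" "(lF V i ^^ n) v = 0" for i j n v
      using commutator_nilpotent[OF lin(2) lin(2), of i j] V that unfolding affine_module_def by metis
    fix U
    assume "subspace U" "\<And>w i. w \<in> U \<Longrightarrow> i \<le> l \<Longrightarrow> lE V i w \<in> U"
      "\<And>w i. w \<in> U \<Longrightarrow> i \<le> l \<Longrightarrow> lF V i w \<in> U"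
      "\<And>w h. w \<in> U \<Longrightarrow> h \<in> coweight_lattice l \<Longrightarrow> lH V h w \<in> U"
    then have "lie_submodule l V U" by (simp add: lie_submodule_def)
    then show "U = {0} \<or> U = UNIV" using assms(4) by (simp add: lie_irreducible_hw_def)
  next
    show "\<exists>v. v \<noteq> 0 \<and> v \<in> lie_weight_space l V \<Lambda> \<and> (\<forall>i\<le>l. lE V i v = 0)"
      using assms(4) unfolding lie_irreducible_hw_def by blast
  qed (use assms lin linH in \<open>simp_all add: lie_weight_space_def\<close>)
qed

section \<open>Quantum integers and the module of the quantum group\<close>

text \<open>Extends \<open>qint\<close> to negative arguments, as coroot values of weights have
  either sign.\<close>

definition qint_z :: "int \<Rightarrow> ratq" where
  "qint_z n = (qvar powi n - qvar powi (- n)) / (qvar - qvar powi (-1))"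

lemma qvar_power: "qvar ^ n = Fract ([:0, 1:] ^ n) 1"
  by (induction n) (simp_all add: qvar_def One_fract_def mult_fract)

lemma qvar_nonzero [simp]: "qvar \<noteq> 0"
  by (simp add: qvar_def Zero_fract_def eq_fract)

lemma qvar_power_neq_1: "n > 0 \<Longrightarrow> qvar ^ n \<noteq> 1"
proof
  assume "n > 0" "qvar ^ n = 1"
  then have "[:0, 1::rat:] ^ n = 1" by (simp add: qvar_power One_fract_def eq_fract)
  then have "degree ([:0, 1::rat:] ^ n) = 0" by simp
  then show False using \<open>n > 0\<close> by (simp add: degree_power_eq)
qed

text \<open>q is not a root of unity. Hence the \<open>q^h\<close> separate weights and nonzero
  quantum integers stay nonzero.\<close>

lemma qvar_powi_inject [simp]: "qvar powi m = qvar powi n \<longleftrightarrow> m = n"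
proof -
  have pos: "qvar powi n \<noteq> 1" if "n > 0" for n
    using qvar_power_neq_1[of "nat n"] that by (simp add: power_int_def)
  have "m = n" if "qvar powi m = qvar powi n"
  proof (rule ccontr)
    assume "m \<noteq> n"
    moreover have "qvar powi (m - n) = 1" "qvar powi (n - m) = 1"
      using that by (simp_all add: power_int_diff)
    ultimately show False using pos[of "m - n"] pos[of "n - m"] by linarith
  qed
  then show ?thesis by auto
qed

lemma qint_z_denominator: "qvar - qvar powi (-1) \<noteq> 0"
  using qvar_powi_inject[of 1 "-1"] by (simp del: qvar_powi_inject)

lemma qint_z_nonzero: "n > 0 \<Longrightarrow> qint_z n \<noteq> 0"
  using qint_z_denominator by (simp add: qint_z_def)

text \<open>The sum telescopes by [f-2k] = [k+1][f-k] - [k][f-k+1].\<close>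

lemma qint_z_sum: "(\<Sum>j<k. qint_z (f - 2 * int j)) = qint_z (int k) * qint_z (f - int k + 1)"
proof (induction k)
  case 0
  show ?case by (simp add: qint_z_def)
next
  case (Suc k)
  \<comment> \<open>With q^k and q^f as independent symbols the telescoping identity becomes one
    between rational functions in \<open>A\<close>, \<open>B\<close> and
    \<open>qvar\<close>.\<close>
  define A B D where "A = qvar powi int k" "B = qvar powi f" "D = qvar - qvar powi (-1)"
  have nz: "A \<noteq> 0" "B \<noteq> 0" "D \<noteq> 0" "qvar \<noteq> 0"
    using qint_z_denominator by (auto simp: A_B_D_def)
  have p: "qvar powi (f - 2 * int k) = B / A^2" "qvar powi (2 * int k - f) = A^2 / B"
    "qvar powi (f - int k + 1) = B * qvar / A" "qvar powi (int k - f - 1) = A / (B * qvar)"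
    "qvar powi (f - int k) = B / A" "qvar powi (int k - f) = A / B"
    "qvar powi (int k + 1) = A * qvar" "qvar powi (- 1 - int k) = 1 / (A * qvar)"
    "qvar powi (- int k) = 1 / A"
    by (simp_all add: A_B_D_def power_int_diff power_int_add power_int_minus power_int_mult mult.commute[of 2]
        divide_inverse)
  have D: "D = qvar - 1 / qvar" by (simp add: A_B_D_def power_int_minus field_simps)
  have eqs: "qint_z (int k) = (A - 1 / A) / D"
    "qint_z (f - int k + 1) = (B * qvar / A - A / (B * qvar)) / D"
    "qint_z (f - 2 * int k) = (B / A^2 - A^2 / B) / D"
    "qint_z (int (Suc k)) = (A * qvar - 1 / (A * qvar)) / D"
    "qint_z (f - int (Suc k) + 1) = (B / A - A / B) / D"
    unfolding qint_z_def A_B_D_def(3)[symmetric] using p by (simp_all add: A_B_D_def algebra_simps)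
  have key: "(B / A^2 - A^2 / B) * D =
      (A * qvar - 1 / (A * qvar)) * (B / A - A / B) - (A - 1 / A) * (B * qvar / A - A / (B * qvar))"
    unfolding D using nz by (simp add: field_simps power2_eq_square)
  have "qint_z (f - 2 * int k) = (B / A^2 - A^2 / B) * D / (D * D)"
    unfolding eqs using nz by simp
  also have "\<dots> = qint_z (int (Suc k)) * qint_z (f - int (Suc k) + 1)
      - qint_z (int k) * qint_z (f - int k + 1)"
    unfolding eqs key by (simp only: diff_divide_distrib[of "_ * _" "_ * _"] times_divide_times_eq)
  finally have "qint_z (f - 2 * int k) = qint_z (int (Suc k)) * qint_z (f - int (Suc k) + 1)
      - qint_z (int k) * qint_z (f - int k + 1)" .
  then show ?case using Suc by simp
qed

lemma qint_nonzero: "n \<ge> 1 \<Longrightarrow> qint n \<noteq> 0"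
  using qint_z_nonzero[of "int n"] by (simp add: qint_def qint_z_def)

lemma qfact_nonzero: "qfact n \<noteq> 0"
  by (simp add: qfact_def qint_nonzero)

lemma quantum_highest_weight_rep:
  fixes M :: "'w::ab_group_add q_rep"
  assumes "l \<ge> 1" "\<Lambda> \<in> weight_lattice l" "\<And>i. i \<le> l \<Longrightarrow> fst \<Lambda> i \<ge> 0" "q_irreducible_hw l \<Lambda> M"
  shows "highest_weight_rep (qscale M) l (qE M) (qF M) (qK M) (\<lambda>h x. qvar powi pairing l h x)
    qint_z (q_weight_space l M) \<Lambda>"
proof -
  have M: "quantum_module l M" using assms(4) by (simp add: q_irreducible_hw_def)
  interpret vector_space "qscale M" using M by (simp add: quantum_module_def)
  have lin: "Vector_Spaces.linear (qscale M) (qscale M) (qE M i)"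
    "Vector_Spaces.linear (qscale M) (qscale M) (qF M i)" if "i \<le> l" for i
    using M that by (auto simp: quantum_module_def)
  have "\<forall>h\<in>coweight_lattice l. Vector_Spaces.linear (qscale M) (qscale M) (qK M h)"
    using M unfolding quantum_module_def by (elim conjE)
  then have linK: "Vector_Spaces.linear (qscale M) (qscale M) (qK M h)" if "h \<in> coweight_lattice l" for h
    using that by (rule bspec)
  have KE: "qK M h (qE M i (qK M (- h) v)) = qscale M (qvar powi pairing l h (simple_root l i)) (qE M i v)"
    and KF: "qK M h (qF M i (qK M (- h) v)) = qscale M (qvar powi (- pairing l h (simple_root l i))) (qF M i v)"
    if "h \<in> coweight_lattice l" "i \<le> l" for h i v
    using M that unfolding quantum_module_def by blast+
  have EF: "qE M i (qF M j v) - qF M j (qE M i v) = (if i = j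
           then qscale M (inverse (qvar - qvar powi (-1)))
                  (qK M (simple_coroot i) v - qK M (- simple_coroot i) v) else 0)"
    if "i \<le> l" "j \<le> l" for i j v
    using M that unfolding quantum_module_def commutator_def by blast
  \<comment> \<open>The relations conjugate by \<open>q^h\<close>; on a weight vector the inner
    \<open>q^(-h)\<close> is a scalar, which \<open>shift\<close> moves to the other side.\<close>
  have shift: "qK M h v = qscale M (qvar powi (a + pairing l h x)) v"
    if "qscale M (qvar powi (- pairing l h x)) (qK M h v) = qscale M (qvar powi a) v" for h x v a
  proof -
    have "qK M h v = qscale M (qvar powi pairing l h x) (qscale M (qvar powi (- pairing l h x)) (qK M h v))"
      by (simp flip: power_int_add)
    then show ?thesis unfolding that by (simp add: add.commute flip: power_int_add)
  qed
  show ?thesis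
  proof (intro highest_weight_rep.intro vector_space_axioms highest_weight_rep_axioms.intro)
    show "\<exists>h\<in>coweight_lattice l. qvar powi pairing l h x \<noteq> qvar powi pairing l h y"
      if "x \<in> weight_lattice l" "y \<in> weight_lattice l" "x \<noteq> y" for x y
      using pairing_separates[OF that] by simp
    show "qE M i v \<in> q_weight_space l M (x + simple_root l i)"
      if "i \<le> l" "v \<in> q_weight_space l M x" for i v x
    proof -
      have "qK M h (qE M i v) = qscale M (qvar powi (pairing l h (simple_root l i) + pairing l h x)) (qE M i v)"
        if h: "h \<in> coweight_lattice l" for h
        using KE[OF h \<open>i \<le> l\<close>, of v] \<open>v \<in> _\<close> coweight_lattice_minus[OF h]
        by (intro shift) (simp add: q_weight_space_def pairing_minus_left linear_ops[OF lin(1)[OF \<open>i \<le> l\<close>]] linear_ops[OF linK[OF h]])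
      then show ?thesis by (simp add: q_weight_space_def pairing_add_right add.commute)
    qed
    show "qF M i v \<in> q_weight_space l M (x - simple_root l i)"
      if "i \<le> l" "v \<in> q_weight_space l M x" for i v x
    proof -
      have "qK M h (qF M i v) = qscale M (qvar powi (- pairing l h (simple_root l i) + pairing l h x)) (qF M i v)"
        if h: "h \<in> coweight_lattice l" for h
        using KF[OF h \<open>i \<le> l\<close>, of v] \<open>v \<in> _\<close> coweight_lattice_minus[OF h]
        by (intro shift) (simp add: q_weight_space_def pairing_minus_left linear_ops[OF lin(2)[OF \<open>i \<le> l\<close>]] linear_ops[OF linK[OF h]])
      then show ?thesis by (simp add: q_weight_space_def pairing_diff_right)
    qed
    show "qE M i (qF M j v) = qF M j (qE M i v)" if "i \<le> l" "j \<le> l" "i \<noteq> j" for i j v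
      using EF[OF that(1,2), of v] that(3) by simp
    show "qE M i (qF M i v) = qF M i (qE M i v) + qscale M (qint_z (fst x i)) v"
      if "i \<le> l" "v \<in> q_weight_space l M x" for i v x
      using EF[OF that(1,1), of v] that simple_coroot_in_coweight_lattice[OF that(1)]
        coweight_lattice_minus[OF simple_coroot_in_coweight_lattice[OF that(1)]]
      by (simp add: q_weight_space_def pairing_simple_coroot pairing_minus_left diff_eq_eq add.commute
        qint_z_def divide_inverse mult.commute flip: scale_left_diff_distrib)
    show "qint_z (- z) = - qint_z z" for z
      by (simp add: qint_z_def diff_divide_distrib)
    show "\<exists>m. (qF M i ^^ m) (qF M j v) = 0"
      if "i \<le> l" "j \<le> l" "i \<noteq> j" "(qF M i ^^ n) v = 0" for i j n v
    proof -
      define m where "m = nat (1 - cartan l i j)"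
      have "(\<Sum>k\<le>m. qscale M ((-1) ^ k) (dividedF M i (m - k) (qF M j (dividedF M i k v)))) = 0" for v
        using M that unfolding quantum_module_def m_def Let_def by blast
      then have "(\<Sum>k\<le>m. qscale M ((-1) ^ k * inverse (qfact (m - k)) * inverse (qfact k))
          ((qF M i ^^ (m - k)) (qF M j ((qF M i ^^ k) v)))) = 0" for v
        by (simp add: dividedF_def linear_ops[OF lin(2)] linear_ops[OF linear_funpow[OF lin(2)]] that mult.assoc)
      then show ?thesis
        using serre_sum_nilpotent[OF lin(2)[OF that(1)] lin(2)[OF that(2)] _ _ that(4), where m = m
            and r = "\<lambda>k. (-1) ^ k * inverse (qfact (m - k)) * inverse (qfact k)"]
        by (auto simp: qfact_nonzero)
    qed
    fix U
    assume "subspace U" "\<And>w i. w \<in> U \<Longrightarrow> i \<le> l \<Longrightarrow> qE M i w \<in> U"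
      "\<And>w i. w \<in> U \<Longrightarrow> i \<le> l \<Longrightarrow> qF M i w \<in> U"
      "\<And>w h. w \<in> U \<Longrightarrow> h \<in> coweight_lattice l \<Longrightarrow> qK M h w \<in> U"
    then have "q_submodule l M U" by (simp add: q_submodule_def)
    then show "U = {0} \<or> U = UNIV" using assms(4) by (simp add: q_irreducible_hw_def)
  next
    show "\<exists>v. v \<noteq> 0 \<and> v \<in> q_weight_space l M \<Lambda> \<and> (\<forall>i\<le>l. qE M i v = 0)"
      using assms(4) unfolding q_irreducible_hw_def by blast
  qed (use assms lin linK in \<open>simp_all add: q_weight_space_def qint_z_nonzero qint_z_sum\<close>, simp add: qint_z_def)
qed


section \<open>Decomposition of weight vectors into strings\<close>

context highest_weight_rep begin

text \<open>The vector \<open>(E i ^^ n) v\<close> is killed by \<open>E i\<close>; subtracting a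
  suitable multiple of its image under \<open>F i ^^ n\<close> lowers the nilpotency order of
  \<open>v\<close>. As \<open>u k\<close> has coroot value \<open>fst x i + 2 * int k\<close>, the
  last condition is the bound on \<open>k\<close> that \<open>kashiwara_decomp\<close>
  demands.\<close>

lemma string_decomposition:
  assumes "i \<le> l" "x \<in> weight_lattice l" "v \<in> W x" "(E i ^^ n) v = 0"
  shows "\<exists>u. v = (\<Sum>k<n. (F i ^^ k) (u k)) \<and>
    (\<forall>k<n. u k \<in> W (x + int_mult (int k) (simple_root l i)) \<and> E i (u k) = 0 \<and>
      (u k \<noteq> 0 \<longrightarrow> 0 \<le> fst x i + int k))"
  using assms(3,4)
proof (induction n arbitrary: v)
  case 0
  then show ?case by simp
next
  case (Suc n)
  interpret sl2: sl2_graded scale "E i" "F i" "\<lambda>f. \<Union>x\<in>{x\<in>weight_lattice l. fst x i = f}. W x" c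
    by (rule sl2_graded) fact
  define t where "t = (E i ^^ n) v"
  let ?y = "x + int_mult (int n) (simple_root l i)"
  have t: "t \<in> W ?y" "E i t = 0"
    using E_pow_W[OF assms(1) Suc.prems(1)] Suc.prems(2) by (simp_all add: t_def)
  have fst_y: "fst ?y i = fst x i + 2 * int n" by (simp add: fst_simple_root_self[OF rank_pos assms(1)])
  have y: "?y \<in> weight_lattice l" using string_in_weight_lattice assms(2) by blast
  \<comment> \<open>Otherwise \<open>Suc n\<close> is at most \<open>- fst x i\<close>, and so many
    applications of \<open>E i\<close> cannot kill a nonzero \<open>v\<close>.\<close>
  have bound: "0 \<le> fst x i + int n" if "t \<noteq> 0"
  proof (rule ccontr)
    assume "\<not> ?thesis"
    moreover have "v \<noteq> 0"
      using that by (auto simp: t_def linear_ops[OF linear_funpow[OF E_linear[OF assms(1)]]])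
    ultimately have "(E i ^^ Suc n) v \<noteq> 0"
      by (intro E_pow_nonzero[OF assms(1,2) Suc.prems(1)]) auto
    then show False using Suc.prems(2) by simp
  qed
  define r where "r = (\<Prod>j\<in>{0<..n}. sl2.s (fst ?y i) j)"
  have r: "r \<noteq> 0" if "t \<noteq> 0"
  proof -
    have "sl2.s (fst ?y i) j \<noteq> 0" if "j \<in> {0<..n}" for j
      by (rule sl2.s_nonzero) (use that bound[OF \<open>t \<noteq> 0\<close>] in \<open>auto simp only: fst_y greaterThanAtMost_iff\<close>)
    then show ?thesis by (simp add: r_def)
  qed
  have EF: "(E i ^^ n) ((F i ^^ n) t) = scale r t"
    using sl2.X_pow_Y_pow_singular[OF W_G[OF y t(1)] t(2), of n 0] by (simp add: r_def)
  define u where "u = scale (inverse r) t"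
  have u: "u \<in> W ?y" "E i u = 0"
    using t by (auto simp: u_def W_scale linear_ops[OF E_linear[OF assms(1)]])
  have Fu: "(F i ^^ n) u \<in> W x" using F_pow_W[OF assms(1) u(1), of n] by simp
  have "(E i ^^ n) (v - (F i ^^ n) u) = 0"
    using EF r by (cases "t = 0")
      (auto simp: u_def linear_ops[OF linear_funpow[OF E_linear[OF assms(1)]]]
        linear_ops[OF linear_funpow[OF F_linear[OF assms(1)]]] simp flip: t_def)
  from Suc.IH[OF W_diff[OF Suc.prems(1) Fu] this] obtain w where
    w: "v - (F i ^^ n) u = (\<Sum>k<n. (F i ^^ k) (w k))"
      "\<forall>k<n. w k \<in> W (x + int_mult (int k) (simple_root l i)) \<and> E i (w k) = 0 \<and>
        (w k \<noteq> 0 \<longrightarrow> 0 \<le> fst x i + int k)" by blast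
  show ?case
  proof (intro exI[of _ "w(n := u)"] conjI)
    have "v = (F i ^^ n) u + (\<Sum>k<n. (F i ^^ k) (w k))" using w(1) by (metis diff_add_cancel add.commute)
    then show "v = (\<Sum>k<Suc n. (F i ^^ k) ((w(n := u)) k))"
      by (simp add: add.commute)
    show "\<forall>k<Suc n. (w(n := u)) k \<in> W (x + int_mult (int k) (simple_root l i)) \<and>
        E i ((w(n := u)) k) = 0 \<and> ((w(n := u)) k \<noteq> 0 \<longrightarrow> 0 \<le> fst x i + int k)"
      using w(2) u bound by (auto simp: less_Suc_eq u_def)
  qed
qed

text \<open>For the largest exponent \<open>n\<close> with a nonzero component,
  \<open>E i ^^ n\<close> kills the lower terms and returns the top ones up to nonzero scalars;
  weights then tell the top ones apart.\<close>

lemma string_decomposition_unique: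
  assumes "i \<le> l" "finite S"
    and S: "\<And>k x. (k, x) \<in> S \<Longrightarrow> x \<in> weight_lattice l \<and> int k \<le> fst x i \<and> u (k, x) \<in> W x \<and> E i (u (k, x)) = 0"
    and sum: "(\<Sum>p\<in>S. (F i ^^ fst p) (u p)) = 0" and "p \<in> S"
  shows "u p = 0"
proof (rule ccontr)
  assume "u p \<noteq> 0"
  interpret sl2: sl2_graded scale "E i" "F i" "\<lambda>f. \<Union>x\<in>{x\<in>weight_lattice l. fst x i = f}. W x" c
    by (rule sl2_graded) fact
  define N where "N = fst ` {p\<in>S. u p \<noteq> 0}"
  have N: "finite N" "N \<noteq> {}"
    using assms(2,5) \<open>u p \<noteq> 0\<close> unfolding N_def by (simp, blast)
  define n where "n = Max N"
  have S': "snd p \<in> weight_lattice l" "int (fst p) \<le> fst (snd p) i" "u p \<in> W (snd p)" "E i (u p) = 0"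
    if "p \<in> S" for p
    using S[of "fst p" "snd p"] that by auto
  have lower: "(E i ^^ n) ((F i ^^ fst p) (u p)) = 0" if "p \<in> S - {p\<in>S. fst p = n}" for p
  proof (cases "u p = 0")
    case True
    then show ?thesis
      by (simp add: linear_ops[OF linear_funpow[OF E_linear[OF assms(1)]]]
          linear_ops[OF linear_funpow[OF F_linear[OF assms(1)]]])
  next
    case False
    then have "fst p \<le> n" unfolding n_def using N(1) that by (intro Max_ge) (auto simp: N_def)
    with that have "fst p < n" by auto
    then show ?thesis
      using sl2.X_pow_Y_pow_singular_eq_0[OF W_G[OF S'(1) S'(3)] S'(4)] that by blast
  qed
  define r where "r x = (\<Prod>j\<in>{0<..n}. sl2.s (fst x i) j)" for x :: weight
  have top: "(E i ^^ n) ((F i ^^ fst p) (u p)) = scale (r (snd p)) (u p)" if "p \<in> {p\<in>S. fst p = n}" for p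
    using sl2.X_pow_Y_pow_singular[OF W_G[OF S'(1) S'(3)] S'(4), of p n 0] that by (simp add: r_def)
  have "0 = (E i ^^ n) (\<Sum>p\<in>S. (F i ^^ fst p) (u p))"
    by (simp add: sum linear_ops[OF linear_funpow[OF E_linear[OF assms(1)]]])
  also have "\<dots> = (\<Sum>p\<in>S. (E i ^^ n) ((F i ^^ fst p) (u p)))"
    by (rule linear_ops[OF linear_funpow[OF E_linear[OF assms(1)]]])
  also have "\<dots> = (\<Sum>p\<in>{p\<in>S. fst p = n}. (E i ^^ n) ((F i ^^ fst p) (u p)))"
    using assms(2) lower by (intro sum.mono_neutral_right) auto
  also have "\<dots> = (\<Sum>p\<in>{p\<in>S. fst p = n}. scale (r (snd p)) (u p))"
    by (rule sum.cong[OF refl top])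
  finally have zero: "(\<Sum>p\<in>{p\<in>S. fst p = n}. scale (r (snd p)) (u p)) = 0" by simp
  have "n \<in> N" unfolding n_def by (rule Max_in) (use N in auto)
  then obtain q where q: "q \<in> S" "u q \<noteq> 0" "fst q = n" by (auto simp: N_def)
  have "(\<Sum>p\<in>{p\<in>{p\<in>S. fst p = n}. snd p = snd q}. scale (r (snd p)) (u p)) = 0"
    by (rule weight_components_vanish[OF _ _ _ zero]) (use assms(2) S' in \<open>auto intro!: W_scale\<close>)
  moreover have "{p\<in>{p\<in>S. fst p = n}. snd p = snd q} = {q}" using q by (auto simp: prod_eq_iff)
  ultimately have "scale (r (snd q)) (u q) = 0" by simp
  moreover have "r (snd q) \<noteq> 0"
  proof -
    have "sl2.s (fst (snd q) i) j \<noteq> 0" if "j \<in> {0<..n}" for j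
      by (rule sl2.s_nonzero) (use that S'(2)[OF q(1)] q(3) in auto)
    then show ?thesis by (simp add: r_def)
  qed
  ultimately show False using q(2) by simp
qed

end

section \<open>Kashiwara operators\<close>

locale quantum_rep =
  fixes l :: nat and M :: "'w::ab_group_add q_rep" and \<Lambda> :: weight
  assumes rank: "l \<ge> 1" and lattice: "\<Lambda> \<in> weight_lattice l"
    and dominant: "\<And>i. i \<le> l \<Longrightarrow> fst \<Lambda> i \<ge> 0" and irreducible_hw: "q_irreducible_hw l \<Lambda> M"
begin

sublocale highest_weight_rep "qscale M" l "qE M" "qF M" "qK M" "\<lambda>h x. qvar powi pairing l h x"
    qint_z "q_weight_space l M" \<Lambda>
  using quantum_highest_weight_rep[OF rank lattice dominant irreducible_hw] .

text \<open>The arbitrary \<open>g\<close> serves both Kashiwara operators: anything computed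
  termwise from a decomposition does not depend on it, so their definite descriptions are well
  defined. Extension by zero to \<open>S \<union> S'\<close> makes the two decompositions
  comparable.\<close>

lemma kashiwara_decomp_unique:
  fixes g :: "nat \<Rightarrow> 'w \<Rightarrow> 'w"
  assumes "i \<le> l" "kashiwara_decomp l M i v S u" "kashiwara_decomp l M i v S' u'"
    and g: "\<And>k. g k 0 = 0"
  shows "(\<Sum>p\<in>S. g (fst p) (u p)) = (\<Sum>p\<in>S'. g (fst p) (u' p))"
proof -
  define e where "e p = (if p \<in> S then u p else 0)" for p
  define e' where "e' p = (if p \<in> S' then u' p else 0)" for p
  have fin: "finite S" "finite S'" using assms(2,3) by (auto simp: kashiwara_decomp_def)
  have extend: "(\<Sum>p\<in>S. h (fst p) (u p)) = (\<Sum>p\<in>S \<union> S'. h (fst p) (e p))"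
    "(\<Sum>p\<in>S'. h (fst p) (u' p)) = (\<Sum>p\<in>S \<union> S'. h (fst p) (e' p))"
    if "\<And>k. h k 0 = 0" for h :: "nat \<Rightarrow> 'w \<Rightarrow> 'w"
    using fin that by (auto simp: e_def e'_def intro!: sum.mono_neutral_cong_left)
  have F0: "dividedF M i k 0 = 0" for k
    by (simp add: dividedF_def linear_ops[OF linear_funpow[OF F_linear[OF assms(1)]]])
  have "(\<Sum>p\<in>S \<union> S'. (qF M i ^^ fst p) (qscale M (inverse (qfact (fst p))) (e p - e' p))) =
      (\<Sum>p\<in>S. dividedF M i (fst p) (u p)) - (\<Sum>p\<in>S'. dividedF M i (fst p) (u' p))"
    unfolding extend[of "dividedF M i", OF F0] sum_subtractf[symmetric]
    by (simp add: dividedF_def scale_right_diff_distrib linear_ops[OF linear_funpow[OF F_linear[OF assms(1)]]])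
  also have "\<dots> = 0" using assms(2,3) by (simp add: kashiwara_decomp_def)
  finally have sum: "(\<Sum>p\<in>S \<union> S'. (qF M i ^^ fst p) (qscale M (inverse (qfact (fst p))) (e p - e' p))) = 0" .
  have "qscale M (inverse (qfact (fst p))) (e p - e' p) = 0" if "p \<in> S \<union> S'" for p
  proof (rule string_decomposition_unique[OF assms(1) _ _ sum that])
    fix k x assume kx: "(k, x) \<in> S \<union> S'"
    have x: "x \<in> weight_lattice l" "int k \<le> fst x i"
      using kx assms(2,3) by (auto simp: kashiwara_decomp_def pairing_simple_coroot[OF assms(1)])
    have "e (k, x) \<in> q_weight_space l M x" "qE M i (e (k, x)) = 0"
      "e' (k, x) \<in> q_weight_space l M x" "qE M i (e' (k, x)) = 0"
      using assms(2,3) W_zero[of x]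
      by (auto simp: kashiwara_decomp_def e_def e'_def linear_ops[OF E_linear[OF assms(1)]])
    then show "x \<in> weight_lattice l \<and> int k \<le> fst x i \<and>
        qscale M (inverse (qfact (fst (k, x)))) (e (k, x) - e' (k, x)) \<in> q_weight_space l M x \<and>
        qE M i (qscale M (inverse (qfact (fst (k, x)))) (e (k, x) - e' (k, x))) = 0"
      using x by (auto intro!: W_scale W_diff simp: linear_ops[OF E_linear[OF assms(1)]])
  qed (use fin in auto)
  then have "e p = e' p" if "p \<in> S \<union> S'" for p using that by (simp add: qfact_nonzero)
  then show ?thesis unfolding extend[of g, OF g] by (intro sum.cong refl) auto
qed

lemma kashiwara_e_eq:
  assumes "i \<le> l" "kashiwara_decomp l M i v S u"
  shows "kashiwara_e l M i v = (\<Sum>p\<in>S. if fst p = 0 then 0 else dividedF M i (fst p - 1) (u p))"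
  unfolding kashiwara_e_def
proof (rule the_equality)
  fix w assume "\<exists>S c. kashiwara_decomp l M i v S c \<and>
     w = (\<Sum>p\<in>S. if fst p = 0 then 0 else dividedF M i (fst p - 1) (c p))"
  then obtain S' u' where 1: "kashiwara_decomp l M i v S' u'"
    and 2: "w = (\<Sum>p\<in>S'. if fst p = 0 then 0 else dividedF M i (fst p - 1) (u' p))" by auto
  show "w = (\<Sum>p\<in>S. if fst p = 0 then 0 else dividedF M i (fst p - 1) (u p))"
    unfolding 2
    by (rule kashiwara_decomp_unique[OF assms(1) 1 assms(2), of "\<lambda>k x. if k = 0 then 0 else dividedF M i (k - 1) x"])
       (simp add: dividedF_def linear_ops[OF linear_funpow[OF F_linear[OF assms(1)]]])
qed (use assms in auto)

lemma kashiwara_f_eq: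
  assumes "i \<le> l" "kashiwara_decomp l M i v S u"
  shows "kashiwara_f l M i v = (\<Sum>p\<in>S. dividedF M i (Suc (fst p)) (u p))"
  unfolding kashiwara_f_def
proof (rule the_equality)
  fix w assume "\<exists>S c. kashiwara_decomp l M i v S c \<and> w = (\<Sum>p\<in>S. dividedF M i (Suc (fst p)) (c p))"
  then obtain S' u' where 1: "kashiwara_decomp l M i v S' u'"
    and 2: "w = (\<Sum>p\<in>S'. dividedF M i (Suc (fst p)) (u' p))" by auto
  show "w = (\<Sum>p\<in>S. dividedF M i (Suc (fst p)) (u p))"
    unfolding 2
    by (rule kashiwara_decomp_unique[OF assms(1) 1 assms(2), of "\<lambda>k. dividedF M i (Suc k)"])
       (simp add: dividedF_def linear_ops[OF linear_funpow[OF F_linear[OF assms(1)]]]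
        linear_ops[OF F_linear[OF assms(1)]])
qed (use assms in auto)

lemma dividedF_weight_space:
  "i \<le> l \<Longrightarrow> v \<in> q_weight_space l M x \<Longrightarrow>
    dividedF M i k v \<in> q_weight_space l M (x - int_mult (int k) (simple_root l i))"
  by (simp add: dividedF_def W_scale F_pow_W)

lemma kashiwara_on_string:
  assumes "i \<le> l" "x \<in> weight_lattice l" "v \<in> q_weight_space l M x" "qE M i v = 0" "int k \<le> fst x i"
  shows "kashiwara_e l M i (dividedF M i k v) = (if k = 0 then 0 else dividedF M i (k - 1) v)"
    and "kashiwara_f l M i (dividedF M i k v) = dividedF M i (Suc k) v"
proof -
  have "kashiwara_decomp l M i (dividedF M i k v) {(k, x)} (\<lambda>_. v)"
    using assms by (simp add: kashiwara_decomp_def pairing_simple_coroot)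
  from kashiwara_e_eq[OF assms(1) this] kashiwara_f_eq[OF assms(1) this]
  show "kashiwara_e l M i (dividedF M i k v) = (if k = 0 then 0 else dividedF M i (k - 1) v)"
    and "kashiwara_f l M i (dividedF M i k v) = dividedF M i (Suc k) v" by simp_all
qed

lemma kashiwara_weight_space:
  assumes "i \<le> l" "x \<in> weight_lattice l" "v \<in> q_weight_space l M x"
  shows "kashiwara_e l M i v \<in> q_weight_space l M (x + simple_root l i)"
    and "kashiwara_f l M i v \<in> q_weight_space l M (x - simple_root l i)"
proof -
  obtain n where "(qE M i ^^ n) v = 0" using E_locally_nilpotent[OF assms] by auto
  from string_decomposition[OF assms this] obtain u where
    v: "v = (\<Sum>k<n. (qF M i ^^ k) (u k))" and
    u: "\<And>k. k < n \<Longrightarrow> u k \<in> q_weight_space l M (x + int_mult (int k) (simple_root l i))"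
      "\<And>k. k < n \<Longrightarrow> qE M i (u k) = 0" "\<And>k. k < n \<Longrightarrow> u k \<noteq> 0 \<Longrightarrow> 0 \<le> fst x i + int k"
    by blast
  \<comment> \<open>Only nonzero components are kept, since the bound on \<open>k\<close> is known
    for these alone.\<close>
  define K where "K = {k\<in>{..<n}. u k \<noteq> 0}"
  define p where "p k = (k, x + int_mult (int k) (simple_root l i))" for k
  have inj: "inj_on p K" by (auto simp: inj_on_def p_def)
  define S where "S = p ` K"
  \<comment> \<open>The quantum factorial cancels the one in the divided power.\<close>
  define c where "c q = qscale M (qfact (fst q)) (u (fst q))" for q :: "nat \<times> weight"
  have decomp: "kashiwara_decomp l M i v S c"
    unfolding kashiwara_decomp_def
  proof (intro conjI)
    have "v = (\<Sum>k\<in>K. (qF M i ^^ k) (u k))" unfolding v K_def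
      by (rule sum.mono_neutral_right) (auto simp: linear_ops[OF linear_funpow[OF F_linear[OF assms(1)]]])
    then show "v = (\<Sum>p\<in>S. dividedF M i (fst p) (c p))"
      unfolding S_def sum.reindex[OF inj]
      by (simp add: p_def c_def dividedF_def qfact_nonzero
          linear_ops[OF linear_funpow[OF F_linear[OF assms(1)]]])
    show "\<forall>(k, y)\<in>S. y \<in> weight_lattice l \<and> int k \<le> pairing l (simple_coroot i) y \<and>
        c (k, y) \<in> q_weight_space l M y \<and> qE M i (c (k, y)) = 0"
      using u(1,2) u(3)[unfolded add.commute[of "fst x i"]] assms(1,2) string_in_weight_lattice(1)[of x]
      by (auto simp: S_def K_def p_def c_def pairing_simple_coroot fst_simple_root_self[OF rank assms(1)]
          linear_ops[OF E_linear[OF assms(1)]] intro!: W_scale)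
  qed (simp add: S_def K_def)
  have c: "c (p k) \<in> q_weight_space l M (x + int_mult (int k) (simple_root l i))" if "k \<in> K" for k
    using u(1) that by (auto simp: c_def p_def K_def intro: W_scale)
  show "kashiwara_e l M i v \<in> q_weight_space l M (x + simple_root l i)"
    unfolding kashiwara_e_eq[OF assms(1) decomp]
  proof (rule W_sum)
    fix q assume "q \<in> S"
    then obtain k where k: "k \<in> K" "q = p k" by (auto simp: S_def)
    show "(if fst q = 0 then 0 else dividedF M i (fst q - 1) (c q)) \<in> q_weight_space l M (x + simple_root l i)"
    proof (cases k)
      case 0
      then show ?thesis using k W_zero by (simp add: p_def)
    next
      case (Suc j)
      then show ?thesis
        using dividedF_weight_space[OF assms(1) c[OF k(1)], of j] k int_mult_add[of 1 "int j"]
        by (simp add: p_def add.assoc)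
    qed
  qed
  show "kashiwara_f l M i v \<in> q_weight_space l M (x - simple_root l i)"
    unfolding kashiwara_f_eq[OF assms(1) decomp]
  proof (rule W_sum)
    fix q assume "q \<in> S"
    then obtain k where k: "k \<in> K" "q = p k" by (auto simp: S_def)
    show "dividedF M i (Suc (fst q)) (c q) \<in> q_weight_space l M (x - simple_root l i)"
      using dividedF_weight_space[OF assms(1) c[OF k(1)], of "Suc k"] k int_mult_add[of 1 "int k"]
      by (simp add: p_def algebra_simps)
  qed
qed

end

section \<open>Crystal bases\<close>

lemma regular_at_0_iff: "r \<in> regular_at_0 \<longleftrightarrow> (\<exists>a b. r = Fract a b \<and> poly b 0 \<noteq> 0)"
  by (auto simp: regular_at_0_def)

lemma regular_at_0_Fract: "poly b 0 \<noteq> 0 \<Longrightarrow> Fract a b \<in> regular_at_0"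
  by (auto simp: regular_at_0_def)

lemma regular_at_0_add: "r \<in> regular_at_0 \<Longrightarrow> s \<in> regular_at_0 \<Longrightarrow> r + s \<in> regular_at_0"
proof -
  assume "r \<in> regular_at_0" "s \<in> regular_at_0"
  then obtain a b a' b' where "r = Fract a b" "poly b 0 \<noteq> 0" "s = Fract a' b'" "poly b' 0 \<noteq> 0"
    by (auto simp: regular_at_0_iff)
  moreover from this have "b \<noteq> 0" "b' \<noteq> 0" by auto
  ultimately show ?thesis by (auto intro!: regular_at_0_Fract)
qed

lemma regular_at_0_mult: "r \<in> regular_at_0 \<Longrightarrow> s \<in> regular_at_0 \<Longrightarrow> r * s \<in> regular_at_0"
  by (auto simp: regular_at_0_iff) (metis mult_fract poly_mult mult_eq_0_iff)

lemma regular_at_0_const: "Fract [:r:] 1 \<in> regular_at_0"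
  by (rule regular_at_0_Fract) simp

lemma regular_at_0_simps [simp]: "0 \<in> regular_at_0" "1 \<in> regular_at_0" "- 1 \<in> regular_at_0" "qvar \<in> regular_at_0"
proof -
  show "0 \<in> regular_at_0" using regular_at_0_const[of 0] by (simp add: fract_collapse)
  show "1 \<in> regular_at_0" using regular_at_0_const[of 1] by (simp add: fract_collapse flip: one_pCons)
  show "- 1 \<in> regular_at_0" using regular_at_0_const[of "- 1"]
    by (metis minus_fract minus_pCons One_fract_def one_pCons neg_equal_0_iff_equal minus_zero)
  show "qvar \<in> regular_at_0" unfolding qvar_def by (rule regular_at_0_Fract) simp
qed

lemma regular_at_0_power: "qvar ^ n \<in> regular_at_0"
  by (induction n) (auto intro: regular_at_0_mult)

text \<open>The exponent is the order of the denominator at 0.\<close>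

lemma qvar_power_mult_regular: "\<exists>n. qvar ^ n * r \<in> regular_at_0"
proof (cases r)
  case (Fract a b)
  obtain b' where b': "b = [:- 0, 1:] ^ order 0 b * b'" "\<not> [:- 0, 1:] dvd b'"
    using order_decomp[OF Fract(2), of 0] by blast
  then have "poly b' 0 \<noteq> 0" "b' \<noteq> 0" by (auto simp: poly_eq_0_iff_dvd)
  moreover have "qvar ^ order 0 b * r = Fract a b'"
    using Fract b'(1) \<open>b' \<noteq> 0\<close> by (simp add: qvar_power eq_fract)
  ultimately show ?thesis by (metis regular_at_0_Fract)
qed

text \<open>Dividing by q once more than the numerator vanishes at 0 produces a pole.\<close>

lemma not_infinitely_qvar_divisible:
  assumes "r \<noteq> 0"
  shows "\<exists>n. inverse (qvar ^ n) * r \<notin> regular_at_0"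
proof (cases r)
  case (Fract a b)
  then have "a \<noteq> 0" using assms by (auto simp: fract_collapse)
  show ?thesis
  proof (rule exI, rule notI)
    let ?n = "Suc (order 0 a)"
    assume "inverse (qvar ^ ?n) * r \<in> regular_at_0"
    then obtain a' b' where ab: "inverse (qvar ^ ?n) * r = Fract a' b'" "poly b' 0 \<noteq> 0"
      by (auto simp: regular_at_0_iff)
    then have b': "b' \<noteq> 0" by auto
    have "r = qvar ^ ?n * (inverse (qvar ^ ?n) * r)"
      by (simp add: mult.assoc[symmetric] del: power_Suc)
    also have "\<dots> = Fract ([:0, 1:] ^ ?n * a') b'" unfolding ab(1) by (simp add: qvar_power del: power_Suc)
    finally have "a * b' = [:0, 1:] ^ ?n * a' * b" using Fract b' by (simp add: eq_fract)
    then have "[:- 0, 1:] ^ ?n dvd a * b'" by (simp add: mult.assoc del: power_Suc)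
    then have "?n \<le> order 0 (a * b')" using order_divides[of 0 ?n "a * b'"] \<open>a \<noteq> 0\<close> b' by auto
    also have "\<dots> = order 0 a" using \<open>a \<noteq> 0\<close> b' ab(2) by (simp add: order_mult order_0I)
    finally show False by simp
  qed
qed

text \<open>Membership in the lattice becomes a condition on coordinates, so closure properties of
  the lattice reduce to those of the ring.\<close>

lemma (in vector_space) lattice_mem_iff_representation:
  assumes "independent X" "span X = UNIV" "0 \<in> A"
  shows "u \<in> {\<Sum>x\<in>S. scale (c x) x | S c. finite S \<and> S \<subseteq> X \<and> (\<forall>x\<in>S. c x \<in> A)} \<longleftrightarrow>
    (\<forall>x. representation X u x \<in> A)"
proof
  assume "u \<in> {\<Sum>x\<in>S. scale (c x) x | S c. finite S \<and> S \<subseteq> X \<and> (\<forall>x\<in>S. c x \<in> A)}"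
  then obtain S c where S: "finite S" "S \<subseteq> X" "\<forall>x\<in>S. c x \<in> A" "u = (\<Sum>x\<in>S. scale (c x) x)" by auto
  have "representation X u = (\<lambda>x. if x \<in> S then c x else 0)"
  proof (rule representation_eqI[OF assms(1)])
    show "(\<Sum>b | (if b \<in> S then c b else 0) \<noteq> 0. scale (if b \<in> S then c b else 0) b) = u"
      unfolding S(4) using S(1) by (intro sum.mono_neutral_cong_left) auto
    show "finite {b. (if b \<in> S then c b else 0) \<noteq> 0}" by (rule finite_subset[OF _ S(1)]) auto
  qed (use assms S in \<open>auto split: if_splits\<close>)
  then show "\<forall>x. representation X u x \<in> A" using S assms by auto
next
  assume A: "\<forall>x. representation X u x \<in> A"
  have "u = (\<Sum>b | representation X u b \<noteq> 0. scale (representation X u b) b)"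
    using sum_nonzero_representation_eq[OF assms(1), of u] assms(2) by simp
  then show "u \<in> {\<Sum>x\<in>S. scale (c x) x | S c. finite S \<and> S \<subseteq> X \<and> (\<forall>x\<in>S. c x \<in> A)}"
    using finite_representation[of X u] representation_ne_zero[of X u] A by blast
qed

section \<open>The crystal lattice modulo q\<close>

locale quantum_crystal = quantum_rep +
  fixes L :: "'a set" and B :: "'a set set"
  assumes base: "crystal_base l M L B"
begin

lemma crystal_lattice: "crystal_lattice l M L"
  using base by (simp add: crystal_base_def)

lemma L_representation:
  obtains X where "independent X" "span X = UNIV" "\<And>u. u \<in> L \<longleftrightarrow> (\<forall>x. representation X u x \<in> regular_at_0)"
proof -
  obtain X where X: "independent X" "span X = UNIV"
    "L = {\<Sum>x\<in>S. qscale M (c x) x | S c. finite S \<and> S \<subseteq> X \<and> (\<forall>x\<in>S. c x \<in> regular_at_0)}"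
    using crystal_lattice unfolding crystal_lattice_def by blast
  then show thesis using that[OF X(1,2)] lattice_mem_iff_representation[OF X(1,2), of regular_at_0] by simp
qed

lemma L_add: "u \<in> L \<Longrightarrow> v \<in> L \<Longrightarrow> u + v \<in> L"
proof -
  obtain X where X: "independent X" "span X = UNIV" "\<And>u. u \<in> L \<longleftrightarrow> (\<forall>x. representation X u x \<in> regular_at_0)"
    by (rule L_representation) blast
  then show "u \<in> L \<Longrightarrow> v \<in> L \<Longrightarrow> u + v \<in> L"
    by (simp add: representation_add regular_at_0_add)
qed

lemma L_scale: "r \<in> regular_at_0 \<Longrightarrow> u \<in> L \<Longrightarrow> qscale M r u \<in> L"
proof -
  obtain X where X: "independent X" "span X = UNIV" "\<And>u. u \<in> L \<longleftrightarrow> (\<forall>x. representation X u x \<in> regular_at_0)"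
    by (rule L_representation) blast
  then show "r \<in> regular_at_0 \<Longrightarrow> u \<in> L \<Longrightarrow> qscale M r u \<in> L"
    by (simp add: representation_scale regular_at_0_mult)
qed

lemma L_zero: "0 \<in> L"
proof -
  obtain X where X: "independent X" "span X = UNIV" "\<And>u. u \<in> L \<longleftrightarrow> (\<forall>x. representation X u x \<in> regular_at_0)"
    by (rule L_representation) blast
  then show ?thesis by (simp add: representation_zero)
qed

lemma L_sum: "(\<And>i. i \<in> A \<Longrightarrow> f i \<in> L) \<Longrightarrow> (\<Sum>i\<in>A. f i) \<in> L"
  by (induction A rule: infinite_finite_induct) (auto simp: L_zero L_add)

text \<open>Clear the poles of the finitely many coordinates by a power of q, then divide by q as
  often as the result stays in \<open>L\<close>; a nonzero coordinate makes this stop. The outcome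
  is a nonzero class modulo q on the line through \<open>v\<close>.\<close>

lemma primitive_multiple:
  assumes "v \<noteq> 0"
  shows "\<exists>r. qscale M r v \<in> L \<and> qscale M r v \<notin> qscale M qvar ` L"
proof -
  obtain X where X: "independent X" "span X = UNIV" "\<And>u. u \<in> L \<longleftrightarrow> (\<forall>x. representation X u x \<in> regular_at_0)"
    by (rule L_representation) blast
  have rep_scale: "representation X (qscale M r u) x = r * representation X u x" for r u x
    using X by (simp add: representation_scale)
  define Z where "Z = {x. representation X v x \<noteq> 0}"
  have Z: "finite Z" by (simp add: Z_def finite_representation)
  define n where "n x = (SOME n. qvar ^ n * representation X v x \<in> regular_at_0)" for x
  have n: "qvar ^ n x * representation X v x \<in> regular_at_0" for x
    unfolding n_def by (rule someI_ex[OF qvar_power_mult_regular])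
  define N where "N = (\<Sum>x\<in>Z. n x)"
  have "qvar ^ N * representation X v x \<in> regular_at_0" for x
  proof (cases "x \<in> Z")
    case True
    then have "n x \<le> N" unfolding N_def by (rule member_le_sum) (use Z in auto)
    then have "qvar ^ N = qvar ^ (N - n x) * qvar ^ n x" by (simp flip: power_add)
    then show ?thesis using regular_at_0_mult[OF regular_at_0_power n[of x]] by (simp add: mult.assoc)
  qed (simp add: Z_def)
  define w where "w = qscale M (qvar ^ N) v"
  have w: "w \<in> L" "w \<noteq> 0"
    using \<open>\<And>x. qvar ^ N * representation X v x \<in> regular_at_0\<close> assms by (auto simp: w_def X(3) rep_scale)
  have "\<exists>x. representation X w x \<noteq> 0"
  proof (rule ccontr)
    assume "\<not> ?thesis"
    then have "w = 0" using sum_nonzero_representation_eq[OF X(1), of w] X(2) by simp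
    then show False using w(2) by simp
  qed
  then obtain x m where "inverse (qvar ^ m) * representation X w x \<notin> regular_at_0"
    using not_infinitely_qvar_divisible by blast
  then have ex: "\<exists>m. qscale M (inverse (qvar ^ m)) w \<notin> L" unfolding X(3) rep_scale by blast
  define m where "m = (LEAST m. qscale M (inverse (qvar ^ m)) w \<notin> L)"
  have m: "qscale M (inverse (qvar ^ m)) w \<notin> L" unfolding m_def by (rule LeastI_ex[OF ex])
  then obtain k where k: "m = Suc k" using w(1) by (cases m) auto
  have "qscale M (inverse (qvar ^ k)) w \<in> L"
    using not_less_Least[of k "\<lambda>m. qscale M (inverse (qvar ^ m)) w \<notin> L"] k by (auto simp: m_def)
  moreover have "qscale M (inverse (qvar ^ k)) w \<notin> qscale M qvar ` L"
  proof
    assume "qscale M (inverse (qvar ^ k)) w \<in> qscale M qvar ` L"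
    then obtain y where y: "y \<in> L" "qscale M (inverse (qvar ^ k)) w = qscale M qvar y" by auto
    have "y = qscale M (inverse qvar) (qscale M (inverse (qvar ^ k)) w)" unfolding y(2) by simp
    then show False using m y(1) by (simp add: k mult.commute)
  qed
  ultimately show ?thesis
    by (intro exI[of _ "inverse (qvar ^ k) * qvar ^ N"]) (simp add: w_def)
qed

text \<open>\<open>L\<close> contains the weight components of its elements, hence so does
  \<open>qL\<close>.\<close>

lemma components_in_qL:
  assumes J: "finite J" "\<And>j. j \<in> J \<Longrightarrow> wt j \<in> weight_lattice l" "\<And>j. j \<in> J \<Longrightarrow> u j \<in> q_weight_space l M (wt j)"
    and sum: "(\<Sum>j\<in>J. u j) \<in> qscale M qvar ` L"
  shows "(\<Sum>j\<in>{j\<in>J. wt j = x}. u j) \<in> qscale M qvar ` L"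
proof -
  obtain y where y: "y \<in> L" "(\<Sum>j\<in>J. u j) = qscale M qvar y" using sum by auto
  then obtain S c where S: "finite S" "S \<subseteq> weight_lattice l"
    "\<And>z. z \<in> S \<Longrightarrow> c z \<in> L \<and> c z \<in> q_weight_space l M z" "y = (\<Sum>z\<in>S. c z)"
    using crystal_lattice unfolding crystal_lattice_def by (meson IntE)
  \<comment> \<open>The sum type joins the given terms and the weight components of
    \<open>qscale M qvar y\<close> into one vanishing sum.\<close>
  define v where "v = case_sum u (\<lambda>z. - qscale M qvar (c z))"
  define wt' where "wt' = case_sum wt (\<lambda>z. z)"
  have "(\<Sum>j\<in>{j\<in>J <+> S. wt' j = x}. v j) = 0"
  proof (rule weight_components_vanish)
    show "(\<Sum>j\<in>J <+> S. v j) = 0"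
      using J(1) S(1) y(2) by (simp add: sum.Plus v_def S(4) sum_negf scale_sum_right)
    show "v j \<in> q_weight_space l M (wt' j)" if "j \<in> J <+> S" for j
      using that J(3) S(3) by (auto simp: v_def wt'_def intro!: W_scale subspace_neg[OF W_subspace])
    show "wt' j \<in> weight_lattice l" if "j \<in> J <+> S" for j
      using that J(2) S(2) by (auto simp: wt'_def)
  qed (use J S in auto)
  moreover have "{j\<in>J <+> S. wt' j = x} = {j\<in>J. wt j = x} <+> {z\<in>S. z = x}"
    by (auto simp: wt'_def)
  ultimately have "(\<Sum>j\<in>{j\<in>J. wt j = x}. u j) = qscale M qvar (\<Sum>z\<in>{z\<in>S. z = x}. c z)"
    using J(1) S(1) by (simp add: sum.Plus v_def sum_negf scale_sum_right)
  moreover have "(\<Sum>z\<in>{z\<in>S. z = x}. c z) \<in> L" by (rule L_sum) (use S in auto)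
  ultimately show ?thesis by blast
qed

lemma mem_q_coset: "v \<in> q_coset M L u \<longleftrightarrow> v - u \<in> qscale M qvar ` L"
  by (auto simp: q_coset_def image_iff algebra_simps)

lemma qL_add: "u \<in> qscale M qvar ` L \<Longrightarrow> v \<in> qscale M qvar ` L \<Longrightarrow> u + v \<in> qscale M qvar ` L"
  by (auto simp flip: scale_right_distrib intro: L_add)

lemma qL_scale: "r \<in> regular_at_0 \<Longrightarrow> u \<in> qscale M qvar ` L \<Longrightarrow> qscale M r u \<in> qscale M qvar ` L"
  by (auto simp: scale_left_commute[of r] simp del: scale_scale intro: L_scale)

lemma qL_sum: "(\<And>i. i \<in> A \<Longrightarrow> f i \<in> qscale M qvar ` L) \<Longrightarrow> (\<Sum>i\<in>A. f i) \<in> qscale M qvar ` L"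
proof (induction A rule: infinite_finite_induct)
  case (insert a A)
  then show ?case by (simp add: qL_add)
qed (use L_zero in \<open>auto intro!: image_eqI[of _ _ 0]\<close>)

lemma qL_minus: "u \<in> qscale M qvar ` L \<Longrightarrow> - u \<in> qscale M qvar ` L"
  using qL_scale[of "- 1" u] by simp

lemma q_coset_self: "u \<in> q_coset M L u"
  unfolding mem_q_coset using L_zero by (auto intro!: image_eqI[of _ _ 0])

lemma q_coset_eq_iff: "q_coset M L u = q_coset M L v \<longleftrightarrow> u - v \<in> qscale M qvar ` L"
proof
  assume "q_coset M L u = q_coset M L v"
  then show "u - v \<in> qscale M qvar ` L" using q_coset_self[of u] by (simp add: mem_q_coset)
next
  assume uv: "u - v \<in> qscale M qvar ` L"
  have "z - u \<in> qscale M qvar ` L \<longleftrightarrow> z - v \<in> qscale M qvar ` L" for z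
    using qL_add[OF uv, of "z - u"] qL_add[OF qL_minus[OF uv], of "z - v"] by auto
  then show "q_coset M L u = q_coset M L v" by (auto simp: mem_q_coset)
qed

lemma basis: "basis_mod_q M L B"
  using base by (simp add: crystal_base_def)

text \<open>Independence modulo q, applied to \<open>u\<close> alone with coefficient 1.\<close>

lemma B_nonzero:
  assumes "u \<in> L" "q_coset M L u \<in> B"
  shows "u \<notin> qscale M qvar ` L"
proof
  assume "u \<in> qscale M qvar ` L"
  then have "(\<Sum>z\<in>{u}. qscale M (Fract [:1:] 1) z) \<in> q_coset M L 0"
    by (simp add: mem_q_coset fract_collapse flip: one_pCons)
  moreover have "\<forall>S (c :: 'a \<Rightarrow> rat). finite S \<and> S \<subseteq> L \<and> inj_on (q_coset M L) S \<and> q_coset M L ` S \<subseteq> B \<and>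
        (\<Sum>u\<in>S. qscale M (Fract [:c u:] 1) u) \<in> q_coset M L 0 \<longrightarrow> (\<forall>u\<in>S. c u = 0)"
    using basis by (simp add: basis_mod_q_def)
  from this[rule_format, of "{u}" "\<lambda>_. 1" u] have "(1 :: rat) = 0"
    using assms calculation by simp
  then show False by simp
qed

text \<open>Representatives of two different weights differ by an element of \<open>qL\<close>, so
  its component \<open>u\<close> would lie in \<open>qL\<close> as well.\<close>

lemma crystal_weight_unique:
  assumes "q_coset M L u \<in> B" "u \<in> L" "u \<in> q_weight_space l M x" "x \<in> weight_lattice l"
    "crystal_weight l M L (q_coset M L u) y"
  shows "x = y"
proof (rule ccontr)
  assume "x \<noteq> y"
  obtain v where v: "y \<in> weight_lattice l" "v \<in> L" "v \<in> q_weight_space l M y" "q_coset M L u = q_coset M L v"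
    using assms(5) by (auto simp: crystal_weight_def)
  have "(\<Sum>j\<in>{j\<in>{x, y}. j = x}. if j = x then u else - v) \<in> qscale M qvar ` L"
  proof (rule components_in_qL)
    show "(\<Sum>j\<in>{x, y}. if j = x then u else - v) \<in> qscale M qvar ` L"
      using v(4) \<open>x \<noteq> y\<close> by (simp add: q_coset_eq_iff)
  qed (use assms v \<open>x \<noteq> y\<close> in \<open>auto intro!: subspace_neg[OF W_subspace]\<close>)
  moreover have "{j\<in>{x, y}. j = x} = {x}" by auto
  ultimately show False using B_nonzero[OF assms(2,1)] by simp
qed

text \<open>Rescale a weight vector so that its class modulo q is nonzero, and expand that class in
  \<open>B\<close>. If no element of \<open>B\<close> had weight \<open>x\<close>, the part of
  weight \<open>x\<close> would be the vector alone, and it would lie in \<open>qL\<close>.\<close>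

lemma weight_has_crystal_element:
  assumes "x \<in> weights"
  shows "\<exists>b\<in>B. crystal_weight l M L b x"
proof (rule ccontr)
  assume none: "\<not> ?thesis"
  obtain v where "x \<in> weight_lattice l" "v \<in> q_weight_space l M x" "v \<noteq> 0"
    using assms by (auto simp: weights_iff)
  moreover from this obtain r where "qscale M r v \<in> L" "qscale M r v \<notin> qscale M qvar ` L"
    using primitive_multiple by blast
  ultimately obtain u where u: "u \<in> L" "u \<notin> qscale M qvar ` L" "u \<in> q_weight_space l M x" "x \<in> weight_lattice l"
    using W_scale by blast
  have "\<forall>x\<in>L. \<exists>S (c :: 'a \<Rightarrow> rat). finite S \<and> S \<subseteq> L \<and> q_coset M L ` S \<subseteq> B \<and>
        x \<in> q_coset M L (\<Sum>u\<in>S. qscale M (Fract [:c u:] 1) u)"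
    using basis unfolding basis_mod_q_def by (elim conjE)
  from bspec[OF this u(1)] obtain S and c :: "'a \<Rightarrow> rat" where S: "finite S" "S \<subseteq> L" "q_coset M L ` S \<subseteq> B"
      "u \<in> q_coset M L (\<Sum>z\<in>S. qscale M (Fract [:c z:] 1) z)"
    by blast
  have "\<exists>y z'. y \<in> weight_lattice l \<and> z' \<in> q_weight_space l M y \<and> z' \<in> L \<and> q_coset M L z = q_coset M L z'
      \<and> crystal_weight l M L (q_coset M L z) y"
    if "z \<in> S" for z
  proof -
    have "q_coset M L z \<in> B" using S(3) that by auto
    then obtain y where "crystal_weight l M L (q_coset M L z) y" using base unfolding crystal_base_def by blast
    then show ?thesis unfolding crystal_weight_def by blast
  qed
  then obtain y z' where yz: "\<And>z. z \<in> S \<Longrightarrow> y z \<in> weight_lattice l \<and> z' z \<in> q_weight_space l M (y z) \<and> z' z \<in> L \<and>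
      q_coset M L z = q_coset M L (z' z) \<and> crystal_weight l M L (q_coset M L z) (y z)"
    by metis
  have neq: "y z \<noteq> x" if "z \<in> S" for z using none yz[OF that] S(3) that by blast
  define J where "J = insert None (Some ` S)"
  define w where "w j = (case j of None \<Rightarrow> u | Some z \<Rightarrow> - qscale M (Fract [:c z:] 1) (z' z))" for j
  define wt where "wt j = (case j of None \<Rightarrow> x | Some z \<Rightarrow> y z)" for j
  \<comment> \<open>The representatives \<open>z\<close> need not be weight vectors; modulo
    \<open>qL\<close> they are replaced by the weight vectors \<open>z' z\<close>.\<close>
  have "u - (\<Sum>z\<in>S. qscale M (Fract [:c z:] 1) z) + (\<Sum>z\<in>S. qscale M (Fract [:c z:] 1) (z - z' z)) \<in> qscale M qvar ` L"
    using S(4) yz by (intro qL_add qL_sum qL_scale regular_at_0_const) (simp_all add: mem_q_coset flip: q_coset_eq_iff)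
  then have "u - (\<Sum>z\<in>S. qscale M (Fract [:c z:] 1) (z' z)) \<in> qscale M qvar ` L"
    by (simp add: scale_right_diff_distrib sum_subtractf)
  then have "(\<Sum>j\<in>J. w j) \<in> qscale M qvar ` L"
    using S(1) by (simp add: J_def w_def sum.reindex sum_negf)
  then have "(\<Sum>j\<in>{j\<in>J. wt j = x}. w j) \<in> qscale M qvar ` L"
    by (rule components_in_qL[rotated -1])
       (use S(1) yz u in \<open>auto simp: J_def wt_def w_def intro!: W_scale subspace_neg[OF W_subspace]\<close>)
  moreover have "{j\<in>J. wt j = x} = {None}" using neq by (auto simp: J_def wt_def)
  ultimately show False using u(2) by (simp add: w_def)
qed

lemma kashiwara_L:
  "i \<le> l \<Longrightarrow> u \<in> L \<Longrightarrow> kashiwara_e l M i u \<in> L"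
  "i \<le> l \<Longrightarrow> u \<in> L \<Longrightarrow> kashiwara_f l M i u \<in> L"
  using crystal_lattice by (auto simp: crystal_lattice_def)

text \<open>
  The union of cosets defining \<open>bar_e\<close> is a single coset by the stability of \<open>B\<close>, so it is the coset
  of any one of the vectors involved.
\<close>

lemma bar_eq_coset:
  assumes "i \<le> l" "q_coset M L u \<in> B"
  shows "bar_e l M L i (q_coset M L u) = q_coset M L (kashiwara_e l M i u)"
    and "bar_f l M L i (q_coset M L u) = q_coset M L (kashiwara_f l M i u)"
proof -
  have B: "B \<subseteq> q_coset M L ` L" using basis by (simp add: basis_mod_q_def)
  have *: "bar_e l M L i (q_coset M L u) \<in> B \<union> {q_coset M L 0}"
    "bar_f l M L i (q_coset M L u) \<in> B \<union> {q_coset M L 0}"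
    using base assms by (auto simp: crystal_base_def)
  obtain z where z: "bar_e l M L i (q_coset M L u) = q_coset M L z" using *(1) B by blast
  have "kashiwara_e l M i u \<in> bar_e l M L i (q_coset M L u)"
    using q_coset_self by (auto simp: bar_e_def)
  then show "bar_e l M L i (q_coset M L u) = q_coset M L (kashiwara_e l M i u)"
    unfolding z mem_q_coset q_coset_eq_iff[symmetric] by simp
  obtain z where z: "bar_f l M L i (q_coset M L u) = q_coset M L z" using *(2) B by blast
  have "kashiwara_f l M i u \<in> bar_f l M L i (q_coset M L u)"
    using q_coset_self by (auto simp: bar_f_def)
  then show "bar_f l M L i (q_coset M L u) = q_coset M L (kashiwara_f l M i u)"
    unfolding z mem_q_coset q_coset_eq_iff[symmetric] by simp
qed

lemma bar_shifts_weight: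
  assumes "i \<le> l" "b \<in> B" "b' \<in> B" "crystal_weight l M L b x" "crystal_weight l M L b' y"
  shows "bar_e l M L i b = b' \<Longrightarrow> y = x + simple_root l i"
    and "bar_f l M L i b = b' \<Longrightarrow> y = x - simple_root l i"
proof -
  obtain u where u: "x \<in> weight_lattice l" "u \<in> L" "u \<in> q_weight_space l M x" "b = q_coset M L u"
    using assms(4) by (auto simp: crystal_weight_def)
  note bar = bar_eq_coset[OF assms(1) assms(2)[unfolded u(4)]]
  show "y = x + simple_root l i" if "bar_e l M L i b = b'"
    using crystal_weight_unique[OF _ kashiwara_L(1)[OF assms(1) u(2)] kashiwara_weight_space(1)[OF assms(1) u(1,3)]]
      assms(3,5) bar(1) that u(4) weight_lattice_add[OF u(1) simple_root_in_weight_lattice] by metis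
  show "y = x - simple_root l i" if "bar_f l M L i b = b'"
    using crystal_weight_unique[OF _ kashiwara_L(2)[OF assms(1) u(2)] kashiwara_weight_space(2)[OF assms(1) u(1,3)]]
      assms(3,5) bar(2) that u(4) weight_lattice_diff[OF u(1) simple_root_in_weight_lattice] by metis
qed

section \<open>Strings in the crystal\<close>

lemma string_of_crystal_elements:
  assumes i: "i \<le> l" and x: "x \<in> weights" "fst x i = - int w" "x - simple_root l i \<notin> weights"
    "x + int_mult (int (Suc w)) (simple_root l i) \<notin> weights"
  shows "\<exists>b. (\<forall>j\<le>w. b j \<in> B \<and> crystal_weight l M L (b j) (x + int_mult (int j) (simple_root l i))) \<and>
    (\<forall>j<w. bar_e l M L i (b j) = b (Suc j) \<and> bar_f l M L i (b (Suc j)) = b j)"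
proof -
  interpret sl2: sl2_graded "qscale M" "qE M i" "qF M i"
      "\<lambda>f. \<Union>x\<in>{x\<in>weight_lattice l. fst x i = f}. q_weight_space l M x" qint_z
    by (rule sl2_graded[OF i])
  interpret dual: sl2_graded "qscale M" "qF M i" "qE M i"
      "\<lambda>f. \<Union>x\<in>{x\<in>weight_lattice l. fst x i = - f}. q_weight_space l M x" qint_z
    by (rule sl2.dual)
  obtain b0 u where b0: "b0 \<in> B" "b0 = q_coset M L u" and u: "u \<in> L" "u \<in> q_weight_space l M x"
    using weight_has_crystal_element[OF x(1)] by (auto simp: crystal_weight_def)
  have xl: "x \<in> weight_lattice l" using x(1) by (simp add: weights_iff)
  have "qF M i u \<in> q_weight_space l M (x - simple_root l i)" by (rule F_W[OF i u(2)])
  then have Fu: "qF M i u = 0"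
    using x(3) weight_lattice_diff[OF xl simple_root_in_weight_lattice[of l i]] unfolding weights_iff by blast
  define y where "y = x + int_mult (int w) (simple_root l i)"
  have yl: "y \<in> weight_lattice l" using string_in_weight_lattice(1)[OF xl] by (simp add: y_def)
  have fst_y: "fst y i = int w" using x(2) by (simp add: y_def fst_simple_root_self[OF rank i])
  have "qE M i ((qE M i ^^ w) u) \<in> q_weight_space l M (x + int_mult (int (Suc w)) (simple_root l i))"
    using E_pow_W[OF i u(2), of "Suc w"] by simp
  then have Ey: "qE M i ((qE M i ^^ w) u) = 0"
    using x(4) string_in_weight_lattice(1)[OF xl] unfolding weights_iff by blast
  \<comment> \<open>The scalar by which going up the whole string from the lowest vector
    \<open>u\<close> and down again multiplies \<open>u\<close>.\<close>
  define r where "r = (\<Prod>j\<in>{0<..w}. dual.s (int w) j)"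
  have "dual.s (int w) j \<noteq> 0" if "j \<in> {0<..w}" for j
    by (rule dual.s_nonzero) (use that in auto)
  then have r: "r \<noteq> 0" by (simp add: r_def)
  have "u \<in> (\<Union>x\<in>{x\<in>weight_lattice l. fst x i = - int w}. q_weight_space l M x)"
    using u(2) xl x(2) by blast
  from dual.X_pow_Y_pow_singular[OF this Fu, of w 0]
  have FE: "(qF M i ^^ w) ((qE M i ^^ w) u) = qscale M r u" by (simp add: r_def)
  \<comment> \<open>Normalised so that the \<open>w\<close>-th divided power takes \<open>t\<close>
    exactly to \<open>u\<close>.\<close>
  define t where "t = qscale M (qfact w * inverse r) ((qE M i ^^ w) u)"
  have t: "t \<in> q_weight_space l M y" "qE M i t = 0"
    using E_pow_W[OF i u(2), of w] Ey by (auto simp: t_def y_def W_scale linear_ops[OF E_linear[OF i]])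
  have Ft: "dividedF M i w t = u"
  proof -
    have "inverse (qfact w) * (qfact w * inverse r * r) = 1"
      using r qfact_nonzero[of w] by (simp add: field_simps)
    then show ?thesis
      by (simp add: t_def dividedF_def linear_ops[OF linear_funpow[OF F_linear[OF i]]] FE)
  qed
  define b where "b j = q_coset M L (dividedF M i (w - j) t)" for j
  have e: "kashiwara_e l M i (dividedF M i (w - j) t) = dividedF M i (w - Suc j) t" if "j < w" for j
    using kashiwara_on_string(1)[OF i yl t, of "w - j"] that fst_y by simp
  have in_B: "dividedF M i (w - j) t \<in> L \<and> b j \<in> B" if "j \<le> w" for j
    using that
  proof (induction j)
    case 0
    show ?case using Ft u b0 by (simp add: b_def)
  next
    case (Suc j)
    then have j: "j < w" and IH: "dividedF M i (w - j) t \<in> L" "b j \<in> B" by auto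
    have L: "dividedF M i (w - Suc j) t \<in> L" using kashiwara_L(1)[OF i IH(1)] e[OF j] by simp
    have bar: "bar_e l M L i (b j) = b (Suc j)"
      using bar_eq_coset(1)[OF i] IH(2) e[OF j] by (simp add: b_def)
    \<comment> \<open>If the raised vector were q times some \<open>z\<close> in \<open>L\<close>,
      lowering \<open>z\<close> would put the previous vector divided by q into \<open>L\<close>,
      making the class \<open>b j\<close> zero.\<close>
    have "b (Suc j) \<noteq> q_coset M L 0"
    proof
      assume "b (Suc j) = q_coset M L 0"
      then obtain z where z: "z \<in> L" "dividedF M i (w - Suc j) t = qscale M qvar z"
        by (auto simp: b_def q_coset_eq_iff)
      define t' where "t' = qscale M (inverse qvar) t"
      have t': "t' \<in> q_weight_space l M y" "qE M i t' = 0"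
        using t by (auto simp: t'_def W_scale linear_ops[OF E_linear[OF i]])
      have scale: "dividedF M i k t' = qscale M (inverse qvar) (dividedF M i k t)" for k
        by (simp add: t'_def dividedF_def linear_ops[OF linear_funpow[OF F_linear[OF i]]] mult.commute)
      have "z = dividedF M i (w - Suc j) t'" unfolding scale z(2) by simp
      then have "kashiwara_f l M i z = dividedF M i (Suc (w - Suc j)) t'"
        using kashiwara_on_string(2)[OF i yl t', of "w - Suc j"] fst_y by simp
      then have "dividedF M i (w - j) t' \<in> L"
        using kashiwara_L(2)[OF i z(1)] j by (simp add: Suc_diff_Suc)
      then have "qscale M qvar (dividedF M i (w - j) t') \<in> qscale M qvar ` L" by blast
      then have "dividedF M i (w - j) t \<in> qscale M qvar ` L" by (simp add: scale)
      then show False using B_nonzero[OF IH(1)] IH(2) by (simp add: b_def)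
    qed
    moreover have "bar_e l M L i (b j) \<in> B \<union> {q_coset M L 0}"
      using base i IH(2) by (auto simp: crystal_base_def)
    ultimately show ?case using L bar by auto
  qed
  show ?thesis
  proof (intro exI[of _ b] conjI allI impI)
    fix j assume j: "j \<le> w"
    then show "b j \<in> B" using in_B by blast
    have "y - int_mult (int (w - j)) (simple_root l i) = x + int_mult (int j) (simple_root l i)"
      using j by (simp add: y_def of_nat_diff int_mult_diff)
    then show "crystal_weight l M L (b j) (x + int_mult (int j) (simple_root l i))"
      using dividedF_weight_space[OF i t(1), of "w - j"] in_B[OF j] string_in_weight_lattice(1)[OF xl]
      by (auto simp: crystal_weight_def b_def)
  next
    fix j assume j: "j < w"
    then show bar: "bar_e l M L i (b j) = b (Suc j)"
      using bar_eq_coset(1)[OF i] in_B[of j] e[OF j] by (simp add: b_def)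
    have "bar_f l M L i (b (Suc j)) = b j \<longleftrightarrow> b (Suc j) = bar_e l M L i (b j)"
      using base i in_B[of j] in_B[of "Suc j"] j unfolding crystal_base_def by simp
    then show "bar_f l M L i (b (Suc j)) = b j" using bar by simp
  qed
qed

text \<open>An edge of residue \<open>i\<close> changes the weight by alpha_i up or down. Since the
  positions just beyond both ends are not weights, no path can leave the string, which gives
  maximality.\<close>

lemma residue_string_between_ends:
  assumes i: "i \<le> l" and x: "x \<in> weights" "fst x i = - int w" "x - simple_root l i \<notin> weights"
    "x + int_mult (int (Suc w)) (simple_root l i) \<notin> weights"
  defines "y \<equiv> x + int_mult (int w) (simple_root l i)"
  shows "\<exists>S. is_residue_string l weights M L B i S \<and> string_ends l i S y x"
proof -
  define p where "p j = x + int_mult (int j) (simple_root l i)" for j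
  have p_Suc: "p (Suc j) = p j + simple_root l i" for j
    using int_mult_add[of 1 "int j"] by (simp add: p_def)
  have p_weight: "p j \<in> weights" if "j \<le> w" for j
    unfolding p_def by (rule weights_add_string[OF i x(1)]) (use that x(2) in simp)
  obtain b where b: "\<And>j. j \<le> w \<Longrightarrow> b j \<in> B \<and> crystal_weight l M L (b j) (p j)"
    "\<And>j. j < w \<Longrightarrow> bar_e l M L i (b j) = b (Suc j) \<and> bar_f l M L i (b (Suc j)) = b j"
    using string_of_crystal_elements[OF i x] unfolding p_def by blast
  define S where "S = p ` {..w}"
  have edge: "reduced_edge l weights M L B i (p j) (p (Suc j))"
      "reduced_edge l weights M L B i (p (Suc j)) (p j)" if "j < w" for j
    using b(1)[of j] b(1)[of "Suc j"] b(2)[OF that] p_weight[of j] p_weight[of "Suc j"] that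
    unfolding reduced_edge_def by (auto simp del: split_paired_Ex intro: bexI[of _ "b j"] bexI[of _ "b (Suc j)"])
  define R where "R = {(s, t). s \<in> S \<and> t \<in> S \<and> reduced_edge l weights M L B i s t}"
  have R: "(p j, p (Suc j)) \<in> R" "(p (Suc j), p j) \<in> R" if "j < w" for j
    using edge[OF that] that by (auto simp: R_def S_def)
  have path: "(x, p j) \<in> R\<^sup>* \<and> (p j, x) \<in> R\<^sup>*" if "j \<le> w" for j
    using that
  proof (induction j)
    case 0
    show ?case by (simp add: p_def)
  next
    case (Suc j)
    then show ?case using R[of j] by (auto intro: rtrancl_into_rtrancl converse_rtrancl_into_rtrancl)
  qed
  have "edge_connected l weights M L B i S"
    unfolding edge_connected_def R_def[symmetric] using path p_weight
    by (auto simp: S_def intro: rtrancl_trans[of _ x])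
  moreover have "T \<subseteq> S" if T: "edge_connected l weights M L B i T" "S \<subseteq> T" for T
  proof
    fix t assume "t \<in> T"
    moreover have "x \<in> S" unfolding S_def by (rule image_eqI[of _ _ 0]) (auto simp: p_def)
    ultimately have "(x, t) \<in> {(s, t). s \<in> T \<and> t \<in> T \<and> reduced_edge l weights M L B i s t}\<^sup>*"
      using T by (auto simp: edge_connected_def simp del: split_paired_All)
    then show "t \<in> S"
    proof (induction rule: rtrancl_induct)
      case base
      show ?case by fact
    next
      case (step s t)
      then obtain j where j: "j \<le> w" "s = p j" by (auto simp: S_def)
      have t: "t \<in> weights" "t = s + simple_root l i \<or> t = s - simple_root l i"
        using step.hyps(2) bar_shifts_weight[OF i] unfolding reduced_edge_def by blast+
      show ?case using t(2)
      proof
        assume "t = s + simple_root l i"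
        then have t': "t = p (Suc j)" using j p_Suc by simp
        then have "j \<noteq> w" using t(1) x(4) by (auto simp: p_def)
        then show ?thesis using j t' by (auto simp: S_def)
      next
        assume t': "t = s - simple_root l i"
        show ?thesis
        proof (cases j)
          case 0
          then show ?thesis using t' t(1) x(3) j by (simp add: p_def)
        next
          case (Suc k)
          then have "t = p k" using t' j p_Suc by simp
          then show ?thesis using Suc j by (auto simp: S_def)
        qed
      qed
    qed
  qed
  ultimately have "is_residue_string l weights M L B i S"
    unfolding is_residue_string_def using S_def by blast
  moreover have "string_ends l i S y x"
  proof -
    have "p j = y - int_mult (int (w - j)) (simple_root l i)" if "j \<le> w" for j
      using that by (simp add: p_def y_def of_nat_diff int_mult_diff)
    moreover have "y - int_mult (int k) (simple_root l i) = p (w - k)" if "k \<le> w" for k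
      using that by (simp add: p_def y_def of_nat_diff int_mult_diff)
    ultimately have "S = {y - int_mult (int k) (simple_root l i) | k. k \<le> w}"
      unfolding S_def image_def by (metis atMost_iff diff_le_self)
    moreover have "x = y - int_mult (int w) (simple_root l i)" by (simp add: y_def)
    ultimately show ?thesis unfolding string_ends_def by blast
  qed
  ultimately show ?thesis by blast
qed

end

section \<open>Finiteness and the bound on the degree\<close>

text \<open>Isolates the delta coefficient, whose factor is twice the level; at positive level it
  can be solved for.\<close>

lemma wt_form_self:
  "wt_form l x x = (\<Sum>i\<le>l. \<Sum>j\<le>l. of_int (fst x i * fst x j) *
        (of_nat (min i j) - of_nat i * of_nat j / of_nat (Suc l))) + 2 * of_int (level l x) * of_int (snd x)"
  by (simp add: wt_form_def level_def)

lemma finite_weights_bounded_below: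
  fixes m :: int
  assumes "k > 0"
  shows "finite {x \<in> weight_lattice l. level l x = k \<and> wt_form l x x = r \<and> (\<forall>i\<le>l. m \<le> fst x i)}" (is "finite ?A")
proof (rule finite_imageD)
  show "inj_on fst ?A"
  proof (rule inj_onI)
    fix x y assume "x \<in> ?A" "y \<in> ?A" "fst x = fst y"
    then have "wt_form l x x = wt_form l y y" "level l x = k" "level l y = k" by auto
    then have "snd x = snd y"
      using assms \<open>fst x = fst y\<close> unfolding wt_form_self by simp
    then show "x = y" using \<open>fst x = fst y\<close> by (simp add: prod_eq_iff)
  qed
  \<comment> \<open>The other \<open>l\<close> coordinates contribute at least
    \<open>int l * m\<close> to the total \<open>k\<close>.\<close>
  have "fst x i \<in> {m..k - int l * m}" if x: "x \<in> ?A" and i: "i \<le> l" for x i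
  proof -
    have "(\<Sum>j\<in>{..l} - {i}. m) \<le> (\<Sum>j\<in>{..l} - {i}. fst x j)" using x by (intro sum_mono) auto
    moreover have "(\<Sum>j\<in>{..l}. fst x j) = fst x i + (\<Sum>j\<in>{..l} - {i}. fst x j)"
      using i by (intro sum.remove) auto
    ultimately show ?thesis using x i by (auto simp: level_def)
  qed
  then have "fst ` ?A \<subseteq> {f. \<forall>i. (i \<in> {..l} \<longrightarrow> f i \<in> {m..k - int l * m}) \<and> (i \<notin> {..l} \<longrightarrow> f i = 0)}"
    by (auto simp: weight_lattice_def)
  moreover have "finite {f. \<forall>i. (i \<in> {..l} \<longrightarrow> f i \<in> {m..k - int l * m}) \<and> (i \<notin> {..l} \<longrightarrow> f i = 0)}"
    by (rule finite_set_of_finite_funs) auto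
  ultimately show "finite (fst ` ?A)" by (rule finite_subset)
qed

theorem proposition3p2:
  fixes l :: nat and a :: "nat \<Rightarrow> nat" and \<Lambda> :: weight
    and V :: "'v::ab_group_add lie_rep"
    and M :: "'w::ab_group_add q_rep"
    and L :: "'w set" and B :: "'w set set"
    and P :: "weight set"
    and d :: nat
  assumes "l \<ge> 1"
    and "\<Lambda> = (\<Sum>i\<le>l. int_mult (int (a i)) (fundamental_weight i))"
    and "lie_irreducible_hw l \<Lambda> V"
    and "P = lie_weights l V"
    and "q_irreducible_hw l \<Lambda> M"
    and "crystal_base l M L B"
  shows "let Q = (\<lambda>N::nat. \<forall>x\<in>P. defect l \<Lambda> x = of_nat d \<and> N \<le> degree_of_weight l \<Lambda> x \<longrightarrow>
               (\<exists>i\<le>l. \<exists>S y. is_residue_string l P M L B i S \<and> string_ends l i S y x \<and>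
                  degree_of_weight l \<Lambda> y < degree_of_weight l \<Lambda> x))
         in \<exists>N. Q N \<and> (\<forall>N'. Q N' \<longrightarrow> N \<le> N')"
proof -
  have fst_\<Lambda>: "fst \<Lambda> j = (if j \<le> l then int (a j) else 0)" for j
    unfolding assms(2) by (simp add: fst_sum sum_fun_apply fundamental_weight_def of_bool_def
      if_distrib[of "\<lambda>x. _ * x"] cong: if_cong)
  then have \<Lambda>: "\<Lambda> \<in> weight_lattice l" "\<And>i. i \<le> l \<Longrightarrow> fst \<Lambda> i \<ge> 0" by (auto simp: weight_lattice_def)
  note lie = lie_highest_weight_rep[OF assms(1) \<Lambda> assms(3)]
  interpret lie: highest_weight_rep "lscale V" l "lE V" "lF V" "lH V" "\<lambda>h x. of_int (pairing l h x)"
    of_int "lie_weight_space l V" \<Lambda> by (rule lie)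
  interpret quantum_crystal l M \<Lambda> L B
    using assms \<Lambda> by unfold_locales auto
  have "P = lie.weights"
    unfolding assms(4) lie_weights_def lie.weights_def ..
  then have P: "P = weights"
    using weights_subset_of_same_highest_weight[OF lie highest_weight_rep_axioms]
      weights_subset_of_same_highest_weight[OF highest_weight_rep_axioms lie] by blast
  define Q where "Q N \<longleftrightarrow> (\<forall>x\<in>P. defect l \<Lambda> x = of_nat d \<and> N \<le> degree_of_weight l \<Lambda> x \<longrightarrow>
               (\<exists>i\<le>l. \<exists>S y. is_residue_string l P M L B i S \<and> string_ends l i S y x \<and>
                  degree_of_weight l \<Lambda> y < degree_of_weight l \<Lambda> x))" for N
  have "\<exists>N. Q N"
  proof (cases "level l \<Lambda> = 0")
    case True
    have "degree_of_weight l \<Lambda> \<Lambda> = 0"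
      using degree_of_weight_eq[OF assms(1), of "\<lambda>_. 0" \<Lambda>] by (simp add: root_sum_def)
    \<comment> \<open>The only weight has degree 0, so nothing is left to check from degree 1
      on.\<close>
    then have "Q 1" using weights_level_zero[OF True] P by (simp add: Q_def)
    then show ?thesis ..
  next
    case False
    then have level: "level l \<Lambda> > 0" using sum_nonneg[of "{..l}" "fst \<Lambda>"] \<Lambda>(2) by (simp add: level_def order_less_le)
    define A where "A = {x \<in> weights. defect l \<Lambda> x = of_nat d \<and> (\<forall>i\<le>l. - int d \<le> fst x i)}"
    have "finite A"
    proof (rule finite_subset[OF _ finite_weights_bounded_below[OF level]])
      show "A \<subseteq> {x \<in> weight_lattice l. level l x = level l \<Lambda> \<and>
          wt_form l x x = wt_form l \<Lambda> \<Lambda> - 2 * of_nat d \<and> (\<forall>i\<le>l. - int d \<le> fst x i)}"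
      proof
        fix x assume "x \<in> A"
        then show "x \<in> {x \<in> weight_lattice l. level l x = level l \<Lambda> \<and>
            wt_form l x x = wt_form l \<Lambda> \<Lambda> - 2 * of_nat d \<and> (\<forall>i\<le>l. - int d \<le> fst x i)}"
          using weights_level[of x] weights_iff[of x] by (simp add: A_def defect_def)
      qed
    qed
    then obtain N where N: "\<forall>n\<in>degree_of_weight l \<Lambda> ` A. n < N"
      using finite_nat_set_iff_bounded by blast
    have "Q N"
      unfolding Q_def P
    proof (intro ballI impI, elim conjE)
      fix x assume x: "x \<in> weights" "defect l \<Lambda> x = of_nat d" "N \<le> degree_of_weight l \<Lambda> x"
      then have "x \<notin> A" using N by auto
      then obtain i where i: "i \<le> l" "fst x i < - int d" using x by (auto simp: A_def not_le)
      define w where "w = nat (- fst x i)"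
      have w: "fst x i = - int w" "d < w" using i(2) by (auto simp: w_def)
      define y where "y = x + int_mult (int w) (simple_root l i)"
      \<comment> \<open>This defect and the one beyond the other end both equal
        \<open>d - w - 1\<close>: the simple reflection exchanges the two weights.\<close>
      have "defect l \<Lambda> (x + int_mult (- 1) (simple_root l i)) < 0"
        unfolding defect_add_simple_root[OF assms(1) i(1)] x(2) w(1) using w(2) by simp
      then have low: "x - simple_root l i \<notin> weights"
        using defect_nonneg[of "x - simple_root l i"] by (auto simp: int_mult_minus)
      have "defect l \<Lambda> (x + int_mult (int (Suc w)) (simple_root l i)) =
          of_int (int d - int w - 1)"
        unfolding defect_add_simple_root[OF assms(1) i(1)] x(2) w(1) by (simp add: algebra_simps)
      also have "\<dots> < 0" using w(2) by simp
      finally have high: "x + int_mult (int (Suc w)) (simple_root l i) \<notin> weights"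
        using defect_nonneg by fastforce
      obtain S where S: "is_residue_string l weights M L B i S" "string_ends l i S y x"
        using residue_string_between_ends[OF i(1) x(1) w(1) low high] unfolding y_def by blast
      have "y \<in> weights" unfolding y_def by (rule weights_add_string[OF i(1) x(1)]) (simp add: w)
      then have "degree_of_weight l \<Lambda> y < degree_of_weight l \<Lambda> x"
        using degree_of_weight_add_simple_root[OF assms(1) i(1) weights_le[OF x(1)], of w] weights_le w(2)
        unfolding y_def by simp
      then show "\<exists>i\<le>l. \<exists>S y. is_residue_string l weights M L B i S \<and> string_ends l i S y x \<and>
          degree_of_weight l \<Lambda> y < degree_of_weight l \<Lambda> x"
        using i(1) S by blast
    qed
    then show ?thesis ..
  qed
  then have "\<exists>N. Q N \<and> (\<forall>N'. Q N' \<longrightarrow> N \<le> N')" by (metis LeastI_ex Least_le)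
  then show ?thesis unfolding Let_def Q_def .
qed

end
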